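(* Let $p\ge1$ and let $(Z_t)_{t\in\mathbb Z}$ be i.i.d. real random variables with $\mathbb E Z_t=0$, $\mathbb E Z_t^2=1$, $\mathbb E|Z_t|^{4(1+\delta)}<\infty$ for some $\delta>0$, having a positive density on an interval containing zero. Let $a_0,\dots,a_p:[0,1]\to[0,\infty)$ be functions for which there are constants $0<\rho,Q,M<\infty$, $0<\nu<1$ and a positive sequence $(\ell(j))_{j\ge0}$ with $\sum_{j\ge1}j/\ell(j)<\infty$ such that $\inf_ua_0(u)>\rho$; $\sup_ua_j(u)\le Q/\ell(j)$ and $|a_j(u)-a_j(v)|\le M|u-v|/\ell(j)$ for $0\le j\le p$ and all $u,v\in[0,1]$; $Q\sum_{j\ge1}1/\ell(j)\le1-\nu$; and $\{\mathbb E(Z_0^{12})\}^{1/6}\sum_{j=1}^pQ/\ell(j)\le1-\nu$. Suppose the third derivatives of the $a_j$ exist with $\sup_{u}|\partial^ia_j(u)/\partial u^i|\le C$ for $i=1,2,3$, $j=0,\dots,p$ and a finite $C$ independent of $i$ and $j$. Let $0<\rho_1\le\rho_2<\infty$, $\Omega=\{(\alpha_0,\dots,\alpha_p):\sum_{j=1}^p\alpha_j\le1,\ \rho_1\le\alpha_0\le\rho_2,\ \rho_1\le\alpha_i\text{ for }i=1,\dots,p\}$, and suppose $\mathbf a_u=(a_0(u),\dots,a_p(u))\in\mathrm{Int}(\Omega)$ for each $u\in(0,1]$. Let $\{X_{t,N}:t=1,\dots,N\}$ be the tvARCH($p$) process with these coefficients, and let $W:[-1/2,1/2]\to\mathbb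 R$ be a kernel function of bounded variation with $\int_{-1/2}^{1/2}W(x)\,dx=1$ and $\int_{-1/2}^{1/2}W(x)x\,dx=0$. Let $u_0\in(0,1)$ and $t_0=t_0(N)\in\mathbb N$ with $|u_0-t_0/N|<1/N$, and $b=b(N)\to0$, $bN\to\infty$ as $N\to\infty$. Then $$\mathbb E(\nabla\mathcal B_{t_0,N}(\mathbf a_{u_0}))=\frac12b^2w(2)\left.\frac{\partial^2\nabla\mathcal L(u,\mathbf a_{u_0})}{\partial u^2}\right|_{u=u_0}+O\left(b^3+\frac1N\right)$$ and $$\mathrm{var}(\nabla\mathcal B_{t_0,N}(\mathbf a_{u_0}))=O\left(b^6+\frac1N\right),$$ where $w(2)=\int_{-1/2}^{1/2}W(x)x^2\,dx$.
   Context: The tvARCH($p$) process satisfies $X_{t,N}=\sigma_{t,N}Z_t$, $\sigma_{t,N}^2=a_0(t/N)+\sum_{j=1}^pa_j(t/N)X_{t-j,N}^2$ for $t=1,\dots,N$; with the conventions $a_j(u)=0$ for $u<0$ and $a_j=0$ for $j>p$, its square is the almost surely unique causal solution $X_{t,N}^2=a_0(\frac tN)Z_t^2+\sum_{k\ge1}\sum_{j_1,\dots,j_k\ge1}a_0(\frac{t-\sum_{s=1}^kj_s}{N})\prod_{r=1}^ka_{j_r}(\frac{t-\sum_{s=1}^{r-1}j_s}{N})\prod_{r=0}^kZ^2_{t-\sum_{s=1}^rj_s}$. For $u\in(0,1]$, $\{\tilde X_t(u)\}_{t\in\mathbb Z}$ is the stationary ARCH($p$) process $\tilde X_t(u)=\sigma_t(u)Z_t$,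 $\sigma_t(u)^2=a_0(u)+\sum_{j=1}^pa_j(u)\tilde X_{t-j}(u)^2$, with square given almost surely by $\tilde X_t(u)^2=a_0(u)Z_t^2+\sum_{k\ge1}\sum_{j_1,\dots,j_k\ge1}a_0(u)\prod_{r=1}^ka_{j_r}(u)\prod_{r=0}^kZ^2_{t-\sum_{s=1}^rj_s}$. $W$ is zero outside $[-1/2,1/2]$. Define $w_{k,N}(\boldsymbol\alpha)=\alpha_0+\sum_{j=1}^p\alpha_jX_{k-j,N}^2$, $\ell_{k,N}(\boldsymbol\alpha)=\frac12(\log w_{k,N}(\boldsymbol\alpha)+X_{k,N}^2/w_{k,N}(\boldsymbol\alpha))$, $\tilde w_k(u,\boldsymbol\alpha)=\alpha_0+\sum_{j=1}^p\alpha_j\tilde X_{k-j}(u)^2$, $\tilde\ell_k(u,\boldsymbol\alpha)=\frac12(\log\tilde w_k(u,\boldsymbol\alpha)+\tilde X_k(u)^2/\tilde w_k(u,\boldsymbol\alpha))$, $\mathcal L(u,\boldsymbol\alpha)=\mathbb E\,\tilde\ell_0(u,\boldsymbol\alpha)$ and $$\mathcal B_{t_0,N}(\boldsymbol\alpha)=\sum_{k=p+1}^N\frac1{bN}W\left(\frac{t_0-k}{bN}\right)\left(\ell_{k,N}(\boldsymbol\alpha)-\tilde\ell_k(u_0,\boldsymbol\alpha)\right).$$ $\nabla=(\partial/\partial\alpha_0,\dots,\partial/\partial\alpha_p)^T$; $\nabla\mathcal L(u,\mathbf a_{u_0})$ is the $\boldsymbol\alpha$-gradient at the fixed point $\boldsymbol\alpha=\mathbf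 a_{u_0}$, then differentiated in $u$. The $O(\cdot)$ for the mean vector and the covariance matrix are entrywise. *)

theory Defs
  imports "HOL-Probability.Probability" "HOL-Library.Landau_Symbols"
begin

section \<open>Analytic notions\<close>

definition bounded_variation_on :: "(real \<Rightarrow> real) \<Rightarrow> real set \<Rightarrow> bool" where
  "bounded_variation_on f S \<longleftrightarrow>
     (\<exists>V. \<forall>n (x :: nat \<Rightarrow> real). (\<forall>i\<le>n. x i \<in> S) \<longrightarrow> (\<forall>i<n. x i \<le> x (Suc i)) \<longrightarrow>
        (\<Sum>i<n. \<bar>f (x (Suc i)) - f (x i)\<bar>) \<le> V)"

text \<open>The derivatives of orders \<open>1, \<dots>, n\<close> exist on \<open>S\<close> (one-sided at boundary points)
  and are bounded in absolute value by \<open>C\<close>.\<close>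

definition bounded_derivs_on :: "(real \<Rightarrow> real) \<Rightarrow> real set \<Rightarrow> nat \<Rightarrow> real \<Rightarrow> bool" where
  "bounded_derivs_on f S n C \<longleftrightarrow>
     (\<exists>D :: nat \<Rightarrow> real \<Rightarrow> real. D 0 = f \<and>
        (\<forall>i<n. \<forall>x\<in>S. (D i has_real_derivative D (Suc i) x) (at x within S)) \<and>
        (\<forall>i\<in>{1..n}. \<forall>x\<in>S. \<bar>D i x\<bar> \<le> C))"

definition has_second_derivative :: "(real \<Rightarrow> real) \<Rightarrow> real \<Rightarrow> real \<Rightarrow> bool" where
  "has_second_derivative f D x \<longleftrightarrow>
     (\<exists>f'. (\<forall>\<^sub>F y in nhds x. (f has_real_derivative f' y) (at y)) \<and>
           (f' has_real_derivative D) (at x))"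

text \<open>A parameter vector \<open>(\<alpha>\<^sub>0, \<dots>, \<alpha>\<^sub>p)\<close> is a function on \<open>nat\<close> of which only the arguments
  \<open>0, \<dots>, p\<close> are ever used.\<close>

definition partial_deriv :: "nat \<Rightarrow> ((nat \<Rightarrow> real) \<Rightarrow> real) \<Rightarrow> (nat \<Rightarrow> real) \<Rightarrow> real" where
  "partial_deriv i f \<alpha> = deriv (\<lambda>x. f (\<alpha>(i := x))) (\<alpha> i)"

definition has_partial_deriv :: "nat \<Rightarrow> ((nat \<Rightarrow> real) \<Rightarrow> real) \<Rightarrow> (nat \<Rightarrow> real) \<Rightarrow> bool" where
  "has_partial_deriv i f \<alpha> \<longleftrightarrow> (\<lambda>x. f (\<alpha>(i := x))) differentiable (at (\<alpha> i))"

text \<open>As a subset of \<open>nat \<Rightarrow> real\<close> this is the cylinder over the subset of \<open>(p+1)\<close>-dimensional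
  space given by the same inequalities. Its \<^const>\<open>interior\<close> in the product topology is the
  cylinder over the Euclidean interior, because restriction to finitely many coordinates is
  continuous, open and surjective.\<close>

definition Omega :: "nat \<Rightarrow> real \<Rightarrow> real \<Rightarrow> (nat \<Rightarrow> real) set" where
  "Omega p \<rho>\<^sub>1 \<rho>\<^sub>2 =
     {\<alpha>. (\<Sum>j=1..p. \<alpha> j) \<le> 1 \<and> \<rho>\<^sub>1 \<le> \<alpha> 0 \<and> \<alpha> 0 \<le> \<rho>\<^sub>2 \<and> (\<forall>i\<in>{1..p}. \<rho>\<^sub>1 \<le> \<alpha> i)}"

section \<open>Probabilistic notions\<close>

text \<open>The law \<open>D\<close> restricted to some nondegenerate interval containing zero has a Lebesgue density
  that is positive there; nothing is required of \<open>D\<close> outside the interval.\<close>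

definition positive_density_near_zero :: "real measure \<Rightarrow> bool" where
  "positive_density_near_zero D \<longleftrightarrow>
     (\<exists>I f. is_interval I \<and> 0 \<in> I \<and> interior I \<noteq> {} \<and>
        f \<in> borel_measurable borel \<and> (\<forall>x\<in>I. 0 < f x) \<and>
        (\<forall>A\<in>sets borel. A \<subseteq> I \<longrightarrow> emeasure D A = (\<integral>\<^sup>+x\<in>A. ennreal (f x) \<partial>lborel)))"

definition strictly_stationary :: "'w measure \<Rightarrow> (int \<Rightarrow> 'w \<Rightarrow> real) \<Rightarrow> bool" where
  "strictly_stationary P X \<longleftrightarrow>
     (\<forall>J h. finite J \<longrightarrow>
        distr P (Pi\<^sub>M J (\<lambda>_. borel)) (\<lambda>\<omega>. \<lambda>i\<in>J. X (i + h) \<omega>) =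
        distr P (Pi\<^sub>M J (\<lambda>_. borel)) (\<lambda>\<omega>. \<lambda>i\<in>J. X i \<omega>))"

definition covar :: "'w measure \<Rightarrow> ('w \<Rightarrow> real) \<Rightarrow> ('w \<Rightarrow> real) \<Rightarrow> real" where
  "covar P f g =
     (\<integral>\<omega>. (f \<omega> - integral\<^sup>L P f) * (g \<omega> - integral\<^sup>L P g) \<partial>P)"

section \<open>ARCH processes\<close>

text \<open>Throughout, \<open>c j s\<close> is the coefficient with index \<open>j\<close> that acts at time \<open>s\<close>.\<close>

definition arch_recursion ::
  "'w measure \<Rightarrow> nat \<Rightarrow> (nat \<Rightarrow> int \<Rightarrow> real) \<Rightarrow> (int \<Rightarrow> 'w \<Rightarrow> real) \<Rightarrow> int set
     \<Rightarrow> (int \<Rightarrow> 'w \<Rightarrow> real) \<Rightarrow> bool" where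
  "arch_recursion P p c Z T X \<longleftrightarrow>
     (\<exists>\<sigma> :: int \<Rightarrow> 'w \<Rightarrow> real. \<forall>t\<in>T. AE \<omega> in P.
        X t \<omega> = \<sigma> t \<omega> * Z t \<omega> \<and>
        (\<sigma> t \<omega>)\<^sup>2 = c 0 t + (\<Sum>j=1..p. c j t * (X (t - int j) \<omega>)\<^sup>2))"

text \<open>The summand of the series solution belonging to the lags \<open>js = [j\<^sub>1, \<dots>, j\<^sub>k]\<close>:
  \<open>lag t js r\<close> is \<open>t - (j\<^sub>1 + \<dots> + j\<^sub>r)\<close>, and since list positions start at \<open>0\<close>, \<open>js ! r\<close> is \<open>j\<close>
  with index \<open>r + 1\<close>. The empty list gives the leading term \<open>c 0 t * (z t)\<^sup>2\<close>.\<close>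

definition lag :: "int \<Rightarrow> nat list \<Rightarrow> nat \<Rightarrow> int" where
  "lag t js r = t - int (sum_list (take r js))"

definition arch_term ::
  "(nat \<Rightarrow> int \<Rightarrow> real) \<Rightarrow> (int \<Rightarrow> real) \<Rightarrow> int \<Rightarrow> nat list \<Rightarrow> real" where
  "arch_term c z t js =
     c 0 (lag t js (length js)) * (\<Prod>r<length js. c (js ! r) (lag t js r)) *
     (\<Prod>r\<le>length js. (z (lag t js r))\<^sup>2)"

text \<open>The sum over \<open>k \<ge> 1\<close> and \<open>j\<^sub>1, \<dots>, j\<^sub>k \<ge> 1\<close>, together with the leading term, is one sum over
  all lists of positive integers; its terms are nonnegative, so no order of summation matters.\<close>

definition causal_arch_square ::
  "'w measure \<Rightarrow> (nat \<Rightarrow> int \<Rightarrow> real) \<Rightarrow> (int \<Rightarrow> 'w \<Rightarrow> real) \<Rightarrow> int set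
     \<Rightarrow> (int \<Rightarrow> 'w \<Rightarrow> real) \<Rightarrow> bool" where
  "causal_arch_square P c Z T X \<longleftrightarrow>
     (\<forall>t\<in>T. AE \<omega> in P.
        (arch_term c (\<lambda>s. Z s \<omega>) t has_sum (X t \<omega>)\<^sup>2) {js. \<forall>j\<in>set js. 1 \<le> j})"

definition tv_coeff :: "nat \<Rightarrow> (nat \<Rightarrow> real \<Rightarrow> real) \<Rightarrow> nat \<Rightarrow> nat \<Rightarrow> int \<Rightarrow> real" where
  "tv_coeff p a N j s = (if s < 0 \<or> p < j then 0 else a j (real_of_int s / real N))"

definition stat_coeff :: "nat \<Rightarrow> (nat \<Rightarrow> real \<Rightarrow> real) \<Rightarrow> real \<Rightarrow> nat \<Rightarrow> int \<Rightarrow> real" where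
  "stat_coeff p a u j s = (if p < j then 0 else a j u)"

text \<open>The series is also imposed for \<open>t \<le> 0\<close>: it provides the starting values
  \<open>X\<^sub>0\<^sub>,\<^sub>N, \<dots>, X\<^sub>1\<^sub>-\<^sub>p\<^sub>,\<^sub>N\<close> that enter the recursion at the times \<open>1, \<dots>, p\<close>.\<close>

definition tvarch_process ::
  "'w measure \<Rightarrow> nat \<Rightarrow> (nat \<Rightarrow> real \<Rightarrow> real) \<Rightarrow> (int \<Rightarrow> 'w \<Rightarrow> real) \<Rightarrow> nat
     \<Rightarrow> (int \<Rightarrow> 'w \<Rightarrow> real) \<Rightarrow> bool" where
  "tvarch_process P p a Z N X \<longleftrightarrow>
     (\<forall>t\<in>{..int N}. X t \<in> borel_measurable P) \<and>
     arch_recursion P p (tv_coeff p a N) Z {1..int N} X \<and>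
     causal_arch_square P (tv_coeff p a N) Z {..int N} X"

definition stationary_arch_process ::
  "'w measure \<Rightarrow> nat \<Rightarrow> (nat \<Rightarrow> real \<Rightarrow> real) \<Rightarrow> (int \<Rightarrow> 'w \<Rightarrow> real) \<Rightarrow> real
     \<Rightarrow> (int \<Rightarrow> 'w \<Rightarrow> real) \<Rightarrow> bool" where
  "stationary_arch_process P p a Z u X \<longleftrightarrow>
     (\<forall>t. X t \<in> borel_measurable P) \<and>
     strictly_stationary P X \<and>
     arch_recursion P p (stat_coeff p a u) Z UNIV X \<and>
     causal_arch_square P (stat_coeff p a u) Z UNIV X"

section \<open>Likelihoods and the bias process\<close>

text \<open>In \<open>arch_w\<close> and \<open>arch_l\<close>, \<open>x\<close> is a sample path, either of the tvARCH process or of its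
  stationary approximation.\<close>

definition arch_w :: "nat \<Rightarrow> (int \<Rightarrow> real) \<Rightarrow> int \<Rightarrow> (nat \<Rightarrow> real) \<Rightarrow> real" where
  "arch_w p x k \<alpha> = \<alpha> 0 + (\<Sum>j=1..p. \<alpha> j * (x (k - int j))\<^sup>2)"

definition arch_l :: "nat \<Rightarrow> (int \<Rightarrow> real) \<Rightarrow> int \<Rightarrow> (nat \<Rightarrow> real) \<Rightarrow> real" where
  "arch_l p x k \<alpha> = 1/2 * (ln (arch_w p x k \<alpha>) + (x k)\<^sup>2 / arch_w p x k \<alpha>)"

definition limit_L ::
  "'w measure \<Rightarrow> nat \<Rightarrow> (real \<Rightarrow> int \<Rightarrow> 'w \<Rightarrow> real) \<Rightarrow> real \<Rightarrow> (nat \<Rightarrow> real) \<Rightarrow> real" where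
  "limit_L P p Xs u \<alpha> = (\<integral>\<omega>. arch_l p (\<lambda>s. Xs u s \<omega>) 0 \<alpha> \<partial>P)"

text \<open>\<open>x\<close> and \<open>y\<close> are the sample paths of the tvARCH process with index \<open>N\<close> and of the stationary
  process at \<open>u\<^sub>0\<close>; \<open>h\<close> is the bandwidth and \<open>m\<close> the centre.\<close>

definition bias_B ::
  "nat \<Rightarrow> (real \<Rightarrow> real) \<Rightarrow> real \<Rightarrow> nat \<Rightarrow> nat \<Rightarrow> (int \<Rightarrow> real) \<Rightarrow> (int \<Rightarrow> real)
     \<Rightarrow> (nat \<Rightarrow> real) \<Rightarrow> real" where
  "bias_B p W h N m x y \<alpha> =
     (\<Sum>k=p+1..N. 1 / (h * real N) * W ((real m - real k) / (h * real N)) *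
        (arch_l p x (int k) \<alpha> - arch_l p y (int k) \<alpha>))"

definition grad_bias_B ::
  "nat \<Rightarrow> (real \<Rightarrow> real) \<Rightarrow> real \<Rightarrow> nat \<Rightarrow> nat \<Rightarrow> (int \<Rightarrow> 'w \<Rightarrow> real) \<Rightarrow> (int \<Rightarrow> 'w \<Rightarrow> real)
     \<Rightarrow> (nat \<Rightarrow> real) \<Rightarrow> nat \<Rightarrow> 'w \<Rightarrow> real" where
  "grad_bias_B p W h N m X Y \<alpha> i \<omega> =
     partial_deriv i (bias_B p W h N m (\<lambda>s. X s \<omega>) (\<lambda>s. Y s \<omega>)) \<alpha>"

definition kernel_moment :: "(real \<Rightarrow> real) \<Rightarrow> nat \<Rightarrow> real" where
  "kernel_moment W k = integral {-1/2..1/2} (\<lambda>x. W x * x ^ k)"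

end

theory Submission
  imports Defs "HOL-Real_Asymp.Real_Asymp"
begin

text \<open>
  The $k$-th summands of the two series expansions form the ``levels'' of an ARCH series. All
  coefficients that occur are dominated by $q_j = Q / \ell(j)$, and inflating the $q_j$ for
  $j \ge 1$ by $\lambda = 1 + \nu$ still leaves a series with a finite sixth moment: by
  convexity, the sixth moments of its partial sums satisfy a contracting recursion. This slack
  absorbs every factor that grows polynomially in the level. It gives
  $|X_{t,N}^2 - \tilde X_t(u)^2| \le K (|t/N - u| + 1/N) V_t$ with one dominating stationary
  sequence $V_t$, and it makes $u \mapsto \tilde X_t(u)^2$ three times differentiable with
  derivatives bounded by multiples of $V_t$. The gradient of $\ell_{k,N}$ is a smooth function,
  the score, of finitely many of these squares.

  For the mean, replacing $X_{k,N}$ by $\tilde X_k(k/N)$ costs $O(1/N)$, and the expected score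
  of $\tilde X_0(u)$ is expanded to second order at $u_0$; the kernel moments are Riemann sums
  of functions of bounded variation. For the variance, a score difference is of size $O(b)$ on
  the kernel window, and cutting the series off after $m$ levels makes scores at distance more
  than $mp$ independent at a cost of $\lambda^{-m}$. So the covariances are at most
  $O(b)$ times a geometric sequence in the lag; summed over the window they give $O(1/N)$.
\<close>

section \<open>Functions with three controlled derivatives\<close>

text \<open>Derivative bounds have the shape A * B ^ i in the order i because products, sums and
  reciprocals preserve this shape. A level is a product of n + 1 coefficients, so its rate grows
  linearly in n and its third derivative costs a factor n ^ 3. The moment order comes from the
  score. Let G majorise 1 and the squares that enter at one time. The score is at most linear in G,
  since the lagged squares in its numerator also occur in its denominator; differences of scores are
  of order G ^ 2 and third derivatives in u of order G ^ 5. Products of two differences need fourth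
  moments of G, the Taylor remainder a fifth; the sixth moment of the squares, hence the twelfth of
  the noise, covers both. The obstacle is the start of the process: before time 0 the coefficients
  of X_{t,N} vanish and cannot be compared with those of a stationary process. Comparisons are
  therefore restricted to times bounded below by a multiple of N, which holds on the kernel window
  because u_0 is interior and b tends to 0.\<close>

definition jets :: "real set \<Rightarrow> (real \<Rightarrow> real) \<Rightarrow> (real \<Rightarrow> real) \<Rightarrow> (real \<Rightarrow> real) \<Rightarrow> (real \<Rightarrow> real)
    \<Rightarrow> real \<Rightarrow> real \<Rightarrow> bool" where
  "jets S f f' f'' f''' A B \<longleftrightarrow>
     (\<forall>x\<in>S. (f has_real_derivative f' x) (at x) \<and>
        (f' has_real_derivative f'' x) (at x) \<and> (f'' has_real_derivative f''' x) (at x) \<and>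
        \<bar>f x\<bar> \<le> A \<and> \<bar>f' x\<bar> \<le> A * B \<and> \<bar>f'' x\<bar> \<le> A * B\<^sup>2 \<and> \<bar>f''' x\<bar> \<le> A * B ^ 3)"

definition jet :: "real set \<Rightarrow> (real \<Rightarrow> real) \<Rightarrow> real \<Rightarrow> real \<Rightarrow> bool" where
  "jet S f A B \<longleftrightarrow> (\<exists>f' f'' f'''. jets S f f' f'' f''' A B)"

lemma jetsD:
  assumes "jets S f f' f'' f''' A B" "x \<in> S"
  shows "(f has_real_derivative f' x) (at x)" "(f' has_real_derivative f'' x) (at x)"
    "(f'' has_real_derivative f''' x) (at x)" "\<bar>f x\<bar> \<le> A" "\<bar>f' x\<bar> \<le> A * B"
    "\<bar>f'' x\<bar> \<le> A * B\<^sup>2" "\<bar>f''' x\<bar> \<le> A * B ^ 3"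
  using assms by (simp_all add: jets_def)

lemma jetI:
  assumes "\<And>x. x \<in> S \<Longrightarrow> (f has_real_derivative f' x) (at x)"
    and "\<And>x. x \<in> S \<Longrightarrow> (f' has_real_derivative f'' x) (at x)"
    and "\<And>x. x \<in> S \<Longrightarrow> (f'' has_real_derivative f''' x) (at x)"
    and "\<And>x. x \<in> S \<Longrightarrow> \<bar>f x\<bar> \<le> A" "\<And>x. x \<in> S \<Longrightarrow> \<bar>f' x\<bar> \<le> A * B"
    and "\<And>x. x \<in> S \<Longrightarrow> \<bar>f'' x\<bar> \<le> A * B\<^sup>2" "\<And>x. x \<in> S \<Longrightarrow> \<bar>f''' x\<bar> \<le> A * B ^ 3"
  shows "jet S f A B"
  unfolding jet_def jets_def using assms by blast

lemma jet_mono: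
  assumes "jet S f A B" "A \<le> A'" "B \<le> B'" "0 \<le> A" "0 \<le> B"
  shows "jet S f A' B'"
proof -
  have "A * B ^ n \<le> A' * B' ^ n" for n
    using assms by (intro mult_mono power_mono) auto
  note le = this[of 1, unfolded power_one_right] this[of 2] this[of 3]
  obtain f' f'' f''' where "jets S f f' f'' f''' A B"
    using assms(1) unfolding jet_def by blast
  note f = jetsD[OF this]
  show ?thesis
    by (rule jetI[OF f(1-3) order_trans[OF f(4) assms(2)] order_trans[OF f(5) le(1)]
          order_trans[OF f(6) le(2)] order_trans[OF f(7) le(3)]])
qed

lemma jet_const: "\<bar>c\<bar> \<le> A \<Longrightarrow> 0 \<le> B \<Longrightarrow> jet S (\<lambda>_. c) A B"
  by (rule jetI[where f' = "\<lambda>_. 0" and f'' = "\<lambda>_. 0" and f''' = "\<lambda>_. 0"])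
     (auto intro!: mult_nonneg_nonneg)

lemma jet_add:
  assumes "jet S f A B" "jet S g A' B"
  shows "jet S (\<lambda>x. f x + g x) (A + A') B"
proof -
  obtain f' f'' f''' where "jets S f f' f'' f''' A B"
    using assms(1) unfolding jet_def by blast
  note f = jetsD[OF this]
  obtain g' g'' g''' where "jets S g g' g'' g''' A' B"
    using assms(2) unfolding jet_def by blast
  note g = jetsD[OF this]
  show ?thesis
    by (rule jetI[where f' = "\<lambda>x. f' x + g' x" and f'' = "\<lambda>x. f'' x + g'' x"
          and f''' = "\<lambda>x. f''' x + g''' x"])
       (auto intro!: derivative_intros f(1-3) g(1-3) abs_triangle_ineq[THEN order_trans]
          add_mono f(4-) g(4-) simp: distrib_right)
qed

lemma jet_sum:
  assumes "finite I" "\<And>i. i \<in> I \<Longrightarrow> jet S (f i) (A i) B" "0 \<le> B"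
  shows "jet S (\<lambda>x. \<Sum>i\<in>I. f i x) (\<Sum>i\<in>I. A i) B"
  using assms by (induction I rule: finite_induct) (auto intro!: jet_const jet_add)

text \<open>By Leibniz' rule the i-th derivative of the product is bounded by A * A' times the
  binomial expansion of (B + B') ^ i. Rates therefore add under multiplication.\<close>

lemma jet_mult:
  assumes "jet S f A B" "jet S g A' B'"
  shows "jet S (\<lambda>x. f x * g x) (A * A') (B + B')"
proof -
  obtain f' f'' f''' where "jets S f f' f'' f''' A B"
    using assms(1) unfolding jet_def by blast
  note f = jetsD[OF this]
  obtain g' g'' g''' where "jets S g g' g'' g''' A' B'"
    using assms(2) unfolding jet_def by blast
  note g = jetsD[OF this]
  have prod: "\<bar>u * v\<bar> \<le> a * b" if "\<bar>u\<bar> \<le> a" "\<bar>v\<bar> \<le> b" for u v a b :: real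
    unfolding abs_mult using that by (intro mult_mono) auto
  note mm = prod[OF f(4) g(4)] prod[OF f(5) g(4)] prod[OF f(4) g(5)]
     prod[OF f(6) g(4)] prod[OF f(5) g(5)] prod[OF f(4) g(6)]
     prod[OF f(7) g(4)] prod[OF f(6) g(5)] prod[OF f(5) g(6)] prod[OF f(4) g(7)]
  show ?thesis
  proof (rule jetI[where f' = "\<lambda>x. f' x * g x + f x * g' x"
          and f'' = "\<lambda>x. f'' x * g x + 2 * (f' x * g' x) + f x * g'' x"
          and f''' = "\<lambda>x. f''' x * g x + 3 * (f'' x * g' x) + 3 * (f' x * g'' x) + f x * g''' x"])
    fix x assume x: "x \<in> S"
    show "((\<lambda>x. f x * g x) has_real_derivative f' x * g x + f x * g' x) (at x)"
      by (auto intro!: derivative_eq_intros f(1-3)[OF x] g(1-3)[OF x])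
    show "((\<lambda>x. f' x * g x + f x * g' x) has_real_derivative
        f'' x * g x + 2 * (f' x * g' x) + f x * g'' x) (at x)"
      by (auto intro!: derivative_eq_intros f(1-3)[OF x] g(1-3)[OF x])
    show "((\<lambda>x. f'' x * g x + 2 * (f' x * g' x) + f x * g'' x) has_real_derivative
        f''' x * g x + 3 * (f'' x * g' x) + 3 * (f' x * g'' x) + f x * g''' x) (at x)"
      by (auto intro!: derivative_eq_intros f(1-3)[OF x] g(1-3)[OF x])
    show "\<bar>f x * g x\<bar> \<le> A * A'" using mm x by auto
    have "\<bar>f' x * g x + f x * g' x\<bar> \<le> (A * B) * A' + A * (A' * B')"
      using mm(2,3)[OF x x] by linarith
    also have "\<dots> = A * A' * (B + B')" by algebra
    finally show "\<bar>f' x * g x + f x * g' x\<bar> \<le> A * A' * (B + B')" .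
    have "\<bar>f'' x * g x + 2 * (f' x * g' x) + f x * g'' x\<bar>
        \<le> (A * B\<^sup>2) * A' + 2 * ((A * B) * (A' * B')) + A * (A' * B'\<^sup>2)"
      using mm(4-6)[OF x x] by linarith
    also have "\<dots> = A * A' * (B + B')\<^sup>2" by algebra
    finally show "\<bar>f'' x * g x + 2 * (f' x * g' x) + f x * g'' x\<bar> \<le> A * A' * (B + B')\<^sup>2" .
    have "\<bar>f''' x * g x + 3 * (f'' x * g' x) + 3 * (f' x * g'' x) + f x * g''' x\<bar>
        \<le> (A * B ^ 3) * A' + 3 * ((A * B\<^sup>2) * (A' * B')) + 3 * ((A * B) * (A' * B'\<^sup>2))
          + A * (A' * B' ^ 3)"
      using mm(7-10)[OF x x] by linarith
    also have "\<dots> = A * A' * (B + B') ^ 3" by algebra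
    finally show "\<bar>f''' x * g x + 3 * (f'' x * g' x) + 3 * (f' x * g'' x) + f x * g''' x\<bar>
        \<le> A * A' * (B + B') ^ 3" .
  qed
qed

lemma jet_cmult:
  assumes "jet S f A B" "\<bar>c\<bar> \<le> c'"
  shows "jet S (\<lambda>x. c * f x) (c' * A) B"
  using jet_mult[OF jet_const[OF assms(2) order_refl] assms(1)] by simp

text \<open>With v = 1 / w and d_i the i-th derivative of w divided by w, the derivatives of v are v
  times polynomials in the d_i. Their absolute coefficients add up to 1, 3 and 13 for the orders 1,
  2 and 3, which 3 ^ i covers.\<close>

lemma jet_inverse:
  assumes "jet S w A B" "0 \<le> A" "0 \<le> B" "0 < r" and r: "\<And>x. x \<in> S \<Longrightarrow> r \<le> w x"
  shows "jet S (\<lambda>x. 1 / w x) (1 / r) (3 * B * (A / r + 1))"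
proof -
  obtain f' f'' f''' where "jets S w f' f'' f''' A B"
    using assms(1) unfolding jet_def by blast
  note f = jetsD[OF this]
  define y where "y = A / r"
  have y: "0 \<le> y" using assms by (simp add: y_def)
  define v where "v x = 1 / w x" for x
  define d1 where "d1 x = f' x * v x" for x
  define d2 where "d2 x = f'' x * v x" for x
  define d3 where "d3 x = f''' x * v x" for x
  have w0: "w x \<noteq> 0" if "x \<in> S" for x using r[OF that] assms(4) by auto
  have v: "\<bar>v x\<bar> \<le> 1 / r" if "x \<in> S" for x
    using r[OF that] assms(4) by (auto simp: v_def frac_le)
  have prod: "\<bar>u * v\<bar> \<le> a * b" if "\<bar>u\<bar> \<le> a" "\<bar>v\<bar> \<le> b" for u v a b :: real
    unfolding abs_mult using that by (intro mult_mono) auto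
  have d1: "\<bar>d1 x\<bar> \<le> y * B" if "x \<in> S" for x
    using prod[OF f(5)[OF that] v[OF that]] by (simp add: d1_def y_def)
  have d2: "\<bar>d2 x\<bar> \<le> y * B\<^sup>2" if "x \<in> S" for x
    using prod[OF f(6)[OF that] v[OF that]] by (simp add: d2_def y_def)
  have d3: "\<bar>d3 x\<bar> \<le> y * B ^ 3" if "x \<in> S" for x
    using prod[OF f(7)[OF that] v[OF that]] by (simp add: d3_def y_def)
  have dv: "(v has_real_derivative - (v x * d1 x)) (at x)" if "x \<in> S" for x
    unfolding v_def d1_def
    by (auto intro!: derivative_eq_intros f(1)[OF that] w0[OF that])
  have dd1: "(d1 has_real_derivative (d2 x - d1 x * d1 x)) (at x)" if "x \<in> S" for x
    unfolding d1_def d2_def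
    by (rule derivative_eq_intros f(2)[OF that] dv[OF that])+ (simp add: d1_def algebra_simps)
  have dd2: "(d2 has_real_derivative (d3 x - d2 x * d1 x)) (at x)" if "x \<in> S" for x
    unfolding d3_def d2_def
    by (rule derivative_eq_intros f(3)[OF that] dv[OF that])+ (simp add: d1_def algebra_simps)
  have "jet S v (1 / r) (3 * B * (y + 1))"
  proof (rule jetI[where f' = "\<lambda>x. - (v x * d1 x)" and f'' = "\<lambda>x. v x * (2 * (d1 x * d1 x) - d2 x)"
        and f''' = "\<lambda>x. v x * (- 6 * (d1 x * (d1 x * d1 x)) + 6 * (d1 x * d2 x) - d3 x)"])
    fix x assume x: "x \<in> S"
    show "(v has_real_derivative - (v x * d1 x)) (at x)" by (rule dv[OF x])
    show "((\<lambda>x. - (v x * d1 x)) has_real_derivative v x * (2 * (d1 x * d1 x) - d2 x)) (at x)"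
      by (rule derivative_eq_intros dv[OF x] dd1[OF x] refl)+ (simp add: algebra_simps)
    show "((\<lambda>x. v x * (2 * (d1 x * d1 x) - d2 x)) has_real_derivative
        v x * (- 6 * (d1 x * (d1 x * d1 x)) + 6 * (d1 x * d2 x) - d3 x)) (at x)"
      by (rule derivative_eq_intros dv[OF x] dd1[OF x] dd2[OF x] refl)+ (simp add: algebra_simps)
    show "\<bar>v x\<bar> \<le> 1 / r" by (rule v[OF x])
    \<comment> \<open>A single factor y lies below every positive power of y + 1, so enlarging the
      base restores a bound that is geometric in the order.\<close>
    have pw: "y * B ^ n \<le> (B * (y + 1)) ^ n" if "n > 0" for n
    proof -
      have "y \<le> (y + 1) ^ n" using y that self_le_power[of "y + 1" n] by linarith
      then have "B ^ n * y \<le> B ^ n * (y + 1) ^ n" using assms by (intro mult_left_mono) auto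
      then show ?thesis by (simp add: power_mult_distrib mult.commute)
    qed
    define q where "q = B * (y + 1)"
    have q: "0 \<le> q" using assms y by (simp add: q_def)
    have d1': "\<bar>d1 x\<bar> \<le> q" using d1[OF x] pw[of 1] by (simp add: q_def)
    have d2': "\<bar>d2 x\<bar> \<le> q\<^sup>2" using d2[OF x] pw[of 2] by (simp add: q_def)
    have d3': "\<bar>d3 x\<bar> \<le> q ^ 3" using d3[OF x] pw[of 3] by (simp add: q_def)
    have d11: "\<bar>d1 x * d1 x\<bar> \<le> q\<^sup>2" using prod[OF d1' d1'] by (simp add: power2_eq_square)
    have "\<bar>v x * d1 x\<bar> \<le> 1 / r * q" by (rule prod[OF v[OF x] d1'])
    also have "\<dots> \<le> 1 / r * (3 * B * (y + 1))" using q assms by (intro mult_left_mono) (auto simp: q_def)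
    finally show "\<bar>- (v x * d1 x)\<bar> \<le> 1 / r * (3 * B * (y + 1))" by simp
    have "\<bar>2 * (d1 x * d1 x) - d2 x\<bar> \<le> 2 * q\<^sup>2 + q\<^sup>2" using d11 d2' by linarith
    also have "\<dots> \<le> (3 * q)\<^sup>2" by (simp add: power2_eq_square)
    finally have "\<bar>2 * (d1 x * d1 x) - d2 x\<bar> \<le> (3 * q)\<^sup>2" .
    from prod[OF v[OF x] this]
    show "\<bar>v x * (2 * (d1 x * d1 x) - d2 x)\<bar> \<le> 1 / r * (3 * B * (y + 1))\<^sup>2"
      by (simp add: q_def mult.assoc)
    have "\<bar>d1 x * (d1 x * d1 x)\<bar> \<le> q ^ 3" using prod[OF d1' d11] by (simp add: power2_eq_square power3_eq_cube)
    moreover have "\<bar>d1 x * d2 x\<bar> \<le> q ^ 3" using prod[OF d1' d2'] by (simp add: power2_eq_square power3_eq_cube)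
    moreover have "0 \<le> q ^ 3" using q by simp
    moreover have "(3 * q) ^ 3 = 27 * q ^ 3" by (simp add: power3_eq_cube)
    ultimately have "\<bar>- 6 * (d1 x * (d1 x * d1 x)) + 6 * (d1 x * d2 x) - d3 x\<bar> \<le> (3 * q) ^ 3"
      using d3' by linarith
    from prod[OF v[OF x] this]
    show "\<bar>v x * (- 6 * (d1 x * (d1 x * d1 x)) + 6 * (d1 x * d2 x) - d3 x)\<bar>
        \<le> 1 / r * (3 * B * (y + 1)) ^ 3"
      by (simp add: q_def mult.assoc)
  qed
  then show ?thesis by (simp add: v_def[abs_def] y_def)
qed

section \<open>Termwise differentiation, and derivatives from quadratic remainders\<close>

lemma has_real_derivative_suminf:
  fixes f f' :: "nat \<Rightarrow> real \<Rightarrow> real"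
  assumes "open S" "convex S" "x \<in> S"
    and "\<And>n x. x \<in> S \<Longrightarrow> (f n has_real_derivative f' n x) (at x)"
    and "\<And>n x. x \<in> S \<Longrightarrow> \<bar>f' n x\<bar> \<le> E n" "summable E" "summable (\<lambda>n. f n x)"
  shows "((\<lambda>x. \<Sum>n. f n x) has_real_derivative (\<Sum>n. f' n x)) (at x)"
proof (rule has_field_derivative_series'(2)[where S = S and x0 = x])
  show "uniformly_convergent_on S (\<lambda>n x. \<Sum>i<n. f' i x)"
    using assms by (intro Weierstrass_m_test') auto
qed (use assms in \<open>auto intro: has_field_derivative_at_within simp: interior_open\<close>)

text \<open>All terms share the rate B, so the one summable majorant E, multiplied by B ^ i, serves
  the M-test at every order.\<close>

lemma jet_suminf:
  fixes f :: "nat \<Rightarrow> real \<Rightarrow> real"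
  assumes S: "open S" "convex S" and f: "\<And>n. jet S (f n) (E n) B" and E: "summable E"
  shows "jet S (\<lambda>x. \<Sum>n. f n x) (\<Sum>n. E n) B"
proof -
  have "\<forall>n. jet S (f n) (E n) B" using f by blast
  then obtain f' f'' f''' where "\<And>n. jets S (f n) (f' n) (f'' n) (f''' n) (E n) B"
    unfolding jet_def choice_iff by blast
  note d = jetsD[OF this]
  have sE: "summable (\<lambda>n. E n * c)" for c using E by (rule summable_mult2)
  have sm: "summable g" if "\<And>n. \<bar>g n\<bar> \<le> E n * c" for g c
    using sE by (rule summable_comparison_test'[where N = 0]) (use that in auto)
  have bd: "\<bar>\<Sum>n. g n\<bar> \<le> (\<Sum>n. E n) * c" if "\<And>n. \<bar>g n\<bar> \<le> E n * c" for g c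
  proof -
    have a: "summable (\<lambda>n. \<bar>g n\<bar>)"
      using sE by (rule summable_comparison_test'[where N = 0]) (use that in auto)
    have "\<bar>\<Sum>n. g n\<bar> \<le> (\<Sum>n. \<bar>g n\<bar>)" by (rule summable_rabs[OF a])
    also have "\<dots> \<le> (\<Sum>n. E n * c)" by (rule suminf_le[OF that a sE])
    also have "\<dots> = (\<Sum>n. E n) * c" by (rule suminf_mult2[symmetric, OF E])
    finally show ?thesis .
  qed
  show ?thesis
  proof (rule jetI[where f' = "\<lambda>x. \<Sum>n. f' n x" and f'' = "\<lambda>x. \<Sum>n. f'' n x"
        and f''' = "\<lambda>x. \<Sum>n. f''' n x"])
    fix x assume x: "x \<in> S"
    show "((\<lambda>x. \<Sum>n. f n x) has_real_derivative (\<Sum>n. f' n x)) (at x)"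
      by (rule has_real_derivative_suminf[OF S x d(1,5) sE sm[where c = 1]]) (use d(4) x in auto)
    show "((\<lambda>x. \<Sum>n. f' n x) has_real_derivative (\<Sum>n. f'' n x)) (at x)"
      by (rule has_real_derivative_suminf[OF S x d(2,6) sE sm[where c = B]]) (use d(5) x in auto)
    show "((\<lambda>x. \<Sum>n. f'' n x) has_real_derivative (\<Sum>n. f''' n x)) (at x)"
      by (rule has_real_derivative_suminf[OF S x d(3,7) sE sm[where c = "B\<^sup>2"]]) (use d(6) x in auto)
    show "\<bar>\<Sum>n. f n x\<bar> \<le> (\<Sum>n. E n)" using bd[of "\<lambda>n. f n x" 1] d(4)[OF x] by simp
  qed (use bd d(5-7) in auto)
qed

text \<open>The uniform bound C becomes geometric once B is so large that C is below A * B, and B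
  \<ge> 1 extends this to the higher orders. On the open interval the derivatives within [0, 1] are
  two-sided.\<close>

lemma bounded_derivs_imp_jet:
  assumes "bounded_derivs_on f {0..1} 3 C" "\<And>u. u \<in> {0..1} \<Longrightarrow> \<bar>f u\<bar> \<le> A"
    and "C \<le> A * B" "1 \<le> B" "0 \<le> A"
  shows "jet {0<..<1} f A B"
proof -
  obtain D :: "nat \<Rightarrow> real \<Rightarrow> real" where D: "D 0 = f"
    "\<And>i x. i < 3 \<Longrightarrow> x \<in> {0..1} \<Longrightarrow> (D i has_real_derivative D (Suc i) x) (at x within {0..1})"
    "\<And>i x. i \<in> {1..3} \<Longrightarrow> x \<in> {0..1} \<Longrightarrow> \<bar>D i x\<bar> \<le> C"
    using assms(1) unfolding bounded_derivs_on_def by blast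
  have D': "(D i has_real_derivative D (Suc i) x) (at x)" if "i < 3" "x \<in> {0<..<1}" for i x
    using D(2)[OF that(1), of x] that(2) at_within_Icc_at[of 0 x 1] by simp
  have pw: "C \<le> A * B ^ i" if "i \<in> {1..3}" for i
  proof -
    have "B \<le> B ^ i" using assms that by (intro self_le_power) auto
    then have "A * B \<le> A * B ^ i" using assms by (intro mult_left_mono) auto
    with assms show ?thesis by simp
  qed
  have bd: "\<bar>D i x\<bar> \<le> A * B ^ i" if "i \<in> {1..3}" "x \<in> {0<..<1}" for i x
    using D(3)[OF that(1), of x] pw[OF that(1)] that(2) by auto
  show ?thesis
    using D'[of 0] D'[of 1] D'[of 2] bd[of 1] bd[of 2] bd[of 3] assms(2) D(1)
    by (intro jetI[where f' = "D 1" and f'' = "D 2" and f''' = "D 3"])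
       (simp_all flip: numeral_2_eq_2 numeral_3_eq_3)
qed

text \<open>The criterion by which expectations are differentiated: a quadratic remainder that is
  bounded pathwise with an integrable constant stays quadratic after integration.\<close>

lemma has_real_derivative_quadratic:
  fixes f :: "real \<Rightarrow> real"
  assumes "open S" "u \<in> S" "\<And>v. v \<in> S \<Longrightarrow> \<bar>f v - f u - d * (v - u)\<bar> \<le> K * (v - u)\<^sup>2"
  shows "(f has_real_derivative d) (at u)"
proof -
  have "((\<lambda>v. (f v - f u) / (v - u) - d) \<longlongrightarrow> 0) (at u)"
  proof (rule Lim_null_comparison[where g = "\<lambda>v. K * \<bar>v - u\<bar>"])
    have "\<forall>\<^sub>F v in at u. v \<in> S \<and> v \<noteq> u"
      using assms(1,2) by (simp add: eventually_at_in_open' eventually_conj_iff eventually_neq_at_within)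
    then show "\<forall>\<^sub>F v in at u. norm ((f v - f u) / (v - u) - d) \<le> K * \<bar>v - u\<bar>"
    proof eventually_elim
      case (elim v)
      have "(f v - f u) / (v - u) - d = (f v - f u - d * (v - u)) / (v - u)"
        using elim by (simp add: field_simps)
      then have "norm ((f v - f u) / (v - u) - d) = \<bar>f v - f u - d * (v - u)\<bar> / \<bar>v - u\<bar>" by simp
      also have "\<dots> \<le> K * (v - u)\<^sup>2 / \<bar>v - u\<bar>" using assms(3) elim by (intro divide_right_mono) auto
      also have "\<dots> = K * \<bar>v - u\<bar>" using elim by (simp add: power2_eq_square field_simps abs_if)
      finally show ?case .
    qed
    show "((\<lambda>v. K * \<bar>v - u\<bar>) \<longlongrightarrow> 0) (at u)" by (auto intro!: tendsto_eq_intros)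
  qed
  then have "((\<lambda>v. (f v - f u) / (v - u)) \<longlongrightarrow> d) (at u)" by (simp add: LIM_zero_iff)
  then show ?thesis by (simp add: has_field_derivative_iff)
qed

section \<open>Taylor expansion of expectations\<close>

text \<open>Derivatives chosen path by path need not be measurable in \<omega>. A limit of
  difference quotients along a sequence that depends on u alone is measurable, and almost surely it
  agrees with the chosen derivative for all u at once.\<close>

lemma measurable_pointwise_derivative:
  fixes H :: "real \<Rightarrow> 'w \<Rightarrow> real"
  assumes S: "open S" and H: "\<And>u. u \<in> S \<Longrightarrow> H u \<in> borel_measurable M"
    and D: "AE \<omega> in M. \<forall>u\<in>S. ((\<lambda>u. H u \<omega>) has_real_derivative H' \<omega> u) (at u)"
  obtains G where "\<And>u. u \<in> S \<Longrightarrow> G u \<in> borel_measurable M"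
    "AE \<omega> in M. \<forall>u\<in>S. G u \<omega> = H' \<omega> u"
proof -
  have "\<forall>u\<in>S. \<exists>e>0. \<forall>n. u + e / real (Suc n) \<in> S"
  proof
    fix u assume "u \<in> S"
    with S obtain e where e: "e > 0" "ball u e \<subseteq> S" by (auto simp: open_contains_ball)
    have "u + e / 2 / real (Suc n) \<in> S" for n
    proof -
      have "e / 2 / real (Suc n) \<le> e / 2 / 1" using e by (intro divide_left_mono) auto
      moreover have "0 \<le> e / 2 / real (Suc n)" using e by simp
      ultimately have "dist u (u + e / 2 / real (Suc n)) < e"
        using e(1) unfolding dist_real_def by linarith
      with e(2) show ?thesis by (auto simp: subset_eq)
    qed
    then show "\<exists>e>0. \<forall>n. u + e / real (Suc n) \<in> S" using e by (intro exI[of _ "e / 2"]) auto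
  qed
  then obtain e where e: "\<And>u. u \<in> S \<Longrightarrow> e u > 0" "\<And>u n. u \<in> S \<Longrightarrow> u + e u / real (Suc n) \<in> S"
    by metis
  define G where "G u \<omega> = lim (\<lambda>n. (H (u + e u / real (Suc n)) \<omega> - H u \<omega>) / (e u / real (Suc n)))" for u \<omega>
  show thesis
  proof
    fix u assume u: "u \<in> S"
    have [measurable]: "H u \<in> borel_measurable M" "\<And>n. H (u + e u / real (Suc n)) \<in> borel_measurable M"
      using H u e(2) by auto
    show "G u \<in> borel_measurable M" unfolding G_def by measurable
  next
    show "AE \<omega> in M. \<forall>u\<in>S. G u \<omega> = H' \<omega> u"
      using D
    proof eventually_elim
      case (elim \<omega>)
      show ?case
      proof
        fix u assume u: "u \<in> S"
        from elim u have "((\<lambda>h. (H (u + h) \<omega> - H u \<omega>) / h) \<longlongrightarrow> H' \<omega> u) (at 0)"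
          by (simp add: DERIV_def)
        moreover have "filterlim (\<lambda>n. e u / real (Suc n)) (at 0) sequentially"
          unfolding filterlim_at using e(1)[OF u]
          using LIMSEQ_Suc[OF lim_const_over_n[of "e u"]] by auto
        ultimately have "(\<lambda>n. (H (u + e u / real (Suc n)) \<omega> - H u \<omega>) / (e u / real (Suc n)))
            \<longlonglongrightarrow> H' \<omega> u"
          by (rule filterlim_compose)
        then show "G u \<omega> = H' \<omega> u" unfolding G_def by (rule limI)
      qed
    qed
  qed
qed

text \<open>The Taylor remainders are integrated instead of differentiating under the integral sign,
  so that no dominated convergence is needed.\<close>

lemma expectation_taylor:
  fixes H :: "real \<Rightarrow> 'w \<Rightarrow> real"
  assumes S: "open S" "convex S" and H: "\<And>u. u \<in> S \<Longrightarrow> H u \<in> borel_measurable M"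
    and K: "integrable M K" and jet: "AE \<omega> in M. jet S (\<lambda>u. H u \<omega>) (K \<omega>) 1"
  defines "\<phi> \<equiv> \<lambda>u. \<integral>\<omega>. H u \<omega> \<partial>M"
  obtains \<phi>' \<phi>'' where
    "\<And>u. u \<in> S \<Longrightarrow> (\<phi> has_real_derivative \<phi>' u) (at u)"
    "\<And>u. u \<in> S \<Longrightarrow> (\<phi>' has_real_derivative \<phi>'' u) (at u)"
    "\<And>u v. u \<in> S \<Longrightarrow> v \<in> S \<Longrightarrow>
       \<bar>\<phi> v - \<phi> u - \<phi>' u * (v - u) - \<phi>'' u * ((v - u)\<^sup>2 / 2)\<bar> \<le> (\<integral>\<omega>. K \<omega> \<partial>M) * \<bar>v - u\<bar> ^ 3"
proof -
  define R where "R \<omega> f' f'' f''' \<longleftrightarrow> jets S (\<lambda>u. H u \<omega>) f' f'' f''' (K \<omega>) 1" for \<omega> f' f'' f'''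
  \<comment> \<open>\<open>jet\<close> only asserts existence, so the three derivatives are selected
    separately for each path.\<close>
  have "\<forall>\<omega>. \<exists>f' f'' f'''. jet S (\<lambda>u. H u \<omega>) (K \<omega>) 1 \<longrightarrow> R \<omega> f' f'' f'''"
    unfolding jet_def R_def by blast
  then obtain F1 F2 F3 where "\<And>\<omega>. jet S (\<lambda>u. H u \<omega>) (K \<omega>) 1 \<longrightarrow> R \<omega> (F1 \<omega>) (F2 \<omega>) (F3 \<omega>)"
    unfolding choice_iff by blast
  with jet have R: "AE \<omega> in M. R \<omega> (F1 \<omega>) (F2 \<omega>) (F3 \<omega>)" by auto
  obtain G1 where G1: "\<And>u. u \<in> S \<Longrightarrow> G1 u \<in> borel_measurable M"
    "AE \<omega> in M. \<forall>u\<in>S. G1 u \<omega> = F1 \<omega> u"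
  proof (rule measurable_pointwise_derivative[OF S(1) H])
    show "AE \<omega> in M. \<forall>u\<in>S. ((\<lambda>u. H u \<omega>) has_real_derivative F1 \<omega> u) (at u)"
      using R by eventually_elim (auto simp: R_def jets_def)
  qed auto
  have dG: "((\<lambda>u. G1 u \<omega>) has_real_derivative d) (at u)"
    if "\<forall>u\<in>S. G1 u \<omega> = F1 \<omega> u" "u \<in> S" "(F1 \<omega> has_real_derivative d) (at u)" for \<omega> d u
    by (rule DERIV_cong_ev[THEN iffD2, OF refl _ refl that(3)])
       (use S that in \<open>auto simp: eventually_nhds\<close>)
  obtain G2 where G2: "\<And>u. u \<in> S \<Longrightarrow> G2 u \<in> borel_measurable M"
    "AE \<omega> in M. \<forall>u\<in>S. G2 u \<omega> = F2 \<omega> u"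
  proof (rule measurable_pointwise_derivative[OF S(1) G1(1)])
    show "AE \<omega> in M. \<forall>u\<in>S. ((\<lambda>u. G1 u \<omega>) has_real_derivative F2 \<omega> u) (at u)"
      using R G1(2) by eventually_elim (auto simp: R_def jets_def intro!: dG)
  qed auto
  have int: "integrable M (f u)" if "u \<in> S" "\<And>u. u \<in> S \<Longrightarrow> f u \<in> borel_measurable M"
    "AE \<omega> in M. \<forall>u\<in>S. \<bar>f u \<omega>\<bar> \<le> K \<omega>" for f u
    by (rule Bochner_Integration.integrable_bound[OF K that(2)[OF that(1)]])
       (use that(3) in \<open>eventually_elim, use that(1) in force\<close>)
  have iH: "integrable M (H u)" if "u \<in> S" for u
    by (rule int[OF that H]) (use R in \<open>auto simp: R_def jets_def elim: AE_mp\<close>)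
  have iG1: "integrable M (G1 u)" if "u \<in> S" for u
    by (rule int[OF that G1(1)], assumption) (use R G1(2) in \<open>eventually_elim, auto simp: R_def jets_def\<close>)
  have iG2: "integrable M (G2 u)" if "u \<in> S" for u
    by (rule int[OF that G2(1)], assumption) (use R G2(2) in \<open>eventually_elim, auto simp: R_def jets_def\<close>)
  have T: "\<bar>h0 v - h0 u - h1 u * (v - u)\<bar> \<le> C * (v - u)\<^sup>2"
    if "\<And>x. x \<in> S \<Longrightarrow> (h0 has_real_derivative h1 x) (at x)"
      "\<And>x. x \<in> S \<Longrightarrow> (h1 has_real_derivative h2 x) (at x)"
      "\<And>x. x \<in> S \<Longrightarrow> \<bar>h2 x\<bar> \<le> C" "u \<in> S" "v \<in> S" for h0 h1 h2 :: "real \<Rightarrow> real" and C u v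
  proof -
    define f where "f i = (if i = 0 then h0 else if i = 1 then h1 else h2)" for i :: nat
    have "norm (f 0 v - (\<Sum>i\<le>1. f i u * (v - u) ^ i / fact i)) \<le> C * norm (v - u) ^ Suc 1 / fact 1"
      by (rule field_Taylor[OF S(2)])
         (use that in \<open>auto intro: has_field_derivative_at_within simp: f_def le_Suc_eq\<close>)
    then show ?thesis by (simp add: f_def diff_diff_eq power2_eq_square)
  qed
  have T3: "\<bar>h0 v - h0 u - h1 u * (v - u) - h2 u * ((v - u)\<^sup>2 / 2)\<bar> \<le> C * \<bar>v - u\<bar> ^ 3"
    if "\<And>x. x \<in> S \<Longrightarrow> (h0 has_real_derivative h1 x) (at x)"
      "\<And>x. x \<in> S \<Longrightarrow> (h1 has_real_derivative h2 x) (at x)"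
      "\<And>x. x \<in> S \<Longrightarrow> (h2 has_real_derivative h3 x) (at x)"
      "\<And>x. x \<in> S \<Longrightarrow> \<bar>h3 x\<bar> \<le> C" "u \<in> S" "v \<in> S" for h0 h1 h2 h3 :: "real \<Rightarrow> real" and C u v
  proof -
    define f where "f i = (if i = 0 then h0 else if i = 1 then h1 else if i = 2 then h2 else h3)"
      for i :: nat
    have "norm (f 0 v - (\<Sum>i\<le>2. f i u * (v - u) ^ i / fact i)) \<le> C * norm (v - u) ^ Suc 2 / fact 2"
      by (rule field_Taylor[OF S(2)])
         (use that in \<open>auto intro: has_field_derivative_at_within simp: f_def le_Suc_eq numeral_2_eq_2\<close>)
    then have "\<bar>h0 v - (h0 u + h1 u * (v - u) + h2 u * (v - u)\<^sup>2 / 2)\<bar> \<le> C * \<bar>v - u\<bar> ^ 3 / 2"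
      by (simp add: f_def numeral_2_eq_2 numeral_3_eq_3)
    moreover have "0 \<le> C * \<bar>v - u\<bar> ^ 3" using that(4)[OF that(5)] by (intro mult_nonneg_nonneg) auto
    ultimately show ?thesis by (simp add: diff_diff_eq)
  qed
  have le: "\<bar>(\<integral>\<omega>. f \<omega> \<partial>M)\<bar> \<le> (\<integral>\<omega>. K \<omega> \<partial>M) * c"
    if "integrable M f" "AE \<omega> in M. \<bar>f \<omega>\<bar> \<le> K \<omega> * c" for f c
  proof -
    have "\<bar>(\<integral>\<omega>. f \<omega> \<partial>M)\<bar> \<le> (\<integral>\<omega>. \<bar>f \<omega>\<bar> \<partial>M)" by (rule integral_abs_bound)
    also have "\<dots> \<le> (\<integral>\<omega>. K \<omega> * c \<partial>M)" using that K by (intro integral_mono_AE) auto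
    finally show ?thesis using K by simp
  qed
  show thesis
  proof (rule that)
    fix u assume u: "u \<in> S"
    show "(\<phi> has_real_derivative (\<integral>\<omega>. G1 u \<omega> \<partial>M)) (at u)"
    proof (rule has_real_derivative_quadratic[OF S(1) u])
      fix v assume v: "v \<in> S"
      have "\<bar>\<integral>\<omega>. H v \<omega> - H u \<omega> - G1 u \<omega> * (v - u) \<partial>M\<bar> \<le> (\<integral>\<omega>. K \<omega> \<partial>M) * (v - u)\<^sup>2"
      proof (rule le)
        show "AE \<omega> in M. \<bar>H v \<omega> - H u \<omega> - G1 u \<omega> * (v - u)\<bar> \<le> K \<omega> * (v - u)\<^sup>2"
          using R G1(2)
        proof eventually_elim
          case (elim \<omega>)
          then show ?case
            using T[of "\<lambda>u. H u \<omega>" "F1 \<omega>" "F2 \<omega>" "K \<omega>" u v] u v by (simp add: R_def jets_def)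
        qed
      qed (use iH iG1 u v in auto)
      then show "\<bar>\<phi> v - \<phi> u - (\<integral>\<omega>. G1 u \<omega> \<partial>M) * (v - u)\<bar> \<le> (\<integral>\<omega>. K \<omega> \<partial>M) * (v - u)\<^sup>2"
        unfolding \<phi>_def using iH iG1 u v by simp
    qed
    show "((\<lambda>u. \<integral>\<omega>. G1 u \<omega> \<partial>M) has_real_derivative (\<integral>\<omega>. G2 u \<omega> \<partial>M)) (at u)"
    proof (rule has_real_derivative_quadratic[OF S(1) u])
      fix v assume v: "v \<in> S"
      have "\<bar>\<integral>\<omega>. G1 v \<omega> - G1 u \<omega> - G2 u \<omega> * (v - u) \<partial>M\<bar> \<le> (\<integral>\<omega>. K \<omega> \<partial>M) * (v - u)\<^sup>2"
      proof (rule le)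
        show "AE \<omega> in M. \<bar>G1 v \<omega> - G1 u \<omega> - G2 u \<omega> * (v - u)\<bar> \<le> K \<omega> * (v - u)\<^sup>2"
          using R G1(2) G2(2)
        proof eventually_elim
          case (elim \<omega>)
          then show ?case
            using T[of "F1 \<omega>" "F2 \<omega>" "F3 \<omega>" "K \<omega>" u v] u v by (simp add: R_def jets_def)
        qed
      qed (use iG1 iG2 u v in auto)
      then show "\<bar>(\<integral>\<omega>. G1 v \<omega> \<partial>M) - (\<integral>\<omega>. G1 u \<omega> \<partial>M) - (\<integral>\<omega>. G2 u \<omega> \<partial>M) * (v - u)\<bar>
          \<le> (\<integral>\<omega>. K \<omega> \<partial>M) * (v - u)\<^sup>2"
        using iG1 iG2 u v by simp
    qed
  next
    fix u v assume uv: "u \<in> S" "v \<in> S"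
    have "\<bar>\<integral>\<omega>. H v \<omega> - H u \<omega> - G1 u \<omega> * (v - u) - G2 u \<omega> * ((v - u)\<^sup>2 / 2) \<partial>M\<bar>
        \<le> (\<integral>\<omega>. K \<omega> \<partial>M) * \<bar>v - u\<bar> ^ 3"
    proof (rule le)
      show "AE \<omega> in M. \<bar>H v \<omega> - H u \<omega> - G1 u \<omega> * (v - u) - G2 u \<omega> * ((v - u)\<^sup>2 / 2)\<bar>
          \<le> K \<omega> * \<bar>v - u\<bar> ^ 3"
        using R G1(2) G2(2)
      proof eventually_elim
        case (elim \<omega>)
        then show ?case
          using T3[of "\<lambda>u. H u \<omega>" "F1 \<omega>" "F2 \<omega>" "F3 \<omega>" "K \<omega>" u v] uv by (simp add: R_def jets_def)
      qed
    qed (use iH iG1 iG2 uv in auto)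
    then show "\<bar>\<phi> v - \<phi> u - (\<integral>\<omega>. G1 u \<omega> \<partial>M) * (v - u) - (\<integral>\<omega>. G2 u \<omega> \<partial>M) * ((v - u)\<^sup>2 / 2)\<bar>
        \<le> (\<integral>\<omega>. K \<omega> \<partial>M) * \<bar>v - u\<bar> ^ 3"
      unfolding \<phi>_def using iH iG1 iG2 uv by simp
  qed
qed

section \<open>Riemann sums of functions of bounded variation\<close>

lemma bounded_variation_onE:
  assumes "bounded_variation_on f S"
  obtains V where "0 \<le> V"
    "\<And>n (x :: nat \<Rightarrow> real). (\<And>i. i \<le> n \<Longrightarrow> x i \<in> S) \<Longrightarrow> (\<And>i. i < n \<Longrightarrow> x i \<le> x (Suc i))
       \<Longrightarrow> (\<Sum>i<n. \<bar>f (x (Suc i)) - f (x i)\<bar>) \<le> V"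
proof -
  from assms obtain V where V: "\<And>n (x :: nat \<Rightarrow> real). \<forall>i\<le>n. x i \<in> S \<Longrightarrow> \<forall>i<n. x i \<le> x (Suc i)
       \<Longrightarrow> (\<Sum>i<n. \<bar>f (x (Suc i)) - f (x i)\<bar>) \<le> V"
    unfolding bounded_variation_on_def by blast
  show thesis
    by (rule that[of "max 0 V"]) (use V in \<open>auto simp: le_max_iff_disj\<close>)
qed

lemma bounded_variation_onI:
  assumes "\<And>n (x :: nat \<Rightarrow> real). (\<And>i. i < n \<Longrightarrow> x i \<le> x (Suc i))
     \<Longrightarrow> (\<Sum>i<n. \<bar>f (x (Suc i)) - f (x i)\<bar>) \<le> V"
  shows "bounded_variation_on f UNIV"
  unfolding bounded_variation_on_def using assms by blast

lemma bounded_variation_on_bounded: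
  assumes "bounded_variation_on f UNIV"
  obtains B where "0 \<le> B" "\<And>x. \<bar>f x\<bar> \<le> B"
proof -
  obtain V where V: "0 \<le> V" "\<And>n (x :: nat \<Rightarrow> real). (\<And>i. i < n \<Longrightarrow> x i \<le> x (Suc i))
       \<Longrightarrow> (\<Sum>i<n. \<bar>f (x (Suc i)) - f (x i)\<bar>) \<le> V"
    by (rule bounded_variation_onE[OF assms]) auto
  have "\<bar>f y - f x\<bar> \<le> V" if "x \<le> y" for x y
    using V(2)[of 1 "\<lambda>i. if i = 0 then x else y"] that by simp
  then have "\<bar>f x - f 0\<bar> \<le> V" for x
    by (metis abs_minus_commute linear)
  then have "\<bar>f x\<bar> \<le> \<bar>f 0\<bar> + V" for x
    using abs_triangle_ineq2[of "f x" "f 0"] order_trans[of "\<bar>f x\<bar> - \<bar>f 0\<bar>" "\<bar>f x - f 0\<bar>" V]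
    by (simp add: diff_le_eq add.commute)
  with V(1) show thesis by (intro that[of "\<bar>f 0\<bar> + V"]) auto
qed

lemma bounded_variation_on_mono:
  assumes "mono f" "\<And>x. \<bar>f x\<bar> \<le> B"
  shows "bounded_variation_on f UNIV"
proof (rule bounded_variation_onI[where V = "2 * B"])
  fix n and x :: "nat \<Rightarrow> real" assume x: "\<And>i. i < n \<Longrightarrow> x i \<le> x (Suc i)"
  have "(\<Sum>i<n. \<bar>f (x (Suc i)) - f (x i)\<bar>) = (\<Sum>i<n. f (x (Suc i)) - f (x i))"
    using x monoD[OF assms(1)] by (intro sum.cong refl abs_of_nonneg) simp
  also have "\<dots> = f (x n) - f (x 0)" by (rule sum_lessThan_telescope)
  also have "\<dots> \<le> 2 * B" using assms(2)[of "x n"] assms(2)[of "x 0"] by linarith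
  finally show "(\<Sum>i<n. \<bar>f (x (Suc i)) - f (x i)\<bar>) \<le> 2 * B" .
qed

lemma bounded_variation_on_mult:
  assumes f: "bounded_variation_on f UNIV" and g: "bounded_variation_on g UNIV"
  shows "bounded_variation_on (\<lambda>x. f x * g x) UNIV"
proof -
  obtain V where V: "0 \<le> V" "\<And>n (x :: nat \<Rightarrow> real). (\<And>i. i < n \<Longrightarrow> x i \<le> x (Suc i))
       \<Longrightarrow> (\<Sum>i<n. \<bar>f (x (Suc i)) - f (x i)\<bar>) \<le> V"
    by (rule bounded_variation_onE[OF f]) auto
  obtain V' where V': "0 \<le> V'" "\<And>n (x :: nat \<Rightarrow> real). (\<And>i. i < n \<Longrightarrow> x i \<le> x (Suc i))
       \<Longrightarrow> (\<Sum>i<n. \<bar>g (x (Suc i)) - g (x i)\<bar>) \<le> V'"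
    by (rule bounded_variation_onE[OF g]) auto
  obtain B where B: "0 \<le> B" "\<And>x. \<bar>f x\<bar> \<le> B" using bounded_variation_on_bounded[OF f] by blast
  obtain B' where B': "0 \<le> B'" "\<And>x. \<bar>g x\<bar> \<le> B'" using bounded_variation_on_bounded[OF g] by blast
  show ?thesis
  proof (rule bounded_variation_onI[where V = "B' * V + B * V'"])
    fix n and x :: "nat \<Rightarrow> real" assume x: "\<And>i. i < n \<Longrightarrow> x i \<le> x (Suc i)"
    have "\<bar>f v * g v - f u * g u\<bar> \<le> B' * \<bar>f v - f u\<bar> + B * \<bar>g v - g u\<bar>" for u v
    proof -
      have "f v * g v - f u * g u = (f v - f u) * g v + f u * (g v - g u)" by algebra
      then have "\<bar>f v * g v - f u * g u\<bar> \<le> \<bar>g v\<bar> * \<bar>f v - f u\<bar> + \<bar>f u\<bar> * \<bar>g v - g u\<bar>"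
        by (metis abs_mult abs_triangle_ineq mult.commute)
      also have "\<dots> \<le> B' * \<bar>f v - f u\<bar> + B * \<bar>g v - g u\<bar>"
        by (intro add_mono mult_right_mono B(2) B'(2)) auto
      finally show ?thesis .
    qed
    then have "(\<Sum>i<n. \<bar>f (x (Suc i)) * g (x (Suc i)) - f (x i) * g (x i)\<bar>)
        \<le> (\<Sum>i<n. B' * \<bar>f (x (Suc i)) - f (x i)\<bar> + B * \<bar>g (x (Suc i)) - g (x i)\<bar>)"
      by (intro sum_mono) auto
    also have "\<dots> = B' * (\<Sum>i<n. \<bar>f (x (Suc i)) - f (x i)\<bar>) + B * (\<Sum>i<n. \<bar>g (x (Suc i)) - g (x i)\<bar>)"
      by (simp add: sum.distrib sum_distrib_left)
    also have "\<dots> \<le> B' * V + B * V'"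
      using V(2)[of n x] V'(2)[of n x] x B(1) B'(1) by (intro add_mono mult_left_mono) auto
    finally show "(\<Sum>i<n. \<bar>f (x (Suc i)) * g (x (Suc i)) - f (x i) * g (x i)\<bar>) \<le> B' * V + B * V'" .
  qed
qed

lemma bounded_variation_on_diff_const:
  assumes "bounded_variation_on f UNIV"
  shows "bounded_variation_on (\<lambda>x. c - f x) UNIV"
  using assms unfolding bounded_variation_on_def by (simp add: abs_minus_commute)

text \<open>The monotone projection onto [a, b] maps increasing sequences to increasing sequences,
  which carries bounded variation from the interval to the line.\<close>

lemma bounded_variation_on_clamp:
  assumes f: "bounded_variation_on f {a..b}" and "a \<le> b"
  shows "bounded_variation_on (\<lambda>x. f (max a (min b x))) UNIV"
proof -
  obtain V where V: "0 \<le> V" "\<And>n (x :: nat \<Rightarrow> real). (\<And>i. i \<le> n \<Longrightarrow> x i \<in> {a..b}) \<Longrightarrow>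
       (\<And>i. i < n \<Longrightarrow> x i \<le> x (Suc i)) \<Longrightarrow> (\<Sum>i<n. \<bar>f (x (Suc i)) - f (x i)\<bar>) \<le> V"
    by (rule bounded_variation_onE[OF f]) blast
  show ?thesis
  proof (rule bounded_variation_onI[where V = V])
    fix n and x :: "nat \<Rightarrow> real" assume x: "\<And>i. i < n \<Longrightarrow> x i \<le> x (Suc i)"
    show "(\<Sum>i<n. \<bar>f (max a (min b (x (Suc i)))) - f (max a (min b (x i)))\<bar>) \<le> V"
    proof (rule V(2))
      show "max a (min b (x i)) \<le> max a (min b (x (Suc i)))" if "i < n" for i
        using x[OF that] by (intro max.mono min.mono) auto
    qed (use \<open>a \<le> b\<close> in auto)
  qed
qed

text \<open>The function may jump at a and b. On the line it is the product of the clamped f, a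
  power of the clamped identity and two step functions that cut out [a, b]; each factor has bounded
  variation.\<close>

lemma bounded_variation_on_zero_outside:
  assumes f: "bounded_variation_on f {a..b}" and "a \<le> b" and zero: "\<And>x. x \<notin> {a..b} \<Longrightarrow> f x = 0"
  shows "bounded_variation_on (\<lambda>x. f x * x ^ r) UNIV"
proof -
  define c where "c x = max a (min b x)" for x
  have c: "bounded_variation_on c UNIV"
    by (rule bounded_variation_on_mono[where B = "\<bar>a\<bar> + \<bar>b\<bar>"])
       (use \<open>a \<le> b\<close> in \<open>auto simp: c_def mono_def\<close>)
  have cr: "bounded_variation_on (\<lambda>x. c x ^ r) UNIV"
  proof (induction r)
    case 0
    show ?case by (rule bounded_variation_onI[where V = 0]) simp
  next
    case (Suc r)
    then show ?case using bounded_variation_on_mult[OF c] by simp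
  qed
  have ge: "bounded_variation_on (\<lambda>x. of_bool (a \<le> x)) UNIV"
    by (rule bounded_variation_on_mono[where B = 1]) (auto simp: mono_def)
  have "bounded_variation_on (\<lambda>x. 1 - of_bool (b < x)) UNIV"
    by (intro bounded_variation_on_diff_const bounded_variation_on_mono[where B = 1])
       (auto simp: mono_def)
  from bounded_variation_on_mult[OF bounded_variation_on_mult[OF
      bounded_variation_on_clamp[OF f \<open>a \<le> b\<close>, folded c_def] cr] bounded_variation_on_mult[OF ge this]]
  have "bounded_variation_on (\<lambda>x. f (c x) * c x ^ r * (of_bool (a \<le> x) * (1 - of_bool (b < x)))) UNIV" .
  also have "(\<lambda>x. f (c x) * c x ^ r * (of_bool (a \<le> x) * (1 - of_bool (b < x)))) = (\<lambda>x. f x * x ^ r)"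
  proof
    fix x
    show "f (c x) * c x ^ r * (of_bool (a \<le> x) * (1 - of_bool (b < x))) = f x * x ^ r"
    proof (cases "x \<in> {a..b}")
      case True
      then have "c x = x" by (auto simp: c_def)
      with True show ?thesis by auto
    next
      case False
      then show ?thesis using zero[of x] by (auto simp: not_le not_less)
    qed
  qed
  finally show ?thesis .
qed

lemma sum_lessThan_double:
  fixes g :: "nat \<Rightarrow> real"
  shows "(\<Sum>j<2 * n. g j) = (\<Sum>i<n. g (2 * i) + g (Suc (2 * i)))"
  by (induction n) auto

text \<open>The steps from t i to t' i are every second step of one increasing sequence, and the
  remaining steps can only add to its variation.\<close>

lemma bounded_variation_interlaced:
  fixes f :: "real \<Rightarrow> real"
  assumes V: "\<And>n (x :: nat \<Rightarrow> real). (\<And>i. i < n \<Longrightarrow> x i \<le> x (Suc i))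
       \<Longrightarrow> (\<Sum>i<n. \<bar>f (x (Suc i)) - f (x i)\<bar>) \<le> V"
    and t: "\<And>i. t i \<le> t' i" "\<And>i. t' i \<le> t (Suc i)"
  shows "(\<Sum>i<n. \<bar>f (t' i) - f (t i)\<bar>) \<le> V"
proof -
  define y where "y j = (if even j then t (j div 2) else t' (j div 2))" for j :: nat
  have "y j \<le> y (Suc j)" for j
    using t by (cases "even j") (simp_all add: y_def)
  then have "(\<Sum>j<2 * n. \<bar>f (y (Suc j)) - f (y j)\<bar>) \<le> V" by (rule V)
  moreover have "(\<Sum>i<n. \<bar>f (t' i) - f (t i)\<bar>) \<le> (\<Sum>j<2 * n. \<bar>f (y (Suc j)) - f (y j)\<bar>)"
    unfolding sum_lessThan_double by (intro sum_mono) (simp add: y_def)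
  ultimately show ?thesis by linarith
qed

text \<open>Every cell integral is an integral over shifts \<open>s \<in> [0, 1/h]\<close> of the left end point, and for
  each fixed \<open>s\<close> the points and their shifts interlace, so that the total error at \<open>s\<close> is at
  most the total variation.\<close>

lemma riemann_sum_bounded_variation:
  fixes f :: "real \<Rightarrow> real"
  assumes V: "\<And>n (x :: nat \<Rightarrow> real). (\<And>i. i < n \<Longrightarrow> x i \<le> x (Suc i))
       \<Longrightarrow> (\<Sum>i<n. \<bar>f (x (Suc i)) - f (x i)\<bar>) \<le> V"
    and zero: "\<And>x. x \<notin> {a..b} \<Longrightarrow> f x = 0" and f: "f integrable_on {a..b}" and h: "0 < h"
    and cover: "(m - real N) / h \<le> a" "b \<le> (m - real p) / h" and "p \<le> N"
  shows "\<bar>(\<Sum>k=p+1..N. 1 / h * f ((m - real k) / h)) - integral {a..b} f\<bar> \<le> V / h"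
proof -
  define t where "t k = (m - real k) / h" for k
  have intU: "f integrable_on UNIV"
    by (rule integrable_on_superset[OF f]) (use zero in auto)
  have int: "f integrable_on {c..d}" for c d
    by (rule integrable_on_subinterval[OF intU]) auto
  have shift: "(\<lambda>s. f (t k + s)) integrable_on {0..1 / h}"
      "integral {0..1 / h} (\<lambda>s. f (t k + s)) = integral {t k..t k + 1 / h} f" for k
    using integrable_shift_real_ivl[of f "t k" "t k + 1 / h" "t k", OF int]
      integral_shift_real_ivl[of "t k" "t k" "t k + 1 / h" f]
    by (simp_all add: add.commute)
  \<comment> \<open>Cell k has left end point t k and right end point t k + 1 / h = t (k - 1), so
    the cells p + 1, ..., N tile the interval from t N to t p.\<close>
  have comb: "integral {t N..t p} f = (\<Sum>k=p+1..N. integral {t k..t k + 1 / h} f)" for N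
  proof (cases "p \<le> N")
    case True
    then show ?thesis
    proof (induction N rule: dec_induct)
      case (step n)
      have tn: "t n = t (Suc n) + 1 / h" using h by (simp add: t_def field_simps)
      have "t (Suc n) \<le> t n" "t n \<le> t p" using h step by (auto simp: t_def divide_right_mono)
      then have "integral {t (Suc n)..t p} f = integral {t (Suc n)..t n} f + integral {t n..t p} f"
        by (intro Henstock_Kurzweil_Integration.integral_combine[symmetric] int)
      then show ?case using step by (simp add: tn)
    qed simp
  next
    case False
    then have "t p < t N" using h by (auto simp: t_def divide_strict_right_mono)
    with False show ?thesis by simp
  qed
  have "integral {a..b} f = integral {t N..t p} f"
    by (rule integral_unique[symmetric], rule has_integral_on_superset[OF integrable_integral[OF f]])
       (use zero cover in \<open>auto simp: t_def\<close>)
  also have "\<dots> = (\<Sum>k=p+1..N. integral {0..1 / h} (\<lambda>s. f (t k + s)))"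
    unfolding comb shift(2) ..
  also have "\<dots> = integral {0..1 / h} (\<lambda>s. \<Sum>k=p+1..N. f (t k + s))"
    by (rule integral_sum[symmetric]) (use shift in auto)
  finally have I: "integral {a..b} f = integral {0..1 / h} (\<lambda>s. \<Sum>k=p+1..N. f (t k + s))" .
  have c: "(\<Sum>k=p+1..N. 1 / h * f (t k)) = integral {0..1 / h} (\<lambda>s. \<Sum>k=p+1..N. f (t k))"
    using h by (simp add: sum_divide_distrib)
  have i1: "(\<lambda>s. \<Sum>k=p+1..N. f (t k + s)) integrable_on {0..1 / h}"
    by (rule integrable_sum) (use shift in auto)
  have i0: "(\<lambda>s::real. \<Sum>k=p+1..N. f (t k)) integrable_on {0..1 / h}"
    by (rule integrable_const_ivl)
  have eq: "(\<Sum>k=p+1..N. 1 / h * f (t k)) - integral {a..b} f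
      = integral {0..1 / h} (\<lambda>s. (\<Sum>k=p+1..N. f (t k)) - (\<Sum>k=p+1..N. f (t k + s)))"
    unfolding I c by (rule Henstock_Kurzweil_Integration.integral_diff[OF i0 i1, symmetric])
  have i2: "(\<lambda>s. (\<Sum>k=p+1..N. f (t k)) - (\<Sum>k=p+1..N. f (t k + s))) integrable_on {0..1 / h}"
    by (rule Henstock_Kurzweil_Integration.integrable_diff[OF i0 i1])
  have bound: "\<bar>(\<Sum>k=p+1..N. f (t k)) - (\<Sum>k=p+1..N. f (t k + s))\<bar> \<le> V" if s: "s \<in> {0..1 / h}" for s
  proof -
    have "\<bar>(\<Sum>k=p+1..N. f (t k)) - (\<Sum>k=p+1..N. f (t k + s))\<bar> \<le> (\<Sum>k=p+1..N. \<bar>f (t k + s) - f (t k)\<bar>)"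
      unfolding sum_subtractf[symmetric] using sum_abs by (subst abs_minus_commute) (simp add: abs_minus_commute)
    \<comment> \<open>The points t k decrease in k; counting down from N makes them increase, as
      \<open>bounded_variation_interlaced\<close> requires.\<close>
    also have "\<dots> = (\<Sum>i<N - p. \<bar>f (t (N - i) + s) - f (t (N - i))\<bar>)"
      by (rule sum.reindex_bij_witness[of _ "\<lambda>i. N - i" "\<lambda>k. N - k"]) (use \<open>p \<le> N\<close> in auto)
    also have "\<dots> = (\<Sum>i<N - p. \<bar>f ((m - real N + real i) / h + s) - f ((m - real N + real i) / h)\<bar>)"
      by (intro sum.cong) (auto simp: t_def of_nat_diff algebra_simps)
    also have "\<dots> \<le> V"
      by (rule bounded_variation_interlaced[OF V]) (use s h in \<open>auto simp: field_simps\<close>)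
    finally show ?thesis .
  qed
  have "norm (integral {0..1 / h} (\<lambda>s. (\<Sum>k=p+1..N. f (t k)) - (\<Sum>k=p+1..N. f (t k + s))))
      \<le> V * measure lborel {0..1 / h}"
  proof (rule has_integral_bound_real[OF _ finite.emptyI integrable_integral[OF i2]])
    show "0 \<le> V" using bound[of 0] h by force
  qed (use bound in auto)
  then show ?thesis unfolding eq[unfolded t_def] using h by (simp add: t_def)
qed

text \<open>A gauge integral alone does not pass to products. Bounded variation makes W bounded,
  hence absolutely integrable, and then a bounded measurable factor preserves integrability.\<close>

lemma kernel_power_integrable:
  assumes bv: "bounded_variation_on W {a..b}" and "a \<le> b" and zero: "\<And>x. x \<notin> {a..b} \<Longrightarrow> W x = 0"
    and int: "W integrable_on {a..b}"
  shows "(\<lambda>x. W x * x ^ r) integrable_on {a..b}"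
proof -
  have "bounded_variation_on W UNIV" 
    using bounded_variation_on_zero_outside[OF bv \<open>a \<le> b\<close> zero, of 0] by simp
  then obtain B where B: "\<And>x. \<bar>W x\<bar> \<le> B" using bounded_variation_on_bounded by blast
  have ai: "W absolutely_integrable_on {a..b}"
    by (rule absolutely_integrable_integrable_bound[where g = "\<lambda>_. B"]) (use B int in auto)
  have "(\<lambda>x. x ^ r * W x) absolutely_integrable_on {a..b}"
  proof (rule absolutely_integrable_bounded_measurable_product_real[OF _ _ _ ai])
    have cont: "continuous_on {a..b} (\<lambda>x. x ^ r)" by (intro continuous_intros)
    then show "bounded ((\<lambda>x. x ^ r) ` {a..b})"
      by (intro compact_imp_bounded compact_continuous_image) auto
    show "(\<lambda>x. x ^ r) \<in> borel_measurable (lebesgue_on {a..b})"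
      by (rule continuous_imp_measurable_on_sets_lebesgue[OF cont]) simp
  qed auto
  then show ?thesis by (simp add: set_lebesgue_integral_eq_integral(1) mult.commute)
qed

section \<open>Levels of the ARCH series\<close>

lemma diff_of_nat_le: "t - int m \<le> t"
  by simp

text \<open>The part of the series with exactly n lags, expanded in its first lag. This recursion
  replaces manipulations of lag lists: bounds, smoothness and measurability of levels are all proved
  by induction along it.\<close>

primrec arch_level :: "nat \<Rightarrow> (nat \<Rightarrow> int \<Rightarrow> real) \<Rightarrow> (int \<Rightarrow> real) \<Rightarrow> nat \<Rightarrow> int \<Rightarrow> real" where
  "arch_level p c z 0 = (\<lambda>t. c 0 t * (z t)\<^sup>2)"
| "arch_level p c z (Suc n) = (\<lambda>t. (z t)\<^sup>2 * (\<Sum>j=1..p. c j t * arch_level p c z n (t - int j)))"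

definition arch_series :: "nat \<Rightarrow> (nat \<Rightarrow> int \<Rightarrow> real) \<Rightarrow> (int \<Rightarrow> real) \<Rightarrow> int \<Rightarrow> real" where
  "arch_series p c z t = (\<Sum>n. arch_level p c z n t)"

lemma lag_Cons: "lag t (j # js) 0 = t" "lag t (j # js) (Suc r) = lag (t - int j) js r"
  by (simp_all add: lag_def)

lemma arch_term_Cons:
  "arch_term c z t (j # js) = (z t)\<^sup>2 * (c j t * arch_term c z (t - int j) js)"
  unfolding arch_term_def
  by (simp add: lag_Cons prod.lessThan_Suc_shift prod.atMost_Suc_shift del: prod.lessThan_Suc prod.atMost_Suc)

lemma arch_level_eq_sum:
  "arch_level p c z n t = (\<Sum>js\<in>{js. set js \<subseteq> {1..p} \<and> length js = n}. arch_term c z t js)"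
proof (induction n arbitrary: t)
  case 0
  have "{js. set js \<subseteq> {1..p} \<and> length js = 0} = {[]}" by auto
  then show ?case by (simp add: arch_term_def lag_def)
next
  case (Suc n)
  let ?A = "{js. set js \<subseteq> {1..p} \<and> length js = n}"
  have "(\<Sum>js\<in>{js. set js \<subseteq> {1..p} \<and> length js = Suc n}. arch_term c z t js)
      = (\<Sum>(js, j)\<in>?A \<times> {1..p}. arch_term c z t (j # js))"
    unfolding lists_length_Suc_eq by (subst sum.reindex) (auto simp: inj_on_def case_prod_beta)
  also have "\<dots> = (\<Sum>j=1..p. \<Sum>js\<in>?A. arch_term c z t (j # js))"
    unfolding sum.cartesian_product[symmetric] by (rule sum.swap)
  also have "\<dots> = (z t)\<^sup>2 * (\<Sum>j=1..p. c j t * (\<Sum>js\<in>?A. arch_term c z (t - int j) js))"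
    by (simp add: arch_term_Cons sum_distrib_left)
  finally show ?case by (simp add: Suc)
qed

lemma arch_term_eq_0: "j \<in> set js \<Longrightarrow> (\<And>s. c j s = 0) \<Longrightarrow> arch_term c z t js = 0"
  by (induction js arbitrary: t) (auto simp: arch_term_Cons)

text \<open>Lists containing a lag above p contribute nothing, and an unconditional sum may be
  regrouped by the length of the list, which leaves a series in n.\<close>

lemma arch_level_sums:
  assumes "(arch_term c z t has_sum s) {js. \<forall>j\<in>set js. 1 \<le> j}" "\<And>j s. p < j \<Longrightarrow> c j s = 0"
  shows "(\<lambda>n. arch_level p c z n t) sums s"
proof -
  let ?A = "\<lambda>n. {js. set js \<subseteq> {1..p} \<and> length js = n}"
  have "(arch_term c z t has_sum s) {js. set js \<subseteq> {1..p}}"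
  proof (rule has_sum_cong_neutral[THEN iffD1, OF _ _ _ assms(1)])
    fix js assume "js \<in> {js. \<forall>j\<in>set js. 1 \<le> j} - {js. set js \<subseteq> {1..p}}"
    then obtain j where "j \<in> set js" "p < j" by (force simp: not_le)
    then show "arch_term c z t js = 0" using arch_term_eq_0 assms(2) by blast
  qed auto
  also have "{js. set js \<subseteq> {1..p}} = snd ` (Sigma UNIV ?A)"
    by (auto simp: image_iff)
  finally have "((arch_term c z t \<circ> snd) has_sum s) (Sigma UNIV ?A)"
    by (subst (asm) has_sum_reindex) (auto simp: inj_on_def)
  then have "((\<lambda>n. arch_level p c z n t) has_sum s) UNIV"
  proof (rule has_sum_SigmaD)
    fix n :: nat
    have "finite (?A n)" by (rule finite_lists_length_eq) simp
    then show "((\<lambda>js. (arch_term c z t \<circ> snd) (n, js)) has_sum arch_level p c z n t) (?A n)"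
      by (simp add: arch_level_eq_sum has_sum_finite)
  qed
  then show ?thesis by (rule has_sum_imp_sums)
qed

text \<open>The inflation factor \<open>lam > 1\<close> on the positive lags makes the level-\<open>n\<close> term of every ARCH
  series with coefficients below \<open>q\<close> smaller by a factor \<open>lam ^ n\<close>, which absorbs all polynomial
  factors in \<open>n\<close> coming from differentiation and from truncation.\<close>

definition dom_coeff :: "real \<Rightarrow> (nat \<Rightarrow> real) \<Rightarrow> nat \<Rightarrow> int \<Rightarrow> real" where
  "dom_coeff lam q j s = (if j = 0 then q 0 else lam * q j)"

text \<open>Only times up to t are constrained: the series at t looks backwards, and beyond time N
  the time-varying coefficients are evaluated outside [0, 1], where nothing is known about
  them.\<close>

definition coeff_le :: "nat \<Rightarrow> (nat \<Rightarrow> real) \<Rightarrow> (nat \<Rightarrow> int \<Rightarrow> real) \<Rightarrow> int \<Rightarrow> bool" where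
  "coeff_le p q c t \<longleftrightarrow> (\<forall>j\<le>p. \<forall>s\<le>t. 0 \<le> c j s \<and> c j s \<le> q j)"

lemma coeff_le_mono: "coeff_le p q c t \<Longrightarrow> s \<le> t \<Longrightarrow> coeff_le p q c s"
  unfolding coeff_le_def by auto

lemma coeff_leD: "coeff_le p q c t \<Longrightarrow> j \<le> p \<Longrightarrow> s \<le> t \<Longrightarrow> 0 \<le> c j s \<and> c j s \<le> q j"
  unfolding coeff_le_def by auto

lemma arch_level_nonneg:
  assumes "coeff_le p q c t"
  shows "0 \<le> arch_level p c z n t"
  using assms
proof (induction n arbitrary: t)
  case 0
  then show ?case by (auto dest: coeff_leD)
next
  case (Suc n)
  have "0 \<le> arch_level p c z n (t - int j)" for j
    by (rule Suc.IH[OF coeff_le_mono[OF Suc.prems]]) simp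
  then show ?case using coeff_leD[OF Suc.prems]
    by (auto intro!: mult_nonneg_nonneg sum_nonneg)
qed

lemma dom_level_nonneg:
  assumes "\<And>j. 0 \<le> q j" "0 \<le> lam"
  shows "0 \<le> arch_level p (dom_coeff lam q) z n t"
  by (rule arch_level_nonneg[where q = "\<lambda>j. dom_coeff lam q j 0"])
     (use assms in \<open>auto simp: coeff_le_def dom_coeff_def\<close>)

lemma dom_level_Suc:
  "arch_level p (dom_coeff lam q) z (Suc n) t
     = lam * ((z t)\<^sup>2 * (\<Sum>j=1..p. q j * arch_level p (dom_coeff lam q) z n (t - int j)))"
proof -
  have "(\<Sum>j=1..p. dom_coeff lam q j t * arch_level p (dom_coeff lam q) z n (t - int j))
      = (\<Sum>j=1..p. lam * (q j * arch_level p (dom_coeff lam q) z n (t - int j)))"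
    by (intro sum.cong) (auto simp: dom_coeff_def)
  then show ?thesis by (simp flip: sum_distrib_left)
qed

lemma arch_level_le_dom:
  assumes "coeff_le p q c t" "1 \<le> lam" and q: "\<And>j. 0 \<le> q j"
  shows "arch_level p c z n t \<le> arch_level p (dom_coeff lam q) z n t / lam ^ n"
  using assms(1)
proof (induction n arbitrary: t)
  case 0
  then show ?case by (auto dest!: coeff_leD[of _ _ _ _ 0] simp: dom_coeff_def intro!: mult_right_mono)
next
  case (Suc n)
  have "(\<Sum>j=1..p. c j t * arch_level p c z n (t - int j))
      \<le> (\<Sum>j=1..p. q j * (arch_level p (dom_coeff lam q) z n (t - int j) / lam ^ n))"
  proof (intro sum_mono mult_mono)
    fix j
    have c: "coeff_le p q c (t - int j)" by (rule coeff_le_mono[OF Suc.prems]) simp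
    show "arch_level p c z n (t - int j) \<le> arch_level p (dom_coeff lam q) z n (t - int j) / lam ^ n"
      by (rule Suc.IH[OF c])
    show "0 \<le> arch_level p c z n (t - int j)" by (rule arch_level_nonneg[OF c])
  qed (use q coeff_leD[OF Suc.prems] in auto)
  then have "(z t)\<^sup>2 * (\<Sum>j=1..p. c j t * arch_level p c z n (t - int j))
      \<le> (z t)\<^sup>2 * (\<Sum>j=1..p. q j * (arch_level p (dom_coeff lam q) z n (t - int j) / lam ^ n))"
    by (rule mult_left_mono) simp
  then show ?case unfolding dom_level_Suc using assms(2)
    by (simp add: sum_divide_distrib[symmetric])
qed

text \<open>A product of n + 1 coefficients is changed one factor at a time, which costs the factor
  n + 1. Closeness is required only on the stretch of length n * p that n lags of size at most p can
  reach.\<close>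

lemma arch_level_diff_le:
  assumes "coeff_le p q c t" "coeff_le p q c' t" "1 \<le> lam" and q: "\<And>j. 0 \<le> q j" and "0 \<le> D"
    and "\<And>j s. j \<le> p \<Longrightarrow> t - int (n * p) \<le> s \<Longrightarrow> s \<le> t \<Longrightarrow> \<bar>c j s - c' j s\<bar> \<le> q j * D"
  shows "\<bar>arch_level p c z n t - arch_level p c' z n t\<bar>
    \<le> real (Suc n) * D * (arch_level p (dom_coeff lam q) z n t / lam ^ n)"
  using assms(1,2,6)
proof (induction n arbitrary: t)
  case 0
  have "\<bar>c 0 t * (z t)\<^sup>2 - c' 0 t * (z t)\<^sup>2\<bar> = \<bar>c 0 t - c' 0 t\<bar> * (z t)\<^sup>2"
    by (simp add: abs_mult flip: left_diff_distrib)
  also have "\<dots> \<le> q 0 * D * (z t)\<^sup>2" using 0(3)[of 0 t] by (intro mult_right_mono) auto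
  finally show ?case by (simp add: dom_coeff_def mult_ac)
next
  case (Suc n)
  let ?T = "\<lambda>j. arch_level p c z n (t - int j)" and ?T' = "\<lambda>j. arch_level p c' z n (t - int j)"
  let ?V = "\<lambda>j. arch_level p (dom_coeff lam q) z n (t - int j) / lam ^ n"
  have b: "\<bar>c j t * ?T j - c' j t * ?T' j\<bar> \<le> real (Suc (Suc n)) * D * (q j * ?V j)"
    if "j \<in> {1..p}" for j
  proof -
    have cc: "coeff_le p q c (t - int j)" "coeff_le p q c' (t - int j)"
      by (auto intro: coeff_le_mono Suc.prems)
    have "\<bar>?T j - ?T' j\<bar> \<le> real (Suc n) * D * ?V j"
    proof (rule Suc.IH[OF cc])
      fix i s assume *: "i \<le> p" "t - int j - int (n * p) \<le> s" "s \<le> t - int j"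
      have "int j \<le> int p" using that by simp
      with * have "t - int (Suc n * p) \<le> s" by (simp add: algebra_simps)
      with * show "\<bar>c i s - c' i s\<bar> \<le> q i * D" by (intro Suc.prems) auto
    qed
    moreover have "0 \<le> ?T j" by (rule arch_level_nonneg[OF cc(1)])
    moreover have "0 \<le> ?T' j" "?T' j \<le> ?V j"
      using arch_level_nonneg[OF cc(2)] arch_level_le_dom[OF cc(2) assms(3) q] by auto
    moreover have "\<bar>c j t - c' j t\<bar> \<le> q j * D"
      using that by (intro Suc.prems diff_of_nat_le) auto
    moreover have "0 \<le> c j t" "c j t \<le> q j" using coeff_leD[OF Suc.prems(1), of j t] that by auto
    moreover have "\<bar>c j t * ?T j - c' j t * ?T' j\<bar> \<le> c j t * \<bar>?T j - ?T' j\<bar> + \<bar>c j t - c' j t\<bar> * ?T' j"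
    proof -
      have "c j t * ?T j - c' j t * ?T' j = c j t * (?T j - ?T' j) + (c j t - c' j t) * ?T' j"
        by algebra
      also have "\<bar>\<dots>\<bar> \<le> \<bar>c j t * (?T j - ?T' j)\<bar> + \<bar>(c j t - c' j t) * ?T' j\<bar>"
        by (rule abs_triangle_ineq)
      finally show ?thesis using \<open>0 \<le> c j t\<close> \<open>0 \<le> ?T' j\<close> by (simp add: abs_mult)
    qed
    moreover have "c j t * \<bar>?T j - ?T' j\<bar> \<le> q j * (real (Suc n) * D * ?V j)"
      using calculation q by (intro mult_mono) auto
    moreover have "\<bar>c j t - c' j t\<bar> * ?T' j \<le> (q j * D) * ?V j"
      using calculation q \<open>0 \<le> D\<close> by (intro mult_mono) auto
    ultimately have "\<bar>c j t * ?T j - c' j t * ?T' j\<bar> \<le> q j * (real (Suc n) * D * ?V j) + (q j * D) * ?V j"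
      by linarith
    also have "\<dots> = (real (Suc n) + 1) * D * (q j * ?V j)" by algebra
    also have "real (Suc n) + 1 = real (Suc (Suc n))" by simp
    finally show ?thesis .
  qed
  have "\<bar>arch_level p c z (Suc n) t - arch_level p c' z (Suc n) t\<bar>
      = (z t)\<^sup>2 * \<bar>\<Sum>j=1..p. c j t * ?T j - c' j t * ?T' j\<bar>"
    by (simp add: sum_subtractf abs_mult flip: right_diff_distrib)
  also have "\<dots> \<le> (z t)\<^sup>2 * (\<Sum>j=1..p. real (Suc (Suc n)) * D * (q j * ?V j))"
    by (intro mult_left_mono sum_abs[THEN order_trans] sum_mono b) auto
  also have "\<dots> = real (Suc (Suc n)) * D * (arch_level p (dom_coeff lam q) z (Suc n) t / lam ^ Suc n)"
    unfolding dom_level_Suc using assms(3)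
    by (simp add: sum_distrib_left[symmetric] sum_divide_distrib[symmetric])
  finally show ?case .
qed

text \<open>The exponent is dictated by third derivatives, where each order costs a factor n + 1.
  The quadratic factor in \<open>arch_series_diff_le\<close> is covered by the same
  constant.\<close>

lemma cube_le_power:
  assumes "1 < lam"
  obtains \<kappa> :: real where "0 \<le> \<kappa>" "\<And>n. real (Suc n) ^ 3 / lam ^ n \<le> \<kappa>"
proof -
  have "(\<lambda>n. real (Suc n) ^ 3 / lam ^ n) \<longlonglongrightarrow> 0"
    using assms by real_asymp
  then have "Bseq (\<lambda>n. real (Suc n) ^ 3 / lam ^ n)"
    by (rule convergent_imp_Bseq[OF convergentI])
  then obtain \<kappa> where "0 < \<kappa>" "\<And>n. norm (real (Suc n) ^ 3 / lam ^ n) \<le> \<kappa>"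
    by (auto elim: BseqE)
  then show thesis by (intro that[of \<kappa>]) (auto simp del: of_nat_Suc intro: abs_le_D1)
qed

section \<open>Comparison of series along a fixed noise path\<close>

context
  fixes p :: nat and q :: "nat \<Rightarrow> real" and lam :: real and z :: "int \<Rightarrow> real" and t :: int
  assumes lam: "1 < lam" and q: "\<And>j. 0 \<le> q j"
    and sV: "summable (\<lambda>n. arch_level p (dom_coeff lam q) z n t)"
begin

lemma dom_series_nonneg: "0 \<le> arch_series p (dom_coeff lam q) z t"
  unfolding arch_series_def using lam q by (intro suminf_nonneg sV dom_level_nonneg) auto

lemma dom_div_le: "arch_level p (dom_coeff lam q) z n t / lam ^ n \<le> arch_level p (dom_coeff lam q) z n t"
  using dom_level_nonneg[of q lam p z n t] lam q one_le_power[of lam n]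
  by (simp add: divide_le_eq mult_le_cancel_left1)

lemma arch_series_summable:
  assumes "coeff_le p q c t"
  shows "summable (\<lambda>n. arch_level p c z n t)"
proof (rule summable_comparison_test'[OF sV, of 0])
  fix n
  have "arch_level p c z n t \<le> arch_level p (dom_coeff lam q) z n t"
    using arch_level_le_dom[OF assms, of lam] lam q dom_div_le[of n] by (meson order_trans less_imp_le)
  then show "norm (arch_level p c z n t) \<le> arch_level p (dom_coeff lam q) z n t"
    using arch_level_nonneg[OF assms] by simp
qed

lemma arch_partial_nonneg: "coeff_le p q c t \<Longrightarrow> 0 \<le> (\<Sum>n<m. arch_level p c z n t)"
  by (intro sum_nonneg arch_level_nonneg)

lemma arch_partial_le:
  assumes "coeff_le p q c t"
  shows "(\<Sum>n<m. arch_level p c z n t) \<le> arch_series p c z t"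
  unfolding arch_series_def
  by (rule sum_le_suminf[OF arch_series_summable[OF assms]])
     (use arch_level_nonneg[OF assms] in auto)

lemma arch_series_nonneg: "coeff_le p q c t \<Longrightarrow> 0 \<le> arch_series p c z t"
  unfolding arch_series_def by (intro suminf_nonneg arch_series_summable arch_level_nonneg)

lemma arch_series_le_dom:
  assumes "coeff_le p q c t"
  shows "arch_series p c z t \<le> arch_series p (dom_coeff lam q) z t"
  unfolding arch_series_def
proof (rule suminf_le[OF _ arch_series_summable[OF assms] sV])
  show "arch_level p c z n t \<le> arch_level p (dom_coeff lam q) z n t" for n
    using arch_level_le_dom[OF assms, of lam] lam q dom_div_le[of n] by (meson order_trans less_imp_le)
qed

text \<open>Every level from m on lies below its dominating level by at least the factor lam ^ m.
  The levels below m read finitely many noise values, so this is what allows decoupling in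
  time.\<close>

lemma arch_series_truncation:
  assumes "coeff_le p q c t"
  shows "\<bar>arch_series p c z t - (\<Sum>n<m. arch_level p c z n t)\<bar>
    \<le> arch_series p (dom_coeff lam q) z t / lam ^ m"
proof -
  let ?f = "\<lambda>n. arch_level p c z n t" and ?V = "\<lambda>n. arch_level p (dom_coeff lam q) z n t"
  have V0: "0 \<le> ?V n" for n using lam q by (intro dom_level_nonneg) auto
  have eq: "arch_series p c z t - (\<Sum>n<m. ?f n) = (\<Sum>n. ?f (n + m))"
    unfolding arch_series_def
    using suminf_split_initial_segment[OF arch_series_summable[OF assms], of m] by simp
  have "0 \<le> (\<Sum>n. ?f (n + m))"
    using arch_level_nonneg[OF assms] arch_series_summable[OF assms]
    by (intro suminf_nonneg summable_ignore_initial_segment) auto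
  then have "\<bar>arch_series p c z t - (\<Sum>n<m. ?f n)\<bar> = (\<Sum>n. ?f (n + m))"
    unfolding eq by simp
  also have "\<dots> \<le> (\<Sum>n. ?V (n + m) / lam ^ m)"
  proof (rule suminf_le)
    fix n
    have "?f (n + m) \<le> ?V (n + m) / lam ^ (n + m)"
      using lam q by (intro arch_level_le_dom[OF assms]) auto
    also have "\<dots> \<le> ?V (n + m) / lam ^ m"
      using lam V0 by (intro divide_left_mono power_increasing) auto
    finally show "?f (n + m) \<le> ?V (n + m) / lam ^ m" .
    show "summable (\<lambda>n. ?f (n + m))" using arch_series_summable[OF assms] by (rule summable_ignore_initial_segment)
    show "summable (\<lambda>n. ?V (n + m) / lam ^ m)" using sV by (intro summable_divide summable_ignore_initial_segment)
  qed
  also have "\<dots> = (\<Sum>n. ?V (n + m)) / lam ^ m"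
    using sV by (intro suminf_divide summable_ignore_initial_segment)
  also have "\<dots> \<le> arch_series p (dom_coeff lam q) z t / lam ^ m"
  proof (rule divide_right_mono)
    show "(\<Sum>n. ?V (n + m)) \<le> arch_series p (dom_coeff lam q) z t"
      using suminf_split_initial_segment[OF sV, of m] V0 sum_nonneg[of "{..<m}" ?V]
      by (simp add: arch_series_def)
  qed (use lam in simp)
  finally show ?thesis .
qed

text \<open>If level \<open>n\<close> reaches back before time \<open>0\<close>, where the coefficients of the two processes are
  unrelated, then \<open>n p \<ge> t \<ge> \<tau> N\<close>, so the trivial bound already gains the factor \<open>1 / N\<close>.\<close>

lemma arch_series_diff_le:
  assumes c: "coeff_le p q c t" "coeff_le p q c' t" and "1 \<le> p" "0 < N" "0 < \<tau>" "\<tau> * real N \<le> real_of_int t"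
    and "0 \<le> L"
    and lip: "\<And>j s. j \<le> p \<Longrightarrow> 0 \<le> s \<Longrightarrow> s \<le> t \<Longrightarrow> \<bar>c j s - c' j s\<bar> \<le> q j * (L * \<bar>real_of_int s / real N - u\<bar>)"
    and \<kappa>: "\<And>n. real (Suc n) ^ 3 / lam ^ n \<le> \<kappa>"
  shows "\<bar>arch_series p c z t - arch_series p c' z t\<bar>
    \<le> (L + 1 / \<tau>) * real p * \<kappa> * (\<bar>real_of_int t / real N - u\<bar> + 1 / real N) * arch_series p (dom_coeff lam q) z t"
proof -
  let ?f = "\<lambda>n. arch_level p c z n t" and ?f' = "\<lambda>n. arch_level p c' z n t"
  let ?V = "\<lambda>n. arch_level p (dom_coeff lam q) z n t"
  define d where "d = \<bar>real_of_int t / real N - u\<bar> + 1 / real N"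
  define K where "K = (L + 1 / \<tau>) * real p * \<kappa> * d"
  have V0: "0 \<le> ?V n" for n using lam q by (intro dom_level_nonneg) auto
  have d0: "0 \<le> d" by (simp add: d_def)
  have level: "\<bar>?f n - ?f' n\<bar> \<le> K * ?V n" for n
  proof -
    have "\<bar>?f n - ?f' n\<bar> \<le> (L + 1 / \<tau>) * real p * real (Suc n) ^ 3 * d * (?V n / lam ^ n)"
    proof (cases "0 \<le> t - int (n * p)")
      case True
      define D where "D = L * (\<bar>real_of_int t / real N - u\<bar> + real (n * p) / real N)"
      have "\<bar>?f n - ?f' n\<bar> \<le> real (Suc n) * D * (?V n / lam ^ n)"
      proof (rule arch_level_diff_le[OF c])
        show "0 \<le> D" using \<open>0 \<le> L\<close> by (auto simp: D_def)
        fix j s assume s: "j \<le> p" "t - int (n * p) \<le> s" "s \<le> t"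
        have "\<bar>real_of_int s / real N - real_of_int t / real N\<bar> = (real_of_int t - real_of_int s) / real N"
          using s by (simp add: diff_divide_distrib[symmetric] abs_div_pos)
        also have "\<dots> \<le> real (n * p) / real N"
          using s by (intro divide_right_mono) linarith+
        finally have "\<bar>real_of_int s / real N - u\<bar> \<le> \<bar>real_of_int t / real N - u\<bar> + real (n * p) / real N"
          by linarith
        then have "L * \<bar>real_of_int s / real N - u\<bar> \<le> D"
          unfolding D_def using \<open>0 \<le> L\<close> by (rule mult_left_mono)
        then have "q j * (L * \<bar>real_of_int s / real N - u\<bar>) \<le> q j * D" by (rule mult_left_mono[OF _ q])
        with lip[of j s] s True show "\<bar>c j s - c' j s\<bar> \<le> q j * D" by simp
      qed (use lam q in auto)
      also have "\<dots> \<le> (L + 1 / \<tau>) * real p * real (Suc n) ^ 3 * d * (?V n / lam ^ n)"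
      proof (intro mult_right_mono)
        have "real (n * p) / real N \<le> real p * real (Suc n) * (1 / real N)"
          using divide_right_mono[of "real (n * p)" "real p * real (Suc n)" "real N"] by (simp add: algebra_simps)
        moreover have "\<bar>real_of_int t / real N - u\<bar> \<le> real p * real (Suc n) * \<bar>real_of_int t / real N - u\<bar>"
        proof -
          have "1 * 1 \<le> real p * real (Suc n)" using \<open>1 \<le> p\<close> by (intro mult_mono) auto
          then show ?thesis by (simp add: mult_le_cancel_right1)
        qed
        ultimately have "\<bar>real_of_int t / real N - u\<bar> + real (n * p) / real N \<le> real p * real (Suc n) * d"
          by (simp add: d_def distrib_left)
        then have "D \<le> L * (real p * real (Suc n) * d)"
          unfolding D_def using \<open>0 \<le> L\<close> by (rule mult_left_mono)
        also have "\<dots> \<le> (L + 1 / \<tau>) * (real p * real (Suc n) * d)"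
          using \<open>0 < \<tau>\<close> d0 by (intro mult_right_mono mult_nonneg_nonneg) auto
        finally have "real (Suc n) * D \<le> real (Suc n) * ((L + 1 / \<tau>) * (real p * real (Suc n) * d))"
          by (rule mult_left_mono) simp
        also have "\<dots> = (L + 1 / \<tau>) * real p * real (Suc n) ^ 2 * d" by (simp add: power2_eq_square)
        \<comment> \<open>One factor n + 1 counts the coefficients, the other comes from the reach n
          * p of the level. Their square is raised to a cube so that \<kappa> applies.\<close>
        also have "\<dots> \<le> (L + 1 / \<tau>) * real p * real (Suc n) ^ 3 * d"
          using \<open>0 < \<tau>\<close> d0 \<open>0 \<le> L\<close> by (intro mult_right_mono mult_left_mono power_increasing) auto
        finally show "real (Suc n) * D \<le> (L + 1 / \<tau>) * real p * real (Suc n) ^ 3 * d" .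
      qed (use V0 lam in auto)
      finally show ?thesis .
    next
      case False
      have "0 \<le> ?f n" "0 \<le> ?f' n" "?f n \<le> ?V n / lam ^ n" "?f' n \<le> ?V n / lam ^ n"
        using arch_level_nonneg c arch_level_le_dom[OF c(1), of lam] arch_level_le_dom[OF c(2), of lam] lam q
        by (auto simp: less_imp_le)
      then have "\<bar>?f n - ?f' n\<bar> \<le> 1 * (?V n / lam ^ n)" by linarith
      also have "\<dots> \<le> (L + 1 / \<tau>) * real p * real (Suc n) ^ 3 * d * (?V n / lam ^ n)"
      proof (rule mult_right_mono)
        from False have "real_of_int t \<le> real (n * p)" by linarith
        with assms(6) have "\<tau> * real N \<le> real n * real p" by simp
        then have "1 \<le> 1 / \<tau> * real p * real n * (1 / real N)"
          using \<open>0 < \<tau>\<close> \<open>0 < N\<close> by (simp add: field_simps)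
        also have "\<dots> \<le> (L + 1 / \<tau>) * real p * real (Suc n) ^ 3 * d"
        proof (intro mult_mono)
          have "real n \<le> real (Suc n) ^ 1" by simp
          also have "\<dots> \<le> real (Suc n) ^ 3" by (intro power_increasing) auto
          finally show "real n \<le> real (Suc n) ^ 3" .
        qed (use \<open>0 < \<tau>\<close> d0 \<open>0 \<le> L\<close> in \<open>auto simp: d_def\<close>)
        finally show "1 \<le> (L + 1 / \<tau>) * real p * real (Suc n) ^ 3 * d" .
      qed (use V0 lam in auto)
      finally show ?thesis .
    qed
    also have "\<dots> = (L + 1 / \<tau>) * real p * d * ?V n * (real (Suc n) ^ 3 / lam ^ n)" by simp
    also have "\<dots> \<le> (L + 1 / \<tau>) * real p * d * ?V n * \<kappa>"
      using \<open>0 < \<tau>\<close> d0 \<open>0 \<le> L\<close> V0 by (intro mult_left_mono \<kappa> mult_nonneg_nonneg) auto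
    finally show ?thesis by (simp add: K_def mult_ac)
  qed
  have sK: "summable (\<lambda>n. K * ?V n)" by (rule summable_mult[OF sV])
  have sa: "summable (\<lambda>n. \<bar>?f n - ?f' n\<bar>)"
    by (rule summable_comparison_test'[OF sK, of 0]) (use level in auto)
  have "arch_series p c z t - arch_series p c' z t = (\<Sum>n. ?f n - ?f' n)"
    unfolding arch_series_def by (intro suminf_diff arch_series_summable c)
  also have "\<bar>\<dots>\<bar> \<le> (\<Sum>n. \<bar>?f n - ?f' n\<bar>)" by (rule summable_rabs[OF sa])
  also have "\<dots> \<le> (\<Sum>n. K * ?V n)" by (rule suminf_le[OF level sa sK])
  also have "\<dots> = K * arch_series p (dom_coeff lam q) z t"
    unfolding arch_series_def by (rule suminf_mult[OF sV])
  finally show ?thesis by (simp add: K_def d_def)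
qed

end

text \<open>Only orders up to 3 occur, so m ^ i is at most m ^ 3: a growing rate can be moved into
  the amplitude, where the geometric decay of the levels absorbs it.\<close>

lemma jet_rescale:
  assumes "jet S f A (B * m)" "1 \<le> m" "0 \<le> A" "0 \<le> B"
  shows "jet S f (A * m ^ 3) B"
proof -
  have "A * (B * m) ^ i \<le> A * m ^ 3 * B ^ i" if "i \<le> 3" for i
  proof -
    have "A * (B * m) ^ i = A * B ^ i * m ^ i" by (simp add: power_mult_distrib)
    also have "\<dots> \<le> A * B ^ i * m ^ 3" using assms that by (intro mult_left_mono power_increasing) auto
    finally show ?thesis by (simp add: mult_ac)
  qed
  note le = this[of 0, simplified] this[of 1, simplified] this[of 2, simplified] this[of 3, simplified]
  obtain f' f'' f''' where "jets S f f' f'' f''' A (B * m)"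
    using assms(1) unfolding jet_def by blast
  note f = jetsD[OF this]
  show ?thesis
    by (rule jetI[OF f(1-3) order_trans[OF f(4) le(1)] order_trans[OF f(5) le(2)]
          order_trans[OF f(6) le(3)] order_trans[OF f(7) le(4)]])
qed

text \<open>Level n is a sum of products of n + 1 coefficients of rate B each; by
  \<open>jet_mult\<close> the rates add up to B * (n + 1), and the amplitudes multiply to the
  dominating level without its inflation.\<close>

lemma jet_arch_level:
  assumes a: "\<And>j. j \<le> p \<Longrightarrow> jet S (a j) (q j) B" and "0 \<le> B" "1 \<le> lam" and q: "\<And>j. 0 \<le> q j"
  shows "jet S (\<lambda>u. arch_level p (stat_coeff p a u) z n t)
    (arch_level p (dom_coeff lam q) z n t / lam ^ n) (B * real (Suc n))"
proof (induction n arbitrary: t)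
  case 0
  show ?case
    using jet_cmult[OF a[of 0], of "(z t)\<^sup>2" "(z t)\<^sup>2"] by (simp add: stat_coeff_def dom_coeff_def mult.commute)
next
  case (Suc n)
  let ?V = "\<lambda>j. arch_level p (dom_coeff lam q) z n (t - int j) / lam ^ n"
  have "jet S (\<lambda>u. a j u * arch_level p (stat_coeff p a u) z n (t - int j)) (q j * ?V j)
      (B + B * real (Suc n))" if "j \<in> {1..p}" for j
    using that by (intro jet_mult a Suc.IH) auto
  then have "jet S (\<lambda>u. (z t)\<^sup>2 * (\<Sum>j=1..p. a j u * arch_level p (stat_coeff p a u) z n (t - int j)))
      ((z t)\<^sup>2 * (\<Sum>j=1..p. q j * ?V j)) (B + B * real (Suc n))"
    using \<open>0 \<le> B\<close> by (intro jet_cmult jet_sum) auto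
  moreover have "(z t)\<^sup>2 * (\<Sum>j=1..p. q j * ?V j)
      = arch_level p (dom_coeff lam q) z (Suc n) t / lam ^ Suc n"
    unfolding dom_level_Suc using \<open>1 \<le> lam\<close> by (simp add: sum_divide_distrib[symmetric])
  moreover have "B + B * real (Suc n) = B * real (Suc (Suc n))" by (simp add: algebra_simps)
  moreover have "(\<lambda>u. (z t)\<^sup>2 * (\<Sum>j=1..p. a j u * arch_level p (stat_coeff p a u) z n (t - int j)))
      = (\<lambda>u. arch_level p (stat_coeff p a u) z (Suc n) t)"
    by (auto simp: stat_coeff_def intro!: sum.cong)
  ultimately show ?case by simp
qed

lemma jet_arch_series:
  assumes a: "\<And>j. j \<le> p \<Longrightarrow> jet S (a j) (q j) B" and "0 \<le> B" "1 < lam" and q: "\<And>j. 0 \<le> q j"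
    and S: "open S" "convex S"
    and sV: "summable (\<lambda>n. arch_level p (dom_coeff lam q) z n t)"
    and \<kappa>: "\<And>n. real (Suc n) ^ 3 / lam ^ n \<le> \<kappa>"
  shows "jet S (\<lambda>u. arch_series p (stat_coeff p a u) z t) (\<kappa> * arch_series p (dom_coeff lam q) z t) B"
proof -
  let ?V = "\<lambda>n. arch_level p (dom_coeff lam q) z n t"
  have V0: "0 \<le> ?V n" for n using assms by (intro dom_level_nonneg) auto
  have "jet S (\<lambda>u. arch_level p (stat_coeff p a u) z n t) (\<kappa> * ?V n) B" for n
  proof (rule jet_mono[OF jet_rescale[OF jet_arch_level[OF a]] _ order_refl])
    have "?V n / lam ^ n * real (Suc n) ^ 3 = real (Suc n) ^ 3 / lam ^ n * ?V n" by simp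
    also have "\<dots> \<le> \<kappa> * ?V n" by (rule mult_right_mono[OF \<kappa> V0])
    finally show "?V n / lam ^ n * real (Suc n) ^ 3 \<le> \<kappa> * ?V n" .
  qed (use V0 assms in auto)
  then have "jet S (\<lambda>u. \<Sum>n. arch_level p (stat_coeff p a u) z n t) (\<Sum>n. \<kappa> * ?V n) B"
    by (rule jet_suminf[OF S]) (rule summable_mult[OF sV])
  then show ?thesis by (simp add: arch_series_def suminf_mult[OF sV])
qed

section \<open>Dependence of a level on a finite stretch of the noise\<close>

lemma arch_level_measurable:
  assumes "{t - int (n * p)..t} \<subseteq> A"
  shows "(\<lambda>z. arch_level p c z n t) \<in> borel_measurable (Pi\<^sub>M A (\<lambda>_. borel))"
  using assms
proof (induction n arbitrary: t)
  case 0
  then have [measurable]: "(\<lambda>z. z t) \<in> borel_measurable (Pi\<^sub>M A (\<lambda>_. borel))"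
    by (intro measurable_component_singleton) auto
  show ?case by simp
next
  case (Suc n)
  have "t \<in> {t - int (Suc n * p)..t}" unfolding atLeastAtMost_iff using diff_of_nat_le by blast
  with Suc.prems have [measurable]: "(\<lambda>z. z t) \<in> borel_measurable (Pi\<^sub>M A (\<lambda>_. borel))"
    by (intro measurable_component_singleton) blast
  have [measurable]: "(\<lambda>z. arch_level p c z n (t - int j)) \<in> borel_measurable (Pi\<^sub>M A (\<lambda>_. borel))"
    if "j \<in> {1..p}" for j
  proof (rule Suc.IH)
    have "int j \<le> int p" using that by simp
    then have "{t - int j - int (n * p)..t - int j} \<subseteq> {t - int (Suc n * p)..t}"
      by (auto simp: algebra_simps)
    with Suc.prems show "{t - int j - int (n * p)..t - int j} \<subseteq> A" by blast
  qed
  show ?case by simp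
qed

lemma arch_level_cong:
  assumes "\<And>s. t - int (n * p) \<le> s \<Longrightarrow> s \<le> t \<Longrightarrow> z s = z' s"
  shows "arch_level p c z n t = arch_level p c z' n t"
  using assms
proof (induction n arbitrary: t)
  case (Suc n)
  have "arch_level p c z n (t - int j) = arch_level p c z' n (t - int j)" if "j \<in> {1..p}" for j
  proof (rule Suc.IH)
    fix s assume s: "t - int j - int (n * p) \<le> s" "s \<le> t - int j"
    have "int j \<le> int p" using that by simp
    with s show "z s = z' s" by (intro Suc.prems) (auto simp: algebra_simps)
  qed
  moreover have "z t = z' t" by (rule Suc.prems[OF diff_of_nat_le order_refl])
  ultimately show ?case by simp
qed simp

section \<open>The score function\<close>

definition score_w :: "nat \<Rightarrow> (nat \<Rightarrow> real) \<Rightarrow> (nat \<Rightarrow> real) \<Rightarrow> real" where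
  "score_w p \<alpha> y = \<alpha> 0 + (\<Sum>j=1..p. \<alpha> j * y j)"

text \<open>The derivative of \<open>arch_l\<close> with respect to coordinate i of the parameter,
  as a function of the squares y j at lag j. The two reciprocal factors are kept apart so that the
  bounds for quotients and jets apply factor by factor.\<close>

definition score :: "nat \<Rightarrow> (nat \<Rightarrow> real) \<Rightarrow> nat \<Rightarrow> (nat \<Rightarrow> real) \<Rightarrow> real" where
  "score p \<alpha> i y =
     1 / 2 * ((if i = 0 then 1 else y i) * (1 / score_w p \<alpha> y) * (1 - y 0 * (1 / score_w p \<alpha> y)))"

lemma half_le: "0 \<le> x \<Longrightarrow> 1 / 2 * x \<le> x" for x :: real
  by simp

lemma abs_half_le: "s = 1 / 2 * x \<Longrightarrow> \<bar>s\<bar> \<le> \<bar>x\<bar>" for s x :: real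
  by (simp add: abs_mult)

section \<open>Size, continuity and smoothness of the score\<close>

context
  fixes p :: nat and \<alpha> :: "nat \<Rightarrow> real" and r :: real
  assumes r: "0 < r" and \<alpha>: "\<And>j. j \<le> p \<Longrightarrow> r \<le> \<alpha> j"
begin

lemma score_w_ge:
  assumes "\<And>j. j \<in> {1..p} \<Longrightarrow> 0 \<le> y j"
  shows "r \<le> score_w p \<alpha> y"
proof -
  have "0 \<le> \<alpha> j * y j" if "j \<in> {1..p}" for j
    using assms[OF that] \<alpha>[of j] r that by (intro mult_nonneg_nonneg) auto
  then have "0 \<le> (\<Sum>j=1..p. \<alpha> j * y j)" by (rule sum_nonneg)
  with \<alpha>[of 0] show ?thesis by (simp add: score_w_def)
qed

text \<open>The lagged square in the numerator of the score also occurs in w, so their quotient is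
  at most 1 / r however large the square is. Only the current square divided by w is
  unbounded.\<close>

lemma score_w_ge_component:
  assumes "\<And>j. j \<in> {1..p} \<Longrightarrow> 0 \<le> y j" "i \<le> p"
  shows "r * (if i = 0 then 1 else y i) \<le> score_w p \<alpha> y"
proof (cases "i = 0")
  case True
  then show ?thesis using score_w_ge[OF assms(1)] by simp
next
  case False
  have "\<alpha> i * y i \<le> (\<Sum>j=1..p. \<alpha> j * y j)"
  proof (rule member_le_sum)
    show "0 \<le> \<alpha> j * y j" if "j \<in> {1..p} - {i}" for j
      using assms(1)[of j] \<alpha>[of j] r that by (intro mult_nonneg_nonneg) auto
  qed (use False assms in auto)
  moreover have "r * y i \<le> \<alpha> i * y i" using assms(1)[of i] \<alpha>[of i] assms(2) False by (intro mult_right_mono) auto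
  ultimately show ?thesis using False \<alpha>[of 0] r by (simp add: score_w_def)
qed

lemma score_w_diff_le:
  assumes "\<And>j. j \<in> {1..p} \<Longrightarrow> \<bar>y j - y' j\<bar> \<le> d"
  shows "\<bar>score_w p \<alpha> y - score_w p \<alpha> y'\<bar> \<le> (\<Sum>j=1..p. \<alpha> j) * d"
proof -
  have "\<bar>score_w p \<alpha> y - score_w p \<alpha> y'\<bar> = \<bar>\<Sum>j=1..p. \<alpha> j * (y j - y' j)\<bar>"
    by (simp add: score_w_def sum_subtractf right_diff_distrib)
  also have "\<dots> \<le> (\<Sum>j=1..p. \<bar>\<alpha> j * (y j - y' j)\<bar>)" by (rule sum_abs)
  also have "\<dots> \<le> (\<Sum>j=1..p. \<alpha> j * d)"
  proof (rule sum_mono)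
    fix j assume j: "j \<in> {1..p}"
    then have "0 \<le> \<alpha> j" using \<alpha>[of j] r by simp
    then show "\<bar>\<alpha> j * (y j - y' j)\<bar> \<le> \<alpha> j * d"
      unfolding abs_mult using assms[OF j] by (intro mult_mono) auto
  qed
  finally show ?thesis by (simp add: sum_distrib_right)
qed

text \<open>The difference equals ((v - v') + (v' / w') * (w' - w)) / w. In this form v' enters only
  through its ratio to w', which may be bounded even when v' is not.\<close>

lemma quotient_diff_le:
  assumes w: "r \<le> w" "r \<le> w'" and v: "0 \<le> v'" "\<bar>v - v'\<bar> \<le> d" and e: "\<bar>w - w'\<bar> \<le> e"
    and k: "v' * (1 / w') \<le> k"
  shows "\<bar>v * (1 / w) - v' * (1 / w')\<bar> \<le> (d + k * e) / r"
proof -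
  have pos: "0 < w" "0 < w'" using w r by auto
  have "v * (1 / w) - v' * (1 / w') = ((v - v') + v' * (1 / w') * (w' - w)) / w"
    using pos by (simp add: field_simps)
  then have "\<bar>v * (1 / w) - v' * (1 / w')\<bar> = \<bar>(v - v') + v' * (1 / w') * (w' - w)\<bar> / w"
    using pos by simp
  also have "\<bar>(v - v') + v' * (1 / w') * (w' - w)\<bar> \<le> \<bar>v - v'\<bar> + \<bar>v' * (1 / w') * (w' - w)\<bar>"
    by (rule abs_triangle_ineq)
  also have "\<bar>v' * (1 / w') * (w' - w)\<bar> = v' * (1 / w') * \<bar>w - w'\<bar>"
    using v pos by (simp add: abs_mult abs_minus_commute)
  also have "\<dots> \<le> k * e"
    using v(1) pos k e by (intro mult_mono) (auto intro: order_trans[OF _ k])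
  finally have "\<bar>v * (1 / w) - v' * (1 / w')\<bar> \<le> (\<bar>v - v'\<bar> + k * e) / w"
    using pos by (simp add: divide_right_mono)
  also have "\<dots> \<le> (d + k * e) / w" using v pos by (intro divide_right_mono) auto
  also have "\<dots> \<le> (d + k * e) / r"
  proof (rule divide_left_mono)
    have "0 \<le> d" "0 \<le> e" "0 \<le> k" using v e k pos by (auto intro: order_trans[OF _ k] order_trans[OF abs_ge_zero])
    then show "0 \<le> d + k * e" by simp
  qed (use w r pos in auto)
  finally show ?thesis .
qed

lemma score_parts_le:
  assumes y: "\<And>j. j \<le> p \<Longrightarrow> 0 \<le> y j \<and> y j \<le> G" and i: "i \<le> p"
  shows "0 \<le> (if i = 0 then 1 else y i) * (1 / score_w p \<alpha> y)"
    "(if i = 0 then 1 else y i) * (1 / score_w p \<alpha> y) \<le> 1 / r"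
    "0 \<le> y 0 * (1 / score_w p \<alpha> y)" "y 0 * (1 / score_w p \<alpha> y) \<le> G / r"
proof -
  have w: "r \<le> score_w p \<alpha> y" using y by (intro score_w_ge) auto
  have w': "r * (if i = 0 then 1 else y i) \<le> score_w p \<alpha> y" using y i by (intro score_w_ge_component) auto
  show "0 \<le> (if i = 0 then 1 else y i) * (1 / score_w p \<alpha> y)"
    using y[OF i] w r by (intro mult_nonneg_nonneg) auto
  show "(if i = 0 then 1 else y i) * (1 / score_w p \<alpha> y) \<le> 1 / r"
    using w w' r by (simp add: field_simps split: if_splits)
  show "0 \<le> y 0 * (1 / score_w p \<alpha> y)" using y[of 0] w r by (intro mult_nonneg_nonneg) auto
  have "y 0 * (1 / score_w p \<alpha> y) \<le> G * (1 / r)"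
    using y[of 0] w r by (intro mult_mono) (auto simp: frac_le)
  then show "y 0 * (1 / score_w p \<alpha> y) \<le> G / r" by simp
qed

lemma score_bounded:
  assumes y: "\<And>j. j \<le> p \<Longrightarrow> 0 \<le> y j \<and> y j \<le> G" and i: "i \<le> p" and G: "1 \<le> G"
  shows "\<bar>score p \<alpha> i y\<bar> \<le> (1 / r * (1 + 1 / r)) * G"
proof -
  let ?v = "(if i = 0 then 1 else y i) * (1 / score_w p \<alpha> y)" and ?c = "y 0 * (1 / score_w p \<alpha> y)"
  note b = score_parts_le[of y G i, OF y i]
  have "\<bar>1 - ?c\<bar> \<le> 1 + G / r" using b(3,4) by linarith
  also have "\<dots> \<le> (1 + 1 / r) * G" using G by (simp add: distrib_right)
  finally have "\<bar>?v * (1 - ?c)\<bar> \<le> 1 / r * ((1 + 1 / r) * G)"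
    unfolding abs_mult using b(1,2) r by (intro mult_mono) auto
  moreover have "score p \<alpha> i y = 1 / 2 * (?v * (1 - ?c))" by (simp add: score_def)
  then have "\<bar>score p \<alpha> i y\<bar> \<le> \<bar>?v * (1 - ?c)\<bar>" by (rule abs_half_le)
  ultimately show ?thesis by (simp add: mult.assoc)
qed

text \<open>One factor G is the scale of the perturbation \<eta> * G, the other comes from the
  current square divided by w. Keeping \<eta> apart from G lets a deterministic rate pass through to
  expectations.\<close>

lemma score_lipschitz:
  obtains K where "0 \<le> K"
    "\<And>y y' i \<eta> G. \<lbrakk>\<And>j. j \<le> p \<Longrightarrow> 0 \<le> y j \<and> y j \<le> G; \<And>j. j \<le> p \<Longrightarrow> 0 \<le> y' j \<and> y' j \<le> G;
       \<And>j. j \<le> p \<Longrightarrow> \<bar>y j - y' j\<bar> \<le> \<eta> * G; i \<le> p; 1 \<le> G; 0 \<le> \<eta>\<rbrakk>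
     \<Longrightarrow> \<bar>score p \<alpha> i y - score p \<alpha> i y'\<bar> \<le> K * \<eta> * G\<^sup>2"
proof -
  define A where "A = (\<Sum>j=1..p. \<alpha> j)"
  have A: "0 \<le> A" unfolding A_def 
    by (intro sum_nonneg order_trans[OF less_imp_le[OF r] \<alpha>]) simp
  \<comment> \<open>The value that \<open>quotient_diff_le\<close> gives, up to the factor \<eta> *
    G, when the numerators move by \<eta> * G, the denominators by A * \<eta> * G and the ratio is
    at most 1 / r.\<close>
  define k where "k = (1 + A / r) / r"
  have k: "0 \<le> k" using A r by (simp add: k_def)
  define K where "K = k * (1 + 1 / r) + 1 / r * k"
  show thesis
  proof (rule that[of K])
    show "0 \<le> K" using k r by (simp add: K_def)
  next
    fix y y' :: "nat \<Rightarrow> real" and i :: nat and \<eta> G :: real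
    assume y: "\<And>j. j \<le> p \<Longrightarrow> 0 \<le> y j \<and> y j \<le> G" and y': "\<And>j. j \<le> p \<Longrightarrow> 0 \<le> y' j \<and> y' j \<le> G"
      and d: "\<And>j. j \<le> p \<Longrightarrow> \<bar>y j - y' j\<bar> \<le> \<eta> * G" and i: "i \<le> p" and G: "1 \<le> G" and \<eta>: "0 \<le> \<eta>"
    let ?w = "score_w p \<alpha> y" and ?w' = "score_w p \<alpha> y'"
    let ?v = "(if i = 0 then 1 else y i) * (1 / ?w)" and ?c = "y 0 * (1 / ?w)"
    let ?v' = "(if i = 0 then 1 else y' i) * (1 / ?w')" and ?c' = "y' 0 * (1 / ?w')"
    note b = score_parts_le[of y G i, OF y i] and b' = score_parts_le[of y' G i, OF y' i]
    have w: "r \<le> ?w" "r \<le> ?w'" using y y' by (auto intro!: score_w_ge)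
    have e: "\<bar>?w - ?w'\<bar> \<le> A * (\<eta> * G)" unfolding A_def using d by (intro score_w_diff_le) auto
    have "\<bar>?v - ?v'\<bar> \<le> (\<eta> * G + 1 / r * (A * (\<eta> * G))) / r"
      by (rule quotient_diff_le[OF w _ _ e b'(2)]) (use d[OF i] y'[OF i] \<eta> G in auto)
    also have "\<dots> = k * (\<eta> * G)" using r by (simp add: k_def field_simps)
    finally have dv: "\<bar>?v - ?v'\<bar> \<le> k * (\<eta> * G)" .
    have "\<bar>?c - ?c'\<bar> \<le> (\<eta> * G + G / r * (A * (\<eta> * G))) / r"
      by (rule quotient_diff_le[OF w _ _ e b'(4)]) (use d[of 0] y'[of 0] in auto)
    also have "\<dots> \<le> (\<eta> * G * G + G / r * (A * (\<eta> * G))) / r"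
      using r mult_left_mono[OF G, of "\<eta> * G"] \<eta> G by (intro divide_right_mono add_right_mono) auto
    also have "\<dots> = k * (\<eta> * G\<^sup>2)" using r by (simp add: k_def field_simps power2_eq_square)
    finally have dc: "\<bar>?c - ?c'\<bar> \<le> k * (\<eta> * G\<^sup>2)" .
    have "\<bar>1 - ?c\<bar> \<le> 1 + G / r" using b(3,4) by linarith
    also have "\<dots> \<le> (1 + 1 / r) * G" using G by (simp add: distrib_right)
    finally have c1: "\<bar>1 - ?c\<bar> \<le> (1 + 1 / r) * G" .
    have "?v * (1 - ?c) - ?v' * (1 - ?c') = (?v - ?v') * (1 - ?c) + ?v' * (?c' - ?c)" by algebra
    then have "\<bar>?v * (1 - ?c) - ?v' * (1 - ?c')\<bar> \<le> \<bar>(?v - ?v') * (1 - ?c)\<bar> + \<bar>?v' * (?c' - ?c)\<bar>"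
      by (simp only: abs_triangle_ineq)
    also have "\<dots> = \<bar>?v - ?v'\<bar> * \<bar>1 - ?c\<bar> + \<bar>?v'\<bar> * \<bar>?c - ?c'\<bar>"
      by (simp only: abs_mult abs_minus_commute[of ?c'])
    also have "\<dots> \<le> k * (\<eta> * G) * ((1 + 1 / r) * G) + 1 / r * (k * (\<eta> * G\<^sup>2))"
      using dv dc c1 b'(1,2) k \<eta> G r by (intro add_mono mult_mono) auto
    also have "\<dots> = K * \<eta> * G\<^sup>2" unfolding K_def by algebra
    finally have main: "\<bar>?v * (1 - ?c) - ?v' * (1 - ?c')\<bar> \<le> K * \<eta> * G\<^sup>2" .
    have "score p \<alpha> i y - score p \<alpha> i y' = 1 / 2 * (?v * (1 - ?c) - ?v' * (1 - ?c'))"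
      unfolding score_def by algebra
    then have "\<bar>score p \<alpha> i y - score p \<alpha> i y'\<bar> \<le> \<bar>?v * (1 - ?c) - ?v' * (1 - ?c')\<bar>"
      by (rule abs_half_le)
    with main show "\<bar>score p \<alpha> i y - score p \<alpha> i y'\<bar> \<le> K * \<eta> * G\<^sup>2" by (rule order_trans[rotated])
  qed
qed

text \<open>The amplitude of the product is of order G ^ 2, and its rate is of order G because the
  reciprocal of w has a rate linear in the size of w. \<open>jet_rescale\<close> turns that rate
  into G ^ 3, whence the exponent 5.\<close>

lemma jet_score:
  assumes "0 \<le> \<kappa>" "0 \<le> B"
  obtains K where "0 \<le> K"
    "\<And>S y i G. \<lbrakk>\<And>j. j \<le> p \<Longrightarrow> jet S (y j) (\<kappa> * G) B; \<And>j u. j \<le> p \<Longrightarrow> u \<in> S \<Longrightarrow> 0 \<le> y j u;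
       i \<le> p; 1 \<le> G\<rbrakk> \<Longrightarrow> jet S (\<lambda>u. score p \<alpha> i (\<lambda>j. y j u)) (K * G ^ 5) 1"
proof -
  define A where "A = \<alpha> 0 + (\<Sum>j=1..p. \<alpha> j * \<kappa>)"
  have \<alpha>0: "0 \<le> \<alpha> j" if "j \<le> p" for j using \<alpha>[OF that] r by simp
  have A: "0 \<le> A" unfolding A_def using \<alpha>0 assms by (intro add_nonneg_nonneg sum_nonneg) auto
  define B' where "B' = 3 * B * (A / r + 1) + B + 1"
  have B': "1 \<le> B'" "B \<le> B'" using A assms r by (auto simp: B'_def)
  define k where "k = \<kappa> + 1"
  have k: "1 \<le> k" using assms by (simp add: k_def)
  define K where "K = k / r * (1 + k / r) * (4 * B') ^ 3"
  show thesis
  proof (rule that[of K])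
    show "0 \<le> K" using k r B' by (simp add: K_def)
  next
    fix S and y :: "nat \<Rightarrow> real \<Rightarrow> real" and i :: nat and G :: real
    assume y: "\<And>j. j \<le> p \<Longrightarrow> jet S (y j) (\<kappa> * G) B" and y0: "\<And>j u. j \<le> p \<Longrightarrow> u \<in> S \<Longrightarrow> 0 \<le> y j u"
      and i: "i \<le> p" and G: "1 \<le> G"
    let ?w = "\<lambda>u. score_w p \<alpha> (\<lambda>j. y j u)"
    have "jet S ?w (\<alpha> 0 + (\<Sum>j=1..p. \<alpha> j * (\<kappa> * G))) B"
      unfolding score_w_def using assms \<alpha>0 by (intro jet_add jet_sum jet_const jet_cmult y) auto
    then have "jet S ?w (A * G) B"
    proof (rule jet_mono)
      have "\<alpha> 0 * 1 \<le> \<alpha> 0 * G" using G \<alpha>0[of 0] by (intro mult_left_mono) auto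
      then show "\<alpha> 0 + (\<Sum>j=1..p. \<alpha> j * (\<kappa> * G)) \<le> A * G"
        by (simp add: A_def distrib_right sum_distrib_right mult.assoc)
      show "0 \<le> \<alpha> 0 + (\<Sum>j=1..p. \<alpha> j * (\<kappa> * G))"
        using \<alpha>0 assms G by (intro add_nonneg_nonneg sum_nonneg) auto
    qed (use assms in auto)
    then have "jet S (\<lambda>u. 1 / ?w u) (1 / r) (3 * B * (A * G / r + 1))"
      using assms r A G y0 by (intro jet_inverse score_w_ge) auto
    then have w: "jet S (\<lambda>u. 1 / ?w u) (1 / r) (B' * G)"
    proof (rule jet_mono)
      have "A * G / r + 1 \<le> (A / r + 1) * G" using G by (simp add: distrib_right)
      then have "3 * B * (A * G / r + 1) \<le> 3 * B * ((A / r + 1) * G)"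
        using assms by (intro mult_left_mono) auto
      also have "\<dots> = (3 * B * (A / r + 1)) * G" by simp
      also have "\<dots> \<le> B' * G" using G assms by (intro mult_right_mono) (auto simp: B'_def)
      finally show "3 * B * (A * G / r + 1) \<le> B' * G" .
    qed (use assms A r G in auto)
    have BG: "B \<le> B' * G" using mult_mono[of B B' 1 G] B' assms G by simp
    have yj: "jet S (y j) (k * G) (B' * G)" if "j \<le> p" for j
      by (rule jet_mono[OF y[OF that]]) (use BG assms G in \<open>auto simp: k_def\<close>)
    have "1 \<le> k * G" using mult_mono[of 1 k 1 G] k G by simp
    then have v: "jet S (\<lambda>u. if i = 0 then 1 else y i u) (k * G) (B' * G)"
      using B' G yj[OF i] by (cases "i = 0") (auto intro!: jet_const)
    have vw: "jet S (\<lambda>u. (if i = 0 then 1 else y i u) * (1 / ?w u)) (k / r * G) (2 * B' * G)"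
      using jet_mult[OF v w] by (simp add: mult_ac)
    have "jet S (\<lambda>u. (-1) * (y 0 u * (1 / ?w u))) (1 * (k / r * G)) (2 * B' * G)"
      using jet_cmult[OF jet_mult[OF yj[of 0] w], of "-1" 1] by (simp add: mult_ac)
    then have "jet S (\<lambda>u. 1 + (-1) * (y 0 u * (1 / ?w u))) (1 + 1 * (k / r * G)) (2 * B' * G)"
      using B' G by (intro jet_add jet_const) auto
    then have "jet S (\<lambda>u. 1 - y 0 u * (1 / ?w u)) (1 + k / r * G) (2 * B' * G)" by simp
    then have c: "jet S (\<lambda>u. 1 - y 0 u * (1 / ?w u)) ((1 + k / r) * G) (2 * B' * G)"
      by (rule jet_mono) (use B' G k r in \<open>auto simp: distrib_right\<close>)
    have "jet S (\<lambda>u. score p \<alpha> i (\<lambda>j. y j u)) (1 / 2 * (k / r * G * ((1 + k / r) * G))) (4 * B' * G)"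
      unfolding score_def using jet_cmult[OF jet_mult[OF vw c], of "1 / 2" "1 / 2"] by (simp add: mult.assoc)
    then have "jet S (\<lambda>u. score p \<alpha> i (\<lambda>j. y j u)) (k / r * (1 + k / r) * G\<^sup>2) (1 * (4 * B' * G))"
    proof (rule jet_mono)
      have X: "0 \<le> k / r * G * ((1 + k / r) * G)" using k r G by simp
      then show "0 \<le> 1 / 2 * (k / r * G * ((1 + k / r) * G))" by (simp only: zero_le_mult_iff) simp
      have "1 / 2 * (k / r * G * ((1 + k / r) * G)) \<le> k / r * G * ((1 + k / r) * G)"
        by (rule half_le[OF X])
      also have "\<dots> = k / r * (1 + k / r) * G\<^sup>2" by (simp add: power2_eq_square)
      finally show "1 / 2 * (k / r * G * ((1 + k / r) * G)) \<le> k / r * (1 + k / r) * G\<^sup>2" .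
    qed (use G B' in auto)
    then have "jet S (\<lambda>u. score p \<alpha> i (\<lambda>j. y j u)) (k / r * (1 + k / r) * G\<^sup>2 * (4 * B' * G) ^ 3) 1"
    proof (rule jet_rescale)
      show "1 \<le> 4 * B' * G" using mult_mono[of 1 "4 * B'" 1 G] B' G by simp
    qed (use k r in auto)
    also have "k / r * (1 + k / r) * G\<^sup>2 * (4 * B' * G) ^ 3 = K * G ^ 5"
      unfolding K_def power_mult_distrib by (simp add: mult_ac flip: power_add)
    finally show "jet S (\<lambda>u. score p \<alpha> i (\<lambda>j. y j u)) (K * G ^ 5) 1" .
  qed
qed

end

section \<open>Derivatives of the likelihood\<close>

definition lag_squares :: "(int \<Rightarrow> real) \<Rightarrow> int \<Rightarrow> nat \<Rightarrow> real" where
  "lag_squares x k j = (x (k - int j))\<^sup>2"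

lemma arch_l_eq:
  "arch_l p x k \<alpha> = 1 / 2 * (ln (score_w p \<alpha> (lag_squares x k))
     + lag_squares x k 0 / score_w p \<alpha> (lag_squares x k))"
  by (simp add: arch_l_def arch_w_def score_w_def lag_squares_def)

lemma score_w_upd:
  assumes "i \<le> p"
  shows "score_w p (\<alpha>(i := s)) y = score_w p \<alpha> y + (s - \<alpha> i) * (if i = 0 then 1 else y i)"
proof (cases "i = 0")
  case True
  then show ?thesis by (simp add: score_w_def)
next
  case False
  have "(\<Sum>j=1..p. (\<alpha>(i := s)) j * y j) = (\<Sum>j=1..p. \<alpha> j * y j + (if j = i then (s - \<alpha> i) * y i else 0))"
    by (intro sum.cong) (auto simp: algebra_simps)
  also have "\<dots> = (\<Sum>j=1..p. \<alpha> j * y j) + (s - \<alpha> i) * y i"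
    using False assms by (simp add: sum.distrib)
  finally show ?thesis using False by (simp add: score_w_def)
qed

lemma score_w_upd_ge:
  assumes "0 < r" "\<And>j. j \<le> p \<Longrightarrow> r \<le> \<alpha> j" "\<And>j. j \<in> {1..p} \<Longrightarrow> 0 \<le> y j" "r \<le> s"
  shows "r \<le> score_w p (\<alpha>(i := s)) y" "i \<le> p \<Longrightarrow> r * (if i = 0 then 1 else y i) \<le> score_w p (\<alpha>(i := s)) y"
proof -
  have *: "r \<le> (\<alpha>(i := s)) j" if "j \<le> p" for j using assms that by simp
  show "r \<le> score_w p (\<alpha>(i := s)) y" by (rule score_w_ge[OF assms(1) * assms(3)])
  show "r * (if i = 0 then 1 else y i) \<le> score_w p (\<alpha>(i := s)) y" if "i \<le> p"
    by (rule score_w_ge_component[OF assms(1) * assms(3) that])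
qed

lemma arch_l_has_partial_deriv:
  assumes r: "0 < r" and \<alpha>: "\<And>j. j \<le> p \<Longrightarrow> r \<le> \<alpha> j" and i: "i \<le> p"
  shows "((\<lambda>s. arch_l p x k (\<alpha>(i := s))) has_real_derivative score p \<alpha> i (lag_squares x k)) (at (\<alpha> i))"
proof -
  let ?y = "lag_squares x k"
  have w: "0 < score_w p \<alpha> ?y"
    using score_w_ge[where p = p and \<alpha> = \<alpha> and r = r and y = ?y, OF r \<alpha>] r by (auto simp: lag_squares_def)
  show ?thesis
    unfolding arch_l_eq score_w_upd[OF i] score_def using w
    by (auto intro!: derivative_eq_intros simp: field_simps power2_eq_square)
qed

text \<open>The remainder bound is uniform in the path, so the likelihood can be differentiated under
  the expectation.\<close>

lemma arch_l_partial_quadratic: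
  assumes r: "0 < r" and \<alpha>: "\<And>j. j \<le> p \<Longrightarrow> 2 * r \<le> \<alpha> j" and i: "i \<le> p" and s: "r < s"
  shows "\<bar>arch_l p x k (\<alpha>(i := s)) - arch_l p x k \<alpha> - score p \<alpha> i (lag_squares x k) * (s - \<alpha> i)\<bar>
    \<le> 1 / r\<^sup>2 * (1 + lag_squares x k 0 / r) * (s - \<alpha> i)\<^sup>2"
proof -
  define y where "y = lag_squares x k"
  have y: "0 \<le> y j" for j by (simp add: y_def lag_squares_def)
  define v where "v = (if i = 0 then 1 else y i)"
  define w where "w s = score_w p \<alpha> y + (s - \<alpha> i) * v" for s
  \<comment> \<open>The half-line contains \<alpha> i because of the margin 2 * r, and w stays at
    least r on it.\<close>
  define S where "S = {r<..}"
  define f0 where "f0 s = 1 / 2 * (ln (w s) + y 0 / w s)" for s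
  define f1 where "f1 s = 1 / 2 * (v / w s - y 0 * v / (w s)\<^sup>2)" for s
  define f2 where "f2 s = 1 / 2 * (- (v / w s)\<^sup>2 + 2 * (y 0 / w s) * (v / w s)\<^sup>2)" for s
  have r\<alpha>: "r \<le> \<alpha> j" if "j \<le> p" for j using \<alpha>[OF that] r by simp
  have w_eq: "w s = score_w p (\<alpha>(i := s)) y" for s by (simp add: w_def v_def score_w_upd[OF i])
  have wr: "r \<le> w s" "r * v \<le> w s" if "s \<in> S" for s
    using score_w_upd_ge[where p = p and \<alpha> = \<alpha> and r = r and y = y and s = s and i = i, OF r r\<alpha>] y that i unfolding w_eq v_def S_def by auto
  have dw: "(w has_real_derivative v) (at s)" for s
    unfolding w_def by (auto intro!: derivative_eq_intros)
  have d0: "(f0 has_real_derivative f1 s) (at s)" if "s \<in> S" for s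
    unfolding f0_def f1_def using wr[OF that] r
    by (auto intro!: derivative_eq_intros dw simp: field_simps power2_eq_square)
  have d1: "(f1 has_real_derivative f2 s) (at s)" if "s \<in> S" for s
    unfolding f1_def f2_def using wr[OF that] r
    by (auto intro!: derivative_eq_intros dw simp: field_simps power2_eq_square)
  have v0: "0 \<le> v" using y by (simp add: v_def)
  have bound: "\<bar>f2 s\<bar> \<le> 1 / r\<^sup>2 * (1 + y 0 / r)" if "s \<in> S" for s
  proof -
    have wp: "0 < w s" using wr[OF that] r by simp
    \<comment> \<open>The unbounded slope v cancels here: w is at least r * v, whichever coordinate
      is varied.\<close>
    have "v / w s \<le> 1 / r" using wr(2)[OF that] wp r by (simp add: field_simps)
    then have vw: "(v / w s)\<^sup>2 \<le> (1 / r)\<^sup>2" using v0 wp by (intro power_mono) auto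
    have yw: "y 0 / w s \<le> y 0 / r" using wr(1)[OF that] y[of 0] r wp by (intro divide_left_mono) auto
    have a: "0 \<le> (y 0 / w s) * (v / w s)\<^sup>2" using y wp by simp
    have b: "(y 0 / w s) * (v / w s)\<^sup>2 \<le> (y 0 / r) * (1 / r)\<^sup>2"
      using vw yw y[of 0] r by (intro mult_mono) auto
    have "\<bar>f2 s\<bar> \<le> 1 / 2 * (v / w s)\<^sup>2 + (y 0 / w s) * (v / w s)\<^sup>2"
    proof -
      have "f2 s = - (1 / 2 * (v / w s)\<^sup>2) + (y 0 / w s) * (v / w s)\<^sup>2"
        unfolding f2_def by algebra
      moreover have "\<bar>- (1 / 2 * a) + b\<bar> \<le> 1 / 2 * a + b" if "0 \<le> a" "0 \<le> b" for a b :: real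
        using that by linarith
      ultimately show ?thesis using a zero_le_power2[of "v / w s"] by (simp only:)
    qed
    also have "\<dots> \<le> (1 / r)\<^sup>2 + (y 0 / r) * (1 / r)\<^sup>2" 
      by (intro add_mono b order_trans[OF half_le vw]) simp
    also have "\<dots> = 1 / r\<^sup>2 * (1 + y 0 / r)" by (simp add: power_divide add_divide_distrib mult.commute)
    finally show ?thesis .
  qed
  define f where "f n = (if n = 0 then f0 else if n = 1 then f1 else f2)" for n :: nat
  have "norm (f 0 s - (\<Sum>n\<le>1. f n (\<alpha> i) * (s - \<alpha> i) ^ n / fact n))
      \<le> 1 / r\<^sup>2 * (1 + y 0 / r) * norm (s - \<alpha> i) ^ Suc 1 / fact 1"
  proof (rule field_Taylor[where S = S])
    show "\<alpha> i \<in> S" using \<alpha>[OF i] r by (simp add: S_def)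
    show "s \<in> S" using s by (simp add: S_def)
    show "convex S" by (simp add: S_def)
  qed (use d0 d1 bound in \<open>auto intro: has_field_derivative_at_within simp: f_def le_Suc_eq\<close>)
  then have "\<bar>f0 s - f0 (\<alpha> i) - f1 (\<alpha> i) * (s - \<alpha> i)\<bar> \<le> 1 / r\<^sup>2 * (1 + y 0 / r) * (s - \<alpha> i)\<^sup>2"
    by (simp add: f_def diff_diff_eq power2_eq_square)
  moreover have "f0 s = arch_l p x k (\<alpha>(i := s))" for s
    by (simp add: f0_def arch_l_eq w_eq y_def)
  moreover have "f1 (\<alpha> i) = score p \<alpha> i y"
  proof -
    have "w (\<alpha> i) \<noteq> 0" using wr(1)[of "\<alpha> i"] \<alpha>[OF i] r by (auto simp: S_def)
    then have "f1 (\<alpha> i) = 1 / 2 * (v * (1 / w (\<alpha> i)) * (1 - y 0 * (1 / w (\<alpha> i))))"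
      unfolding f1_def by (simp add: field_simps power2_eq_square)
    then show ?thesis by (simp add: score_def w_def v_def)
  qed
  ultimately show ?thesis by (simp add: y_def)
qed

text \<open>The logarithm of w lies between ln r and w, and w grows at most linearly in the
  squares.\<close>

lemma arch_l_abs_le:
  assumes r: "0 < r" and \<alpha>: "\<And>j. j \<le> p \<Longrightarrow> r \<le> \<alpha> j"
    and y: "\<And>j. j \<le> p \<Longrightarrow> lag_squares x k j \<le> G" and G: "1 \<le> G"
  shows "\<bar>arch_l p x k \<alpha>\<bar> \<le> (\<bar>ln r\<bar> + (\<Sum>j\<le>p. \<alpha> j) + 1 / r) * G"
proof -
  let ?y = "lag_squares x k" let ?w = "score_w p \<alpha> ?y"
  have y0: "0 \<le> ?y j" for j by (simp add: lag_squares_def)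
  have w: "r \<le> ?w" using score_w_ge[OF r \<alpha>] y0 by simp
  have \<alpha>0: "0 \<le> \<alpha> j" if "j \<le> p" for j using \<alpha>[OF that] r by simp
  have "?w \<le> \<alpha> 0 * G + (\<Sum>j=1..p. \<alpha> j * G)"
    unfolding score_w_def using \<alpha>0 y G mult_left_mono[OF G \<alpha>0[of 0]]
    by (intro add_mono sum_mono mult_left_mono) auto
  also have "\<dots> = (\<Sum>j\<le>p. \<alpha> j) * G"
    by (simp add: atMost_atLeast0 sum.atLeast_Suc_atMost sum_distrib_right distrib_right)
  finally have w': "?w \<le> (\<Sum>j\<le>p. \<alpha> j) * G" .
  have "ln ?w \<le> ?w" "ln r \<le> ln ?w" using w r ln_le_minus_one[of ?w] by auto
  then have "\<bar>ln ?w\<bar> \<le> \<bar>ln r\<bar> + ?w" using w r by linarith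
  also have "\<dots> \<le> \<bar>ln r\<bar> * G + (\<Sum>j\<le>p. \<alpha> j) * G"
    using w' mult_left_mono[OF G, of "\<bar>ln r\<bar>"] by simp
  finally have l: "\<bar>ln ?w\<bar> \<le> \<bar>ln r\<bar> * G + (\<Sum>j\<le>p. \<alpha> j) * G" .
  have "?y 0 / ?w \<le> G / r" using y[of 0] y0[of 0] w r by (intro frac_le) auto
  moreover have "0 \<le> ?y 0 / ?w" using y0 w r by simp
  ultimately have "\<bar>ln ?w + ?y 0 / ?w\<bar> \<le> \<bar>ln r\<bar> * G + (\<Sum>j\<le>p. \<alpha> j) * G + G / r"
    using l by linarith
  then have "\<bar>1 / 2 * (ln ?w + ?y 0 / ?w)\<bar> \<le> \<bar>ln r\<bar> * G + (\<Sum>j\<le>p. \<alpha> j) * G + G / r"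
    by (rule order_trans[OF abs_half_le[OF refl]])
  then show ?thesis unfolding arch_l_eq by (simp add: distrib_right)
qed

lemma bias_B_has_partial_deriv:
  assumes "0 < r" "\<And>j. j \<le> p \<Longrightarrow> r \<le> \<alpha> j" "i \<le> p"
  shows "((\<lambda>s. bias_B p W h N m x y (\<alpha>(i := s))) has_real_derivative
    (\<Sum>k=p+1..N. 1 / (h * real N) * W ((real m - real k) / (h * real N)) *
        (score p \<alpha> i (lag_squares x (int k)) - score p \<alpha> i (lag_squares y (int k))))) (at (\<alpha> i))"
  unfolding bias_B_def
  by (rule DERIV_sum, rule DERIV_cmult, rule DERIV_diff; rule arch_l_has_partial_deriv[OF assms])

lemma grad_bias_B_eq:
  assumes "0 < r" "\<And>j. j \<le> p \<Longrightarrow> r \<le> \<alpha> j" "i \<le> p"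
  shows "grad_bias_B p W h N m X Y \<alpha> i \<omega> =
    (\<Sum>k=p+1..N. 1 / (h * real N) * W ((real m - real k) / (h * real N)) *
        (score p \<alpha> i (lag_squares (\<lambda>s. X s \<omega>) (int k)) - score p \<alpha> i (lag_squares (\<lambda>s. Y s \<omega>) (int k))))"
  unfolding grad_bias_B_def partial_deriv_def
  by (rule DERIV_imp_deriv, rule bias_B_has_partial_deriv[OF assms])

section \<open>Moments of the dominating series\<close>

text \<open>Jensen's inequality for the n-th power, after normalising the weights.\<close>

lemma power_sum_convex:
  fixes w y :: "'i \<Rightarrow> real"
  assumes "finite I" "I \<noteq> {}" "\<And>i. i \<in> I \<Longrightarrow> 0 \<le> w i" "0 < sum w I" "even n" "0 < n"
  shows "(\<Sum>i\<in>I. w i * y i) ^ n \<le> sum w I ^ (n - 1) * (\<Sum>i\<in>I. w i * y i ^ n)"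
proof -
  let ?s = "sum w I"
  have "(\<Sum>i\<in>I. w i / ?s * y i) ^ n \<le> (\<Sum>i\<in>I. w i / ?s * y i ^ n)"
    using convex_on_sum[OF assms(1,2) convex_power_even[OF assms(5)], of "\<lambda>i. w i / ?s" y] assms
    by (simp add: sum_divide_distrib[symmetric])
  then have "(\<Sum>i\<in>I. w i * y i) ^ n / ?s ^ n \<le> (\<Sum>i\<in>I. w i * y i ^ n) / ?s"
    by (simp add: sum_divide_distrib[symmetric] power_divide)
  then have "(\<Sum>i\<in>I. w i * y i) ^ n \<le> ?s ^ n / ?s * (\<Sum>i\<in>I. w i * y i ^ n)"
    using assms(4) by (simp add: field_simps)
  also have "?s ^ n / ?s = ?s ^ (n - 1)" using assms(4,6) by (cases n) auto
  finally show ?thesis .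
qed

text \<open>The terms are nonnegative, so uniform moment bounds pass to the supremum of the partial
  sums by monotone convergence; its finiteness gives summability.\<close>

lemma AE_summable_power:
  fixes f :: "nat \<Rightarrow> 'w \<Rightarrow> real"
  assumes [measurable]: "\<And>n. f n \<in> borel_measurable M" and pos: "\<And>n \<omega>. 0 \<le> f n \<omega>"
    and int: "\<And>m. integrable M (\<lambda>\<omega>. (\<Sum>n<m. f n \<omega>) ^ r)"
    and bd: "\<And>m. (\<integral>\<omega>. (\<Sum>n<m. f n \<omega>) ^ r \<partial>M) \<le> E" and r: "0 < r"
  shows "AE \<omega> in M. summable (\<lambda>n. f n \<omega>)"
    and "integrable M (\<lambda>\<omega>. (\<Sum>n. f n \<omega>) ^ r)" "(\<integral>\<omega>. (\<Sum>n. f n \<omega>) ^ r \<partial>M) \<le> E"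
proof -
  let ?S = "\<lambda>m \<omega>. (\<Sum>n<m. f n \<omega>) ^ r"
  have S0: "0 \<le> ?S m \<omega>" for m \<omega> by (intro zero_le_power sum_nonneg pos)
  have mono: "?S m \<omega> \<le> ?S m' \<omega>" if "m \<le> m'" for m m' \<omega>
    using that pos by (intro power_mono sum_mono2 sum_nonneg) auto
  have "(\<integral>\<^sup>+\<omega>. (SUP m. ennreal (?S m \<omega>)) \<partial>M) = (SUP m. \<integral>\<^sup>+\<omega>. ennreal (?S m \<omega>) \<partial>M)"
    by (intro nn_integral_monotone_convergence_SUP) (auto simp: incseq_def le_fun_def intro!: ennreal_leI mono)
  also have "\<dots> \<le> ennreal E"
    using bd S0 by (intro SUP_least) (auto simp: nn_integral_eq_integral[OF int] intro!: ennreal_leI)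
  also have "\<dots> < \<infinity>" by simp
  finally have "AE \<omega> in M. (SUP m. ennreal (?S m \<omega>)) \<noteq> \<infinity>"
    by (intro nn_integral_PInf_AE) auto
  then show summ: "AE \<omega> in M. summable (\<lambda>n. f n \<omega>)"
  proof eventually_elim
    case (elim \<omega>)
    then obtain B where B: "(SUP m. ennreal (?S m \<omega>)) = ennreal B" "0 \<le> B"
      by (cases "SUP m. ennreal (?S m \<omega>)") auto
    have le: "?S m \<omega> \<le> B" for m
    proof -
      have "ennreal (?S m \<omega>) \<le> ennreal B" unfolding B(1)[symmetric] by (rule SUP_upper) simp
      then show ?thesis using B(2) by (simp add: ennreal_le_iff)
    qed
    \<comment> \<open>B bounds the r-th powers of the partial sums. A partial sum is either below 1
      or below its own r-th power, so B + 1 bounds it in both cases.\<close>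
    show "summable (\<lambda>n. f n \<omega>)"
    proof (rule summableI_nonneg_bounded[where x = "B + 1"])
      fix m
      show "(\<Sum>n<m. f n \<omega>) \<le> B + 1"
      proof (cases "1 \<le> (\<Sum>n<m. f n \<omega>)")
        case True
        then have "(\<Sum>n<m. f n \<omega>) \<le> ?S m \<omega>" using r by (intro self_le_power) auto
        with le[of m] show ?thesis by simp
      qed (use B in auto)
    qed (rule pos)
  qed
  have "incseq (\<lambda>m. \<integral>\<omega>. ?S m \<omega> \<partial>M)"
    unfolding incseq_def by (intro allI impI integral_mono int mono)
  then obtain x where x: "(\<lambda>m. \<integral>\<omega>. ?S m \<omega> \<partial>M) \<longlonglongrightarrow> x"
    using incseq_convergent[where X = "\<lambda>m. \<integral>\<omega>. ?S m \<omega> \<partial>M"] bd by blast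
  have lim: "AE \<omega> in M. (\<lambda>m. ?S m \<omega>) \<longlonglongrightarrow> (\<Sum>n. f n \<omega>) ^ r"
    using summ by eventually_elim (intro tendsto_intros summable_LIMSEQ)
  have m: "AE \<omega> in M. mono (\<lambda>m. ?S m \<omega>)" by (auto simp: mono_def mono)
  have meas: "(\<lambda>\<omega>. (\<Sum>n. f n \<omega>) ^ r) \<in> borel_measurable M" by measurable
  show "integrable M (\<lambda>\<omega>. (\<Sum>n. f n \<omega>) ^ r)"
    by (rule integral_monotone_convergence_nonneg(1)[OF int m _ lim x meas]) (use S0 in auto)
  have "(\<integral>\<omega>. (\<Sum>n. f n \<omega>) ^ r \<partial>M) = x"
    by (rule integral_monotone_convergence_nonneg(2)[OF int m _ lim x meas]) (use S0 in auto)
  also have "x \<le> E" using x bd by (intro LIMSEQ_le_const2) auto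
  finally show "(\<integral>\<omega>. (\<Sum>n. f n \<omega>) ^ r \<partial>M) \<le> E" .
qed

text \<open>The functions take whole paths as arguments; invariance under \<open>restrict\<close>
  expresses that they read only the coordinates in A or B, so that independence of disjoint blocks
  of coordinates applies.\<close>

lemma (in prob_space) indep_var_path_functions:
  fixes Z :: "int \<Rightarrow> 'a \<Rightarrow> real" and f g :: "(int \<Rightarrow> real) \<Rightarrow> real"
  assumes "indep_vars (\<lambda>_. borel) Z UNIV" "A \<inter> B = {}"
    and "f \<in> borel_measurable (Pi\<^sub>M A (\<lambda>_. borel))" "g \<in> borel_measurable (Pi\<^sub>M B (\<lambda>_. borel))"
    and "\<And>z. f (restrict z A) = f z" "\<And>z. g (restrict z B) = g z"
  shows "indep_var borel (\<lambda>\<omega>. f (\<lambda>t. Z t \<omega>)) borel (\<lambda>\<omega>. g (\<lambda>t. Z t \<omega>))"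
  using indep_var_compose[OF indep_var_restrict[OF assms(1,2)] assms(3,4)] assms(5,6)
  by (simp add: comp_def)

lemma measurable_path_function:
  fixes Z :: "int \<Rightarrow> 'a \<Rightarrow> real" and f :: "(int \<Rightarrow> real) \<Rightarrow> real"
  assumes "\<And>t. Z t \<in> borel_measurable M" "f \<in> borel_measurable (Pi\<^sub>M A (\<lambda>_. borel))"
    and "\<And>z. f (restrict z A) = f z"
  shows "(\<lambda>\<omega>. f (\<lambda>t. Z t \<omega>)) \<in> borel_measurable M"
proof -
  have "(\<lambda>\<omega>. restrict (\<lambda>t. Z t \<omega>) A) \<in> measurable M (Pi\<^sub>M A (\<lambda>_. borel))"
    using assms(1) by (intro measurable_restrict)
  from measurable_compose[OF this assms(2)] show ?thesis using assms(3) by simp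
qed

lemma arch_level_restrict:
  assumes "{t - int (n * p)..t} \<subseteq> A"
  shows "arch_level p c (restrict z A) n t = arch_level p c z n t"
  by (rule arch_level_cong) (use assms in \<open>auto simp: subset_eq\<close>)

lemma arch_series_measurable:
  assumes "{..t} \<subseteq> A"
  shows "(\<lambda>z. arch_series p c z t) \<in> borel_measurable (Pi\<^sub>M A (\<lambda>_. borel))"
  unfolding arch_series_def
  by (intro borel_measurable_suminf arch_level_measurable) (use assms in auto)

lemma arch_series_restrict:
  assumes "{..t} \<subseteq> A"
  shows "arch_series p c (restrict z A) t = arch_series p c z t"
  unfolding arch_series_def using assms by (auto intro!: suminf_cong arch_level_restrict)

text \<open>Summing the level recursion shows that the partial sums satisfy the ARCH recursion
  themselves, with one more level at time t than at the lagged times. This drives the induction for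
  the moments.\<close>

lemma dom_partial_sum_Suc:
  "(\<Sum>n<Suc m. arch_level p (dom_coeff lam q) z n t)
    = (z t)\<^sup>2 * (q 0 + (\<Sum>j=1..p. lam * q j * (\<Sum>n<m. arch_level p (dom_coeff lam q) z n (t - int j))))"
proof -
  have "(\<Sum>n<Suc m. arch_level p (dom_coeff lam q) z n t)
      = arch_level p (dom_coeff lam q) z 0 t + (\<Sum>n<m. arch_level p (dom_coeff lam q) z (Suc n) t)"
    by (rule sum.lessThan_Suc_shift)
  also have "(\<Sum>n<m. arch_level p (dom_coeff lam q) z (Suc n) t)
      = (z t)\<^sup>2 * (\<Sum>n<m. \<Sum>j=1..p. lam * q j * arch_level p (dom_coeff lam q) z n (t - int j))"
    unfolding dom_level_Suc by (simp add: sum_distrib_left mult_ac)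
  also have "(\<Sum>n<m. \<Sum>j=1..p. lam * q j * arch_level p (dom_coeff lam q) z n (t - int j))
      = (\<Sum>j=1..p. lam * q j * (\<Sum>n<m. arch_level p (dom_coeff lam q) z n (t - int j)))"
    by (subst sum.swap) (simp add: sum_distrib_left)
  also have "arch_level p (dom_coeff lam q) z 0 t = (z t)\<^sup>2 * q 0" by (simp add: dom_coeff_def)
  finally show ?thesis by (simp only: distrib_left)
qed

text \<open>The bound \<open>E\<close> is the fixed point of the recursion for the sixth moments of the partial sums
  that convexity yields; \<open>\<beta>\<close> is the weight given to the constant term \<open>q 0\<close>.\<close>

lemma (in prob_space) dom_partial_moment:
  fixes Z :: "int \<Rightarrow> 'a \<Rightarrow> real"
  assumes indep: "indep_vars (\<lambda>_. borel) Z UNIV"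
    and m12: "\<And>t. integrable M (\<lambda>\<omega>. Z t \<omega> ^ 12)" "\<And>t. expectation (\<lambda>\<omega>. Z t \<omega> ^ 12) \<le> m12"
    and q: "\<And>j. 0 \<le> q j" "0 \<le> lam" and \<beta>: "0 < \<beta>"
    and contr: "m12 * (\<beta> + (\<Sum>j=1..p. lam * q j)) ^ 6 \<le> 1"
  defines "E \<equiv> (q 0 / \<beta>) ^ 6"
  shows "integrable M (\<lambda>\<omega>. (\<Sum>n<m. arch_level p (dom_coeff lam q) (\<lambda>s. Z s \<omega>) n t) ^ 6) \<and>
    expectation (\<lambda>\<omega>. (\<Sum>n<m. arch_level p (dom_coeff lam q) (\<lambda>s. Z s \<omega>) n t) ^ 6) \<le> E"
proof (induction m arbitrary: t)
  case 0
  show ?case by (simp add: E_def)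
next
  case (Suc m)
  have rv: "random_variable borel (Z t)" for t using indep by (auto simp: indep_vars_def)
  define S where "S z t = (\<Sum>n<m. arch_level p (dom_coeff lam q) z n t)" for z t
  have S0: "0 \<le> S z t" for z t unfolding S_def using q by (intro sum_nonneg dom_level_nonneg) auto
  \<comment> \<open>The constant q 0 becomes a zeroth summand with weight \<beta> and value q 0 /
    \<beta>. Its sixth power is then exactly E, and one convexity step treats all summands
    alike.\<close>
  define w where "w j = (if j = 0 then \<beta> else lam * q j)" for j
  define y where "y z j = (if j = 0 then q 0 / \<beta> else S z (t - int j))" for z and j :: nat
  have w0: "0 \<le> w j" for j using q \<beta> by (simp add: w_def)
  have sw: "sum w {0..p} = \<beta> + (\<Sum>j=1..p. lam * q j)"
    by (subst sum.atLeast_Suc_atMost) (auto simp: w_def)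
  define s where "s = sum w {0..p}"
  have s: "0 < s" unfolding s_def sw using \<beta> q by (intro add_pos_nonneg sum_nonneg) auto
  define R where "R z = (\<Sum>j=0..p. w j * y z j) ^ 6" for z
  have R_eq: "(\<Sum>n<Suc m. arch_level p (dom_coeff lam q) z n t) ^ 6 = z t ^ 12 * R z" for z
  proof -
    have "q 0 + (\<Sum>j=1..p. lam * q j * S z (t - int j)) = (\<Sum>j=0..p. w j * y z j)"
      using \<beta> by (subst sum.atLeast_Suc_atMost) (auto simp: w_def y_def)
    then have "(\<Sum>n<Suc m. arch_level p (dom_coeff lam q) z n t) = (z t)\<^sup>2 * (\<Sum>j=0..p. w j * y z j)"
      unfolding dom_partial_sum_Suc S_def by simp
    then show ?thesis by (simp add: R_def power_mult_distrib flip: power_mult)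
  qed
  have Rle: "R z \<le> s ^ 5 * (\<Sum>j=0..p. w j * y z j ^ 6)" for z
    unfolding R_def s_def using power_sum_convex[of "{0..p}" w 6 "y z"] w0 s by (simp add: s_def)
  have R0: "0 \<le> R z" for z unfolding R_def by simp
  \<comment> \<open>All lags are at least 1, so R reads only the noise before t and is independent
    of the factor at time t.\<close>
  have Smeas: "(\<lambda>z. S z (t - int j)) \<in> borel_measurable (Pi\<^sub>M {..<t} (\<lambda>_. borel))" if "1 \<le> j" for j
    unfolding S_def by (intro borel_measurable_sum arch_level_measurable) (use that in auto)
  have Srestr: "S (restrict z {..<t}) (t - int j) = S z (t - int j)" if "1 \<le> j" for z j
    unfolding S_def by (intro sum.cong refl arch_level_restrict) (use that in auto)
  have [measurable]: "(\<lambda>z. y z j) \<in> borel_measurable (Pi\<^sub>M {..<t} (\<lambda>_. borel))" for j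
    using Smeas[of j] by (cases "j = 0") (auto simp: y_def)
  have Rmeas: "R \<in> borel_measurable (Pi\<^sub>M {..<t} (\<lambda>_. borel))"
    unfolding R_def by measurable
  have Rrestr: "R (restrict z {..<t}) = R z" for z
    unfolding R_def y_def using Srestr by (auto intro!: arg_cong[where f = "\<lambda>x. x ^ 6"] sum.cong)
  let ?R = "\<lambda>\<omega>. R (\<lambda>s. Z s \<omega>)" and ?y = "\<lambda>j \<omega>. y (\<lambda>s. Z s \<omega>) j"
  have ind: "indep_var borel (\<lambda>\<omega>. Z t \<omega> ^ 12) borel ?R"
    using indep_var_path_functions[OF indep, of "{t}" "{..<t}" "\<lambda>z. z t ^ 12" R] Rmeas Rrestr by simp
  have iy: "integrable M (\<lambda>\<omega>. ?y j \<omega> ^ 6)" for j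
    using Suc.IH[of "t - int j"] by (cases "j = 0") (simp_all add: y_def S_def)
  have Ey: "expectation (\<lambda>\<omega>. ?y j \<omega> ^ 6) \<le> E" for j
    using Suc.IH[of "t - int j"] by (cases "j = 0") (simp_all add: y_def S_def E_def prob_space)
  have isum: "integrable M (\<lambda>\<omega>. s ^ 5 * (\<Sum>j=0..p. w j * ?y j \<omega> ^ 6))" using iy by auto
  have iR: "integrable M ?R"
  proof (rule Bochner_Integration.integrable_bound[OF isum])
    show "?R \<in> borel_measurable M" by (rule measurable_path_function[OF rv Rmeas Rrestr])
  qed (use R0 Rle in \<open>auto intro!: AE_I2 intro: order_trans[OF _ abs_ge_self]\<close>)
  have "expectation ?R \<le> expectation (\<lambda>\<omega>. s ^ 5 * (\<Sum>j=0..p. w j * ?y j \<omega> ^ 6))"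
    by (intro integral_mono iR isum Rle)
  also have "\<dots> = s ^ 5 * (\<Sum>j=0..p. w j * expectation (\<lambda>\<omega>. ?y j \<omega> ^ 6))" using iy by simp
  also have "\<dots> \<le> s ^ 5 * (\<Sum>j=0..p. w j * E)"
    using s w0 Ey by (intro mult_left_mono sum_mono) auto
  also have "\<dots> = s ^ 5 * (s * E)" by (simp add: s_def sum_distrib_right)
  also have "\<dots> = s ^ 6 * E" by algebra
  finally have ER: "expectation ?R \<le> s ^ 6 * E" .
  have E0: "0 \<le> E" by (simp add: E_def)
  have "expectation (\<lambda>\<omega>. Z t \<omega> ^ 12 * ?R \<omega>) = expectation (\<lambda>\<omega>. Z t \<omega> ^ 12) * expectation ?R"
    by (rule indep_var_lebesgue_integral[OF ind m12(1) iR])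
  also have "\<dots> \<le> m12 * (s ^ 6 * E)"
  proof (rule mult_mono[OF m12(2) ER])
    show "0 \<le> m12" using m12(2)[of t] by (rule order_trans[rotated]) simp
    show "0 \<le> expectation ?R" using R0 by simp
  qed
  also have "\<dots> = (m12 * s ^ 6) * E" by simp
  also have "\<dots> \<le> 1 * E" using contr E0 unfolding s_def sw by (rule mult_right_mono)
  finally have "expectation (\<lambda>\<omega>. Z t \<omega> ^ 12 * ?R \<omega>) \<le> E" by simp
  moreover have "integrable M (\<lambda>\<omega>. Z t \<omega> ^ 12 * ?R \<omega>)"
    by (rule indep_var_integrable[OF ind m12(1) iR])
  ultimately show ?case unfolding R_eq by simp
qed

section \<open>Probabilistic bounds\<close>

lemma score_measurable:
  assumes [measurable]: "\<And>j. y j \<in> borel_measurable M"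
  shows "(\<lambda>x. score p \<alpha> i (\<lambda>j. y j x)) \<in> borel_measurable M"
  unfolding score_def score_w_def by (cases "i = 0") simp_all

text \<open>The interface to the noise: independence in time, and a sixth moment bound for the
  inflated partial sums that is uniform in the number of levels and in time.\<close>

locale arch_noise = prob_space M for M :: "'a measure" +
  fixes Z :: "int \<Rightarrow> 'a \<Rightarrow> real" and p :: nat and q :: "nat \<Rightarrow> real" and lam E :: real
  assumes indep: "indep_vars (\<lambda>_. borel) Z UNIV"
    and p: "1 \<le> p" and lam: "1 < lam" and q: "\<And>j. 0 \<le> q j"
    and moment: "\<And>m t. integrable M (\<lambda>\<omega>. (\<Sum>n<m. arch_level p (dom_coeff lam q) (\<lambda>s. Z s \<omega>) n t) ^ 6) \<and>
      expectation (\<lambda>\<omega>. (\<Sum>n<m. arch_level p (dom_coeff lam q) (\<lambda>s. Z s \<omega>) n t) ^ 6) \<le> E"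
begin

definition V :: "int \<Rightarrow> 'a \<Rightarrow> real" where
  "V t \<omega> = arch_series p (dom_coeff lam q) (\<lambda>s. Z s \<omega>) t"

text \<open>One majorant for all squares that the score at time k reads. The summand 1 makes its
  powers increase with the exponent.\<close>

definition G :: "int \<Rightarrow> 'a \<Rightarrow> real" where
  "G k \<omega> = 1 + (\<Sum>j\<le>p. V (k - int j) \<omega>)"

definition Y :: "(nat \<Rightarrow> int \<Rightarrow> real) \<Rightarrow> int \<Rightarrow> 'a \<Rightarrow> real" where
  "Y c t \<omega> = arch_series p c (\<lambda>s. Z s \<omega>) t"

definition Ytrunc :: "nat \<Rightarrow> (nat \<Rightarrow> int \<Rightarrow> real) \<Rightarrow> int \<Rightarrow> 'a \<Rightarrow> real" where
  "Ytrunc m c t \<omega> = (\<Sum>n<m. arch_level p c (\<lambda>s. Z s \<omega>) n t)"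

text \<open>The sixth moment bound for a sum of p + 2 terms, namely 1 and p + 1 values of V,
  obtained from convexity with unit weights.\<close>

definition EG :: real where
  "EG = (real p + 2) ^ 5 * (1 + (real p + 1) * E)"

definition cov :: "('a \<Rightarrow> real) \<Rightarrow> ('a \<Rightarrow> real) \<Rightarrow> real" where
  "cov A B = expectation (\<lambda>\<omega>. A \<omega> * B \<omega>) - expectation A * expectation B"

lemma Z_measurable [measurable]: "Z t \<in> borel_measurable M"
  using indep by (auto simp: indep_vars_def)

lemma level_measurable [measurable]: "(\<lambda>\<omega>. arch_level p c (\<lambda>s. Z s \<omega>) n t) \<in> borel_measurable M"
  by (rule measurable_path_function[OF Z_measurable arch_level_measurable arch_level_restrict])
     (rule subset_UNIV)+

lemma Y_measurable [measurable]: "Y c t \<in> borel_measurable M"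
  unfolding Y_def arch_series_def by measurable

lemma V_measurable [measurable]: "V t \<in> borel_measurable M"
  unfolding V_def arch_series_def by measurable

lemma Ytrunc_measurable [measurable]: "Ytrunc m c t \<in> borel_measurable M"
  unfolding Ytrunc_def by measurable

lemma G_measurable [measurable]: "G k \<in> borel_measurable M"
  unfolding G_def by measurable

lemma V_moment:
  "AE \<omega> in M. summable (\<lambda>n. arch_level p (dom_coeff lam q) (\<lambda>s. Z s \<omega>) n t)"
  "integrable M (\<lambda>\<omega>. V t \<omega> ^ 6)" "expectation (\<lambda>\<omega>. V t \<omega> ^ 6) \<le> E"
  using AE_summable_power[of "\<lambda>n \<omega>. arch_level p (dom_coeff lam q) (\<lambda>s. Z s \<omega>) n t" M 6 E]
    moment[where t = t] dom_level_nonneg[of q lam p] q lam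
  unfolding V_def arch_series_def by auto

lemma AE_summable: "AE \<omega> in M. \<forall>t. summable (\<lambda>n. arch_level p (dom_coeff lam q) (\<lambda>s. Z s \<omega>) n t)"
  by (subst AE_all_countable) (use V_moment(1) in blast)

lemma AE_V_le_G: "AE \<omega> in M. \<forall>k. 1 \<le> G k \<omega> \<and> (\<forall>j\<le>p. 0 \<le> V (k - int j) \<omega> \<and> V (k - int j) \<omega> \<le> G k \<omega>)"
  using AE_summable
proof eventually_elim
  case (elim \<omega>)
  then have V0: "0 \<le> V t \<omega>" for t unfolding V_def using dom_series_nonneg[where p = p and q = q and lam = lam, OF lam q] by blast
  have "V (k - int j) \<omega> \<le> (\<Sum>j\<le>p. V (k - int j) \<omega>)" if "j \<le> p" for k j
    using V0 that by (intro member_le_sum) auto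
  moreover have "0 \<le> (\<Sum>j\<le>p. V (k - int j) \<omega>)" for k by (intro sum_nonneg V0)
  ultimately show ?case using V0 by (auto simp: G_def intro: add_increasing)
qed

lemma E_nonneg: "0 \<le> E"
  using moment[of 0 0] by simp

lemma EG_nonneg: "0 \<le> EG"
  unfolding EG_def using E_nonneg by simp

lemma G_moment6: "integrable M (\<lambda>\<omega>. G k \<omega> ^ 6)" "expectation (\<lambda>\<omega>. G k \<omega> ^ 6) \<le> EG"
proof -
  let ?B = "\<lambda>\<omega>. (real p + 2) ^ 5 * (1 + (\<Sum>j\<le>p. V (k - int j) \<omega> ^ 6))"
  have le: "G k \<omega> ^ 6 \<le> ?B \<omega>" for \<omega>
  proof -
    define y where "y i = (case i of 0 \<Rightarrow> 1 | Suc j \<Rightarrow> V (k - int j) \<omega>)" for i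
    have "(\<Sum>i\<in>{..Suc p}. 1 * y i) ^ 6
        \<le> (\<Sum>i\<in>{..Suc p}. 1::real) ^ (6 - 1) * (\<Sum>i\<in>{..Suc p}. 1 * y i ^ 6)"
      by (rule power_sum_convex) auto
    moreover have "(\<Sum>i\<in>{..Suc p}. 1 * y i) = G k \<omega>"
      by (simp add: G_def y_def sum.atMost_Suc_shift del: sum.atMost_Suc)
    moreover have "(\<Sum>i\<in>{..Suc p}. 1 * y i ^ 6) = 1 + (\<Sum>j\<le>p. V (k - int j) \<omega> ^ 6)"
      by (simp add: y_def sum.atMost_Suc_shift del: sum.atMost_Suc)
    ultimately show ?thesis by (simp add: add.commute)
  qed
  have iB: "integrable M ?B" using V_moment(2) by auto
  show i: "integrable M (\<lambda>\<omega>. G k \<omega> ^ 6)"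
    by (rule Bochner_Integration.integrable_bound[OF iB])
       (auto intro!: AE_I2 order_trans[OF le] simp del: distrib_left_numeral)
  have "expectation (\<lambda>\<omega>. G k \<omega> ^ 6) \<le> expectation ?B" by (intro integral_mono i iB le)
  also have "\<dots> = (real p + 2) ^ 5 * (1 + (\<Sum>j\<le>p. expectation (\<lambda>\<omega>. V (k - int j) \<omega> ^ 6)))"
    using V_moment(2) by (simp add: prob_space)
  also have "\<dots> \<le> (real p + 2) ^ 5 * (1 + (\<Sum>j\<le>p. E))"
    by (intro mult_left_mono add_left_mono sum_mono V_moment(3)) auto
  also have "\<dots> = EG" by (simp add: EG_def add.commute)
  finally show "expectation (\<lambda>\<omega>. G k \<omega> ^ 6) \<le> EG" .
qed

text \<open>Almost surely G is at least 1, so the bound for the sixth power serves every smaller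
  exponent.\<close>

lemma G_moment:
  assumes "n \<le> 6"
  shows "integrable M (\<lambda>\<omega>. G k \<omega> ^ n)" "expectation (\<lambda>\<omega>. G k \<omega> ^ n) \<le> EG"
proof -
  have le: "AE \<omega> in M. 0 \<le> G k \<omega> ^ n \<and> G k \<omega> ^ n \<le> G k \<omega> ^ 6"
    using AE_V_le_G by eventually_elim (use assms in \<open>auto intro!: power_increasing order_trans[OF zero_le_one]\<close>)
  show i: "integrable M (\<lambda>\<omega>. G k \<omega> ^ n)"
    by (rule Bochner_Integration.integrable_bound[OF G_moment6(1)[of k]]) (use le in auto)
  have "expectation (\<lambda>\<omega>. G k \<omega> ^ n) \<le> expectation (\<lambda>\<omega>. G k \<omega> ^ 6)"
    by (intro integral_mono_AE i G_moment6(1)) (use le in auto)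
  with G_moment6(2)[of k] show "expectation (\<lambda>\<omega>. G k \<omega> ^ n) \<le> EG" by simp
qed

lemma G_product: "integrable M (\<lambda>\<omega>. G k \<omega> ^ 2 * G l \<omega> ^ 2)" "expectation (\<lambda>\<omega>. G k \<omega> ^ 2 * G l \<omega> ^ 2) \<le> EG"
proof -
  have le: "G k \<omega> ^ 2 * G l \<omega> ^ 2 \<le> 1 / 2 * (G k \<omega> ^ 4 + G l \<omega> ^ 4)" for \<omega>
  proof -
    have "0 \<le> (G k \<omega> ^ 2 - G l \<omega> ^ 2)\<^sup>2" by simp
    also have "\<dots> = G k \<omega> ^ 4 + G l \<omega> ^ 4 - 2 * (G k \<omega> ^ 2 * G l \<omega> ^ 2)" by algebra
    finally show ?thesis by simp
  qed
  have iB: "integrable M (\<lambda>\<omega>. 1 / 2 * (G k \<omega> ^ 4 + G l \<omega> ^ 4))" using G_moment(1)[of 4] by auto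
  show i: "integrable M (\<lambda>\<omega>. G k \<omega> ^ 2 * G l \<omega> ^ 2)"
    by (rule Bochner_Integration.integrable_bound[OF iB]) (use le in \<open>auto intro!: AE_I2 simp: abs_mult\<close>)
  have "expectation (\<lambda>\<omega>. G k \<omega> ^ 2 * G l \<omega> ^ 2) \<le> expectation (\<lambda>\<omega>. 1 / 2 * (G k \<omega> ^ 4 + G l \<omega> ^ 4))"
    by (intro integral_mono i iB le)
  also have "\<dots> = 1 / 2 * (expectation (\<lambda>\<omega>. G k \<omega> ^ 4) + expectation (\<lambda>\<omega>. G l \<omega> ^ 4))"
    using G_moment(1)[of 4] by simp
  also have "\<dots> \<le> EG" using G_moment(2)[of 4 k] G_moment(2)[of 4 l] by simp
  finally show "expectation (\<lambda>\<omega>. G k \<omega> ^ 2 * G l \<omega> ^ 2) \<le> EG" .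
qed

section \<open>Expectations and covariances of variables dominated by powers of G\<close>

lemma integrable_G_bound:
  assumes [measurable]: "A \<in> borel_measurable M" and "AE \<omega> in M. \<bar>A \<omega>\<bar> \<le> a * G k \<omega> ^ n" "n \<le> 6"
  shows "integrable M A" "\<bar>expectation A\<bar> \<le> a * expectation (\<lambda>\<omega>. G k \<omega> ^ n)"
proof -
  have iB: "integrable M (\<lambda>\<omega>. a * G k \<omega> ^ n)" using G_moment(1)[OF assms(3)] by simp
  show i: "integrable M A"
    by (rule Bochner_Integration.integrable_bound[OF iB]) (use assms(2) in auto)
  have "\<bar>expectation A\<bar> \<le> expectation (\<lambda>\<omega>. \<bar>A \<omega>\<bar>)" by (rule integral_abs_bound)
  also have "\<dots> \<le> expectation (\<lambda>\<omega>. a * G k \<omega> ^ n)"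
    by (intro integral_mono_AE iB integrable_abs i assms)
  finally show "\<bar>expectation A\<bar> \<le> a * expectation (\<lambda>\<omega>. G k \<omega> ^ n)" using G_moment(1)[OF assms(3)] by simp
qed

lemma product_G_bound:
  assumes [measurable]: "A \<in> borel_measurable M" "B \<in> borel_measurable M"
    and A: "AE \<omega> in M. \<bar>A \<omega>\<bar> \<le> a * G k \<omega> ^ 2" and B: "AE \<omega> in M. \<bar>B \<omega>\<bar> \<le> b * G l \<omega> ^ 2"
    and ab: "0 \<le> a" "0 \<le> b"
  shows "integrable M (\<lambda>\<omega>. A \<omega> * B \<omega>)" "\<bar>expectation (\<lambda>\<omega>. A \<omega> * B \<omega>)\<bar> \<le> a * b * EG"
proof -
  have le: "AE \<omega> in M. \<bar>A \<omega> * B \<omega>\<bar> \<le> a * b * (G k \<omega> ^ 2 * G l \<omega> ^ 2)"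
    using A B
  proof eventually_elim
    case (elim \<omega>)
    have "\<bar>A \<omega> * B \<omega>\<bar> \<le> (a * G k \<omega> ^ 2) * (b * G l \<omega> ^ 2)"
      unfolding abs_mult using elim ab by (intro mult_mono) auto
    then show ?case by (simp add: mult_ac)
  qed
  have iB: "integrable M (\<lambda>\<omega>. a * b * (G k \<omega> ^ 2 * G l \<omega> ^ 2))" using G_product(1) by simp
  show i: "integrable M (\<lambda>\<omega>. A \<omega> * B \<omega>)"
    by (rule Bochner_Integration.integrable_bound[OF iB]) (use le in auto)
  have "\<bar>expectation (\<lambda>\<omega>. A \<omega> * B \<omega>)\<bar> \<le> expectation (\<lambda>\<omega>. \<bar>A \<omega> * B \<omega>\<bar>)" by (rule integral_abs_bound)
  also have "\<dots> \<le> expectation (\<lambda>\<omega>. a * b * (G k \<omega> ^ 2 * G l \<omega> ^ 2))"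
    by (intro integral_mono_AE iB integrable_abs i le)
  also have "\<dots> = a * b * expectation (\<lambda>\<omega>. G k \<omega> ^ 2 * G l \<omega> ^ 2)" using G_product(1) by simp
  also have "\<dots> \<le> a * b * EG" using ab by (intro mult_left_mono G_product(2)) auto
  finally show "\<bar>expectation (\<lambda>\<omega>. A \<omega> * B \<omega>)\<bar> \<le> a * b * EG" .
qed

text \<open>B' is a stand-in for B that is independent of A. By bilinearity the covariance of A and
  B equals that of A and B - B', so it inherits both the size of A and the approximation
  error.\<close>

lemma covariance_G_bound:
  assumes meas [measurable]: "A \<in> borel_measurable M" "B \<in> borel_measurable M" "B' \<in> borel_measurable M"
    and A: "AE \<omega> in M. \<bar>A \<omega>\<bar> \<le> a * G k \<omega> ^ 2" and B': "AE \<omega> in M. \<bar>B' \<omega>\<bar> \<le> b' * G l \<omega> ^ 2"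
    and B: "AE \<omega> in M. \<bar>B \<omega> - B' \<omega>\<bar> \<le> b * G l \<omega> ^ 2"
    and ab: "0 \<le> a" "0 \<le> b" "0 \<le> b'" and ind: "indep_var borel A borel B'"
  shows "\<bar>cov A B\<bar> \<le> a * b * (EG + EG\<^sup>2)"
proof -
  have iA: "integrable M A" "\<bar>expectation A\<bar> \<le> a * expectation (\<lambda>\<omega>. G k \<omega> ^ 2)"
    by (rule integrable_G_bound[OF meas(1) A]; simp)+
  have iB': "integrable M B'" by (rule integrable_G_bound(1)[OF meas(3) B']) simp
  have iD: "integrable M (\<lambda>\<omega>. B \<omega> - B' \<omega>)"
    "\<bar>expectation (\<lambda>\<omega>. B \<omega> - B' \<omega>)\<bar> \<le> b * expectation (\<lambda>\<omega>. G l \<omega> ^ 2)"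
    by (rule integrable_G_bound[OF _ B]; simp)+
  have iB: "integrable M B" using Bochner_Integration.integrable_add[OF iD(1) iB'] by simp
  have AD: "integrable M (\<lambda>\<omega>. A \<omega> * (B \<omega> - B' \<omega>))" "\<bar>expectation (\<lambda>\<omega>. A \<omega> * (B \<omega> - B' \<omega>))\<bar> \<le> a * b * EG"
    by (rule product_G_bound[OF meas(1) _ A B ab(1,2)]; simp)+
  have AB': "integrable M (\<lambda>\<omega>. A \<omega> * B' \<omega>)" "expectation (\<lambda>\<omega>. A \<omega> * B' \<omega>) = expectation A * expectation B'"
    using indep_var_integrable[OF ind iA(1) iB'] indep_var_lebesgue_integral[OF ind iA(1) iB'] by auto
  have "expectation (\<lambda>\<omega>. A \<omega> * B \<omega>) = expectation (\<lambda>\<omega>. A \<omega> * (B \<omega> - B' \<omega>) + A \<omega> * B' \<omega>)"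
    by (simp add: right_diff_distrib)
  also have "\<dots> = expectation (\<lambda>\<omega>. A \<omega> * (B \<omega> - B' \<omega>)) + expectation A * expectation B'"
    using AD(1) AB' by simp
  finally have eq: "cov A B = expectation (\<lambda>\<omega>. A \<omega> * (B \<omega> - B' \<omega>)) - expectation A * expectation (\<lambda>\<omega>. B \<omega> - B' \<omega>)"
    unfolding cov_def using iB iB' by (simp add: right_diff_distrib)
  have "\<bar>expectation A * expectation (\<lambda>\<omega>. B \<omega> - B' \<omega>)\<bar> \<le> (a * EG) * (b * EG)"
    unfolding abs_mult
    using iA(2) iD(2) G_moment(2)[of 2] ab EG_nonneg
    by (intro mult_mono) (auto intro: order_trans mult_left_mono)
  with AD(2) have "\<bar>expectation (\<lambda>\<omega>. A \<omega> * (B \<omega> - B' \<omega>)) - expectation A * expectation (\<lambda>\<omega>. B \<omega> - B' \<omega>)\<bar>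
      \<le> a * b * EG + (a * EG) * (b * EG)" by linarith
  also have "\<dots> = a * b * (EG + EG\<^sup>2)" by algebra
  finally show ?thesis unfolding eq .
qed

lemma AE_Y_bounds:
  assumes c: "coeff_le p q c k"
  shows "AE \<omega> in M. \<forall>j\<le>p. 0 \<le> Y c (k - int j) \<omega> \<and> Y c (k - int j) \<omega> \<le> V (k - int j) \<omega> \<and>
    0 \<le> Ytrunc m c (k - int j) \<omega> \<and> Ytrunc m c (k - int j) \<omega> \<le> V (k - int j) \<omega> \<and>
    \<bar>Y c (k - int j) \<omega> - Ytrunc m c (k - int j) \<omega>\<bar> \<le> 1 / lam ^ m * V (k - int j) \<omega>"
  using AE_summable
proof eventually_elim
  case (elim \<omega>)
  have cj: "coeff_le p q c (k - int j)" for j by (rule coeff_le_mono[OF c]) simp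
  have s: "summable (\<lambda>n. arch_level p (dom_coeff lam q) (\<lambda>s. Z s \<omega>) n t)" for t using elim by blast
  note Y_def[simp] Ytrunc_def[simp] V_def[simp]
  have 1: "Y c (k - int j) \<omega> \<le> V (k - int j) \<omega>" for j
    using arch_series_le_dom[where p = p and q = q and lam = lam and c = c, OF lam q s cj] by simp
  have 2: "Ytrunc m c (k - int j) \<omega> \<le> Y c (k - int j) \<omega>" for j
    using arch_partial_le[where p = p and q = q and lam = lam and c = c, OF lam q s cj] by simp
  have 3: "0 \<le> Ytrunc m c (k - int j) \<omega>" for j
    using arch_partial_nonneg[where p = p and q = q and lam = lam and c = c, OF lam q s cj] by simp
  have 4: "\<bar>Y c (k - int j) \<omega> - Ytrunc m c (k - int j) \<omega>\<bar> \<le> 1 / lam ^ m * V (k - int j) \<omega>" for j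
    using arch_series_truncation[where p = p and q = q and lam = lam and c = c, OF lam q s cj] by simp
  show ?case
    by (intro allI impI conjI 1 3 4 order_trans[OF 3 2] order_trans[OF 2 1])
qed

end

section \<open>Covariances of score differences\<close>

context arch_noise
begin

definition S :: "(nat \<Rightarrow> real) \<Rightarrow> nat \<Rightarrow> (nat \<Rightarrow> int \<Rightarrow> real) \<Rightarrow> int \<Rightarrow> 'a \<Rightarrow> real" where
  "S \<alpha> i c k \<omega> = score p \<alpha> i (\<lambda>j. Y c (k - int j) \<omega>)"

definition Strunc :: "nat \<Rightarrow> (nat \<Rightarrow> real) \<Rightarrow> nat \<Rightarrow> (nat \<Rightarrow> int \<Rightarrow> real) \<Rightarrow> int \<Rightarrow> 'a \<Rightarrow> real" where
  "Strunc m \<alpha> i c k \<omega> = score p \<alpha> i (\<lambda>j. Ytrunc m c (k - int j) \<omega>)"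

definition D :: "(nat \<Rightarrow> real) \<Rightarrow> nat \<Rightarrow> (nat \<Rightarrow> int \<Rightarrow> real) \<Rightarrow> (nat \<Rightarrow> int \<Rightarrow> real) \<Rightarrow> int \<Rightarrow> 'a \<Rightarrow> real" where
  "D \<alpha> i c c' k \<omega> = S \<alpha> i c k \<omega> - S \<alpha> i c' k \<omega>"

definition Dtrunc :: "nat \<Rightarrow> (nat \<Rightarrow> real) \<Rightarrow> nat \<Rightarrow> (nat \<Rightarrow> int \<Rightarrow> real) \<Rightarrow> (nat \<Rightarrow> int \<Rightarrow> real) \<Rightarrow> int \<Rightarrow> 'a \<Rightarrow> real" where
  "Dtrunc m \<alpha> i c c' k \<omega> = Strunc m \<alpha> i c k \<omega> - Strunc m \<alpha> i c' k \<omega>"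

lemma S_measurable [measurable]: "S \<alpha> i c k \<in> borel_measurable M"
  unfolding S_def by (intro score_measurable Y_measurable)

lemma Strunc_measurable [measurable]: "Strunc m \<alpha> i c k \<in> borel_measurable M"
  unfolding Strunc_def by (intro score_measurable Ytrunc_measurable)

lemma D_measurable [measurable]: "D \<alpha> i c c' k \<in> borel_measurable M"
  unfolding D_def by measurable

lemma Dtrunc_measurable [measurable]: "Dtrunc m \<alpha> i c c' k \<in> borel_measurable M"
  unfolding Dtrunc_def by measurable

lemma score_cong:
  assumes "\<And>j. j \<le> p \<Longrightarrow> y j = y' j" "i \<le> p"
  shows "score p \<alpha> i y = score p \<alpha> i y'"
  using assms by (simp add: score_def score_w_def)

text \<open>The difference at k reads noise up to time k. Level n < m at a lag of at most p reaches
  back at most n * p + p \<le> m * p steps from l, hence stays strictly after k.\<close>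

lemma D_Dtrunc_indep:
  assumes kl: "k + int (m * p) < l" and i: "i \<le> p"
  shows "indep_var borel (D \<alpha> i c c' k) borel (Dtrunc m \<alpha> i c c' l)"
proof -
  define f where "f z = score p \<alpha> i (\<lambda>j. arch_series p c z (k - int j))
    - score p \<alpha> i (\<lambda>j. arch_series p c' z (k - int j))" for z
  \<comment> \<open>\<open>score_measurable\<close> asks for measurability of all components,
    although the score reads only those up to p. Setting the others to 0 keeps them from reaching
    back beyond time k.\<close>
  define h where "h c z j = (if j \<le> p then \<Sum>n<m. arch_level p c z n (l - int j) else 0)" for c z j
  define g where "g z = score p \<alpha> i (h c z) - score p \<alpha> i (h c' z)" for z
  have sub: "{l - int j - int (n * p)..l - int j} \<subseteq> {k<..}" if "n < m" "j \<le> p" for n j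
  proof -
    have "n * p + j \<le> Suc n * p" using that by simp
    also have "\<dots> \<le> m * p" using that by (intro mult_right_mono) auto
    finally have "int (n * p) + int j \<le> int (m * p)" by (metis of_nat_add of_nat_le_iff)
    with kl show ?thesis by auto
  qed
  have fm: "f \<in> borel_measurable (Pi\<^sub>M {..k} (\<lambda>_. borel))"
    unfolding f_def by (intro borel_measurable_diff score_measurable arch_series_measurable) auto
  have fr: "f (restrict z {..k}) = f z" for z
    unfolding f_def by (simp add: arch_series_restrict)
  have "(\<lambda>z. h c z j) \<in> borel_measurable (Pi\<^sub>M {k<..} (\<lambda>_. borel))" for c j
  proof (cases "j \<le> p")
    case True
    then show ?thesis
      unfolding h_def if_P[OF True] by (intro borel_measurable_sum arch_level_measurable sub) auto
  qed (simp add: h_def)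
  then have gm: "g \<in> borel_measurable (Pi\<^sub>M {k<..} (\<lambda>_. borel))"
    unfolding g_def by (intro borel_measurable_diff score_measurable)
  have "h c (restrict z {k<..}) = h c z" for c z
    unfolding h_def by (auto intro!: sum.cong arch_level_restrict[OF sub])
  then have gr: "g (restrict z {k<..}) = g z" for z unfolding g_def by simp
  have "indep_var borel (\<lambda>\<omega>. f (\<lambda>t. Z t \<omega>)) borel (\<lambda>\<omega>. g (\<lambda>t. Z t \<omega>))"
    by (rule indep_var_path_functions[OF indep _ fm gm fr gr]) auto
  moreover have "(\<lambda>\<omega>. g (\<lambda>t. Z t \<omega>)) = Dtrunc m \<alpha> i c c' l"
    unfolding g_def h_def Dtrunc_def Strunc_def Ytrunc_def
    by (intro ext arg_cong2[where f = "(-)"] score_cong i) auto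
  moreover have "(\<lambda>\<omega>. f (\<lambda>t. Z t \<omega>)) = D \<alpha> i c c' k"
    by (simp add: f_def D_def[abs_def] S_def Y_def)
  ultimately show ?thesis by simp
qed

lemma AE_process_le_G:
  assumes c: "coeff_le p q c k"
  shows "AE \<omega> in M. 1 \<le> G k \<omega> \<and> (\<forall>j\<le>p. (0 \<le> Y c (k - int j) \<omega> \<and> Y c (k - int j) \<omega> \<le> G k \<omega>) \<and>
    (0 \<le> Ytrunc m c (k - int j) \<omega> \<and> Ytrunc m c (k - int j) \<omega> \<le> G k \<omega>) \<and>
    \<bar>Y c (k - int j) \<omega> - Ytrunc m c (k - int j) \<omega>\<bar> \<le> (1 / lam) ^ m * G k \<omega>)"
  using AE_V_le_G AE_Y_bounds[OF c, of m]
proof eventually_elim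
  case (elim \<omega>)
  have lm: "0 \<le> 1 / lam ^ m" using lam by simp
  have "1 / lam ^ m * V (k - int j) \<omega> \<le> (1 / lam) ^ m * G k \<omega>" if "j \<le> p" for j
    unfolding power_one_over using elim(1) that lm by (intro mult_left_mono) blast+
  moreover have "V (k - int j) \<omega> \<le> G k \<omega>" if "j \<le> p" for j using elim(1) that by blast
  moreover note elim(2)
  moreover have "1 \<le> G k \<omega>" using elim(1) by blast
  ultimately show ?case by fastforce
qed

text \<open>One constant bounds size, truncation error and differences of scores for all coefficient
  arrays below q, all times and all truncation levels, so it can be fixed before the sample
  size.\<close>

definition score_constant :: "(nat \<Rightarrow> real) \<Rightarrow> real \<Rightarrow> bool" where
  "score_constant \<alpha> K \<longleftrightarrow> 0 \<le> K \<and>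
     (\<forall>i c k. i \<le> p \<longrightarrow> coeff_le p q c k \<longrightarrow> (AE \<omega> in M. \<bar>S \<alpha> i c k \<omega>\<bar> \<le> K * G k \<omega> ^ 2)) \<and>
     (\<forall>m i c c' k. i \<le> p \<longrightarrow> coeff_le p q c k \<longrightarrow> coeff_le p q c' k \<longrightarrow>
        (AE \<omega> in M. \<bar>Dtrunc m \<alpha> i c c' k \<omega>\<bar> \<le> K * G k \<omega> ^ 2) \<and>
        (AE \<omega> in M. \<bar>D \<alpha> i c c' k \<omega> - Dtrunc m \<alpha> i c c' k \<omega>\<bar> \<le> K * (1 / lam) ^ m * G k \<omega> ^ 2)) \<and>
     (\<forall>\<eta> i c c' k. i \<le> p \<longrightarrow> coeff_le p q c k \<longrightarrow> coeff_le p q c' k \<longrightarrow> 0 \<le> \<eta> \<longrightarrow>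
        (AE \<omega> in M. \<forall>j\<le>p. \<bar>Y c (k - int j) \<omega> - Y c' (k - int j) \<omega>\<bar> \<le> \<eta> * V (k - int j) \<omega>) \<longrightarrow>
        (AE \<omega> in M. \<bar>D \<alpha> i c c' k \<omega>\<bar> \<le> K * \<eta> * G k \<omega> ^ 2))"

lemma score_constantD:
  assumes "score_constant \<alpha> K"
  shows "0 \<le> K"
    "i \<le> p \<Longrightarrow> coeff_le p q c k \<Longrightarrow> AE \<omega> in M. \<bar>S \<alpha> i c k \<omega>\<bar> \<le> K * G k \<omega> ^ 2"
    "i \<le> p \<Longrightarrow> coeff_le p q c k \<Longrightarrow> coeff_le p q c' k \<Longrightarrow>
      AE \<omega> in M. \<bar>Dtrunc m \<alpha> i c c' k \<omega>\<bar> \<le> K * G k \<omega> ^ 2"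
    "i \<le> p \<Longrightarrow> coeff_le p q c k \<Longrightarrow> coeff_le p q c' k \<Longrightarrow>
      AE \<omega> in M. \<bar>D \<alpha> i c c' k \<omega> - Dtrunc m \<alpha> i c c' k \<omega>\<bar> \<le> K * (1 / lam) ^ m * G k \<omega> ^ 2"
    "i \<le> p \<Longrightarrow> coeff_le p q c k \<Longrightarrow> coeff_le p q c' k \<Longrightarrow> 0 \<le> \<eta> \<Longrightarrow>
      AE \<omega> in M. \<forall>j\<le>p. \<bar>Y c (k - int j) \<omega> - Y c' (k - int j) \<omega>\<bar> \<le> \<eta> * V (k - int j) \<omega> \<Longrightarrow>
      AE \<omega> in M. \<bar>D \<alpha> i c c' k \<omega>\<bar> \<le> K * \<eta> * G k \<omega> ^ 2"
  using assms unfolding score_constant_def by blast+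

lemma score_difference_bounds:
  assumes r: "0 < r" and \<alpha>: "\<And>j. j \<le> p \<Longrightarrow> r \<le> \<alpha> j"
  obtains K where "score_constant \<alpha> K"
proof -
  define K1 where "K1 = 1 / r * (1 + 1 / r)"
  have K1: "0 \<le> K1" using r by (simp add: K1_def)
  obtain K2 where K2: "0 \<le> K2"
    "\<And>y y' i \<eta> G. \<lbrakk>\<And>j. j \<le> p \<Longrightarrow> 0 \<le> y j \<and> y j \<le> G; \<And>j. j \<le> p \<Longrightarrow> 0 \<le> y' j \<and> y' j \<le> G;
       \<And>j. j \<le> p \<Longrightarrow> \<bar>y j - y' j\<bar> \<le> \<eta> * G; i \<le> p; 1 \<le> G; 0 \<le> \<eta>\<rbrakk>
     \<Longrightarrow> \<bar>score p \<alpha> i y - score p \<alpha> i y'\<bar> \<le> K2 * \<eta> * G\<^sup>2"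
    using score_lipschitz[where p = p and \<alpha> = \<alpha> and r = r, OF r \<alpha>] by blast
  define K where "K = 2 * K1 + 2 * K2"
  have K: "0 \<le> K" "K1 \<le> K" "2 * K1 \<le> K" "2 * K2 \<le> K" "K2 \<le> K" using K1 K2(1) by (auto simp: K_def)
  have sq: "x * G k \<omega> \<le> x * G k \<omega> ^ 2" if "0 \<le> x" "1 \<le> G k \<omega>" for x k \<omega>
    using that by (intro mult_left_mono self_le_power) auto
  have KG: "x * G k \<omega> ^ 2 \<le> y * G k \<omega> ^ 2" if "x \<le> y" for x y k \<omega>
    using that by (intro mult_right_mono) auto
  have sb: "\<bar>score p \<alpha> i y\<bar> \<le> K1 * G k \<omega> ^ 2"
    if "\<And>j. j \<le> p \<Longrightarrow> 0 \<le> y j \<and> y j \<le> G k \<omega>" "i \<le> p" "1 \<le> G k \<omega>" for i y k \<omega>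
    using order_trans[OF score_bounded[where p = p and \<alpha> = \<alpha> and r = r, OF r \<alpha> that] sq] K1 that(3)
    by (simp add: K1_def)
  have "score_constant \<alpha> K"
    unfolding score_constant_def
  proof (intro conjI allI impI)
    show "0 \<le> K" by (rule K)
  next
    fix i c k assume i: "i \<le> p" and c: "coeff_le p q c k"
    show "AE \<omega> in M. \<bar>S \<alpha> i c k \<omega>\<bar> \<le> K * G k \<omega> ^ 2"
      using AE_process_le_G[OF c, of 0]
    proof eventually_elim
      case (elim \<omega>)
      have "\<bar>S \<alpha> i c k \<omega>\<bar> \<le> K1 * G k \<omega> ^ 2"
        unfolding S_def by (rule sb[OF _ i]) (use elim in blast)+
      with KG[OF K(2)] show ?case by (rule order_trans[rotated])
    qed
  next
    fix m i c c' k assume i: "i \<le> p" and c: "coeff_le p q c k" "coeff_le p q c' k"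
    show "AE \<omega> in M. \<bar>Dtrunc m \<alpha> i c c' k \<omega>\<bar> \<le> K * G k \<omega> ^ 2"
      using AE_process_le_G[OF c(1), of m] AE_process_le_G[OF c(2), of m]
    proof eventually_elim
      case (elim \<omega>)
      have "\<bar>Strunc m \<alpha> i c k \<omega>\<bar> \<le> K1 * G k \<omega> ^ 2"
        unfolding Strunc_def by (rule sb[OF _ i]) (use elim(1) in blast)+
      moreover have "\<bar>Strunc m \<alpha> i c' k \<omega>\<bar> \<le> K1 * G k \<omega> ^ 2"
        unfolding Strunc_def by (rule sb[OF _ i]) (use elim(2) in blast)+
      ultimately have "\<bar>Dtrunc m \<alpha> i c c' k \<omega>\<bar> \<le> 2 * K1 * G k \<omega> ^ 2" unfolding Dtrunc_def by linarith
      with KG[OF K(3)] show ?case by (rule order_trans[rotated])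
    qed
    have trunc: "AE \<omega> in M. \<bar>S \<alpha> i c k \<omega> - Strunc m \<alpha> i c k \<omega>\<bar> \<le> K2 * (1 / lam) ^ m * G k \<omega> ^ 2"
      if "coeff_le p q c k" for c
      using AE_process_le_G[OF that, of m]
    proof eventually_elim
      case (elim \<omega>)
      show ?case unfolding S_def Strunc_def
        by (rule K2(2)) (use elim i lam in \<open>auto simp del: power_one_over\<close>)
    qed
    show "AE \<omega> in M. \<bar>D \<alpha> i c c' k \<omega> - Dtrunc m \<alpha> i c c' k \<omega>\<bar> \<le> K * (1 / lam) ^ m * G k \<omega> ^ 2"
      using trunc[OF c(1)] trunc[OF c(2)]
    proof eventually_elim
      case (elim \<omega>)
      then have "\<bar>D \<alpha> i c c' k \<omega> - Dtrunc m \<alpha> i c c' k \<omega>\<bar> \<le> 2 * K2 * (1 / lam) ^ m * G k \<omega> ^ 2"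
        unfolding D_def Dtrunc_def by linarith
      also have "\<dots> \<le> K * (1 / lam) ^ m * G k \<omega> ^ 2"
        using K(4) lam by (intro mult_right_mono) auto
      finally show ?case .
    qed
  next
    fix \<eta> i c c' k assume i: "i \<le> p" and c: "coeff_le p q c k" "coeff_le p q c' k" and \<eta>: "0 \<le> \<eta>"
      and d: "AE \<omega> in M. \<forall>j\<le>p. \<bar>Y c (k - int j) \<omega> - Y c' (k - int j) \<omega>\<bar> \<le> \<eta> * V (k - int j) \<omega>"
    show "AE \<omega> in M. \<bar>D \<alpha> i c c' k \<omega>\<bar> \<le> K * \<eta> * G k \<omega> ^ 2"
      using AE_V_le_G AE_process_le_G[OF c(1), of 0] AE_process_le_G[OF c(2), of 0] d
    proof eventually_elim
      case (elim \<omega>)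
      have "\<bar>D \<alpha> i c c' k \<omega>\<bar> \<le> K2 * \<eta> * G k \<omega> ^ 2"
        unfolding D_def S_def
      proof (rule K2(2)[OF _ _ _ i _ \<eta>])
        fix j assume j: "j \<le> p"
        show "0 \<le> Y c (k - int j) \<omega> \<and> Y c (k - int j) \<omega> \<le> G k \<omega>" using elim(2) j by blast
        show "0 \<le> Y c' (k - int j) \<omega> \<and> Y c' (k - int j) \<omega> \<le> G k \<omega>" using elim(3) j by blast
        have "V (k - int j) \<omega> \<le> G k \<omega>" using elim(1) j by blast
        then have "\<eta> * V (k - int j) \<omega> \<le> \<eta> * G k \<omega>" by (rule mult_left_mono[OF _ \<eta>])
        moreover have "\<bar>Y c (k - int j) \<omega> - Y c' (k - int j) \<omega>\<bar> \<le> \<eta> * V (k - int j) \<omega>"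
          using elim(4) j by blast
        ultimately show "\<bar>Y c (k - int j) \<omega> - Y c' (k - int j) \<omega>\<bar> \<le> \<eta> * G k \<omega>" by linarith
      qed (use elim(1) in blast)
      also have "\<dots> \<le> K * \<eta> * G k \<omega> ^ 2"
        using K(5) \<eta> by (intro mult_right_mono) auto
      finally show ?case .
    qed
  qed
  then show thesis by (rule that)
qed

text \<open>The earlier of the two differences contributes its size \<open>\<eta>\<close>; the later one is replaced by a
  truncation that is independent of the earlier one, at a cost that is geometric in the time
  distance.\<close>

definition cov_constant :: "(nat \<Rightarrow> real) \<Rightarrow> real \<Rightarrow> bool" where
  "cov_constant \<alpha> K \<longleftrightarrow> 0 \<le> K \<and>
     (\<forall>\<eta> i c c' k l. i \<le> p \<longrightarrow> coeff_le p q c l \<longrightarrow> coeff_le p q c' l \<longrightarrow> k \<le> l \<longrightarrow> 0 \<le> \<eta> \<longrightarrow> \<eta> \<le> 1 \<longrightarrow>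
      (AE \<omega> in M. \<forall>j\<le>p. \<bar>Y c (k - int j) \<omega> - Y c' (k - int j) \<omega>\<bar> \<le> \<eta> * V (k - int j) \<omega>) \<longrightarrow>
      \<bar>cov (D \<alpha> i c c' k) (D \<alpha> i c c' l)\<bar> \<le> K * \<eta> * (1 / lam) ^ ((nat (l - k) - 1) div p))"

lemma score_difference_covariance:
  assumes r: "0 < r" and \<alpha>: "\<And>j. j \<le> p \<Longrightarrow> r \<le> \<alpha> j"
  obtains K where "cov_constant \<alpha> K"
proof -
  obtain K where "score_constant \<alpha> K" using score_difference_bounds[where \<alpha> = \<alpha> and r = r, OF r \<alpha>] by blast
  note K = score_constantD[OF this]
  have "cov_constant \<alpha> (K * K * (EG + EG\<^sup>2))"
    unfolding cov_constant_def
  proof (intro conjI allI impI)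
    show "0 \<le> K * K * (EG + EG\<^sup>2)" using K(1) EG_nonneg by simp
  next
    fix \<eta> i c c' k l
    assume i: "i \<le> p" and c: "coeff_le p q c l" "coeff_le p q c' l" and kl: "k \<le> l" and \<eta>: "0 \<le> \<eta>" "\<eta> \<le> 1"
      and d: "AE \<omega> in M. \<forall>j\<le>p. \<bar>Y c (k - int j) \<omega> - Y c' (k - int j) \<omega>\<bar> \<le> \<eta> * V (k - int j) \<omega>"
    \<comment> \<open>The largest m with k + m * p < l when k < l; for k = l truncated subtraction
      makes it 0.\<close>
    define m where "m = (nat (l - k) - 1) div p"
    note ck = coeff_le_mono[OF c(1) kl] coeff_le_mono[OF c(2) kl]
    have A: "AE \<omega> in M. \<bar>D \<alpha> i c c' k \<omega>\<bar> \<le> (K * \<eta>) * G k \<omega> ^ 2" by (rule K(5)[OF i ck \<eta>(1) d])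
    have "\<bar>cov (D \<alpha> i c c' k) (D \<alpha> i c c' l)\<bar>
      \<le> (K * \<eta>) * (K * (1 / lam) ^ m) * (EG + EG\<^sup>2)"
    proof (cases "k = l")
      case True
      \<comment> \<open>On the diagonal independence cannot help, but both factors are of size
        \<eta>, and \<eta> \<le> 1 lets one of them be replaced by a constant.\<close>
      have 1: "\<bar>expectation (\<lambda>\<omega>. D \<alpha> i c c' k \<omega> * D \<alpha> i c c' k \<omega>)\<bar> \<le> (K * \<eta>) * (K * \<eta>) * EG"
        by (rule product_G_bound(2)[OF _ _ A A]) (use K(1) \<eta> in auto)
      have "\<bar>expectation (D \<alpha> i c c' k)\<bar> \<le> (K * \<eta>) * expectation (\<lambda>\<omega>. G k \<omega> ^ 2)"
        by (rule integrable_G_bound(2)[OF _ A]) auto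
      also have "\<dots> \<le> (K * \<eta>) * EG" using K(1) \<eta> G_moment(2)[of 2 k] by (intro mult_left_mono) auto
      finally have 2: "\<bar>expectation (D \<alpha> i c c' k) * expectation (D \<alpha> i c c' k)\<bar> \<le> ((K * \<eta>) * EG) * ((K * \<eta>) * EG)"
        unfolding abs_mult by (intro mult_mono) auto
      have "\<bar>cov (D \<alpha> i c c' k) (D \<alpha> i c c' k)\<bar>
          \<le> (K * \<eta>) * (K * \<eta>) * EG + ((K * \<eta>) * EG) * ((K * \<eta>) * EG)"
        unfolding cov_def using 1 2 by linarith
      also have "\<dots> = (K * \<eta>) * (K * \<eta>) * (EG + EG\<^sup>2)" by algebra
      also have "\<dots> \<le> (K * \<eta>) * (K * 1) * (EG + EG\<^sup>2)"
        using K(1) \<eta> EG_nonneg by (intro mult_right_mono mult_left_mono) auto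
      finally show ?thesis using True by (simp add: m_def)
    next
      case False
      with kl have pos: "0 < nat (l - k)" by simp
      have "m * p \<le> nat (l - k) - 1" unfolding m_def by (rule div_times_less_eq_dividend)
      with pos have "m * p < nat (l - k)" by linarith
      then have "k + int (m * p) < l" by linarith
      then have ind: "indep_var borel (D \<alpha> i c c' k) borel (Dtrunc m \<alpha> i c c' l)"
        by (rule D_Dtrunc_indep[OF _ i])
      show ?thesis
        by (rule covariance_G_bound[OF _ _ _ A K(3)[OF i c] K(4)[OF i c] _ _ _ ind])
           (use K(1) \<eta> lam in auto)
    qed
    also have "\<dots> = K * K * (EG + EG\<^sup>2) * \<eta> * (1 / lam) ^ m" by (simp only: mult_ac)
    finally show "\<bar>cov (D \<alpha> i c c' k) (D \<alpha> i c c' l)\<bar>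
      \<le> K * K * (EG + EG\<^sup>2) * \<eta> * (1 / lam) ^ ((nat (l - k) - 1) div p)" by (simp only: m_def)
  qed
  then show thesis by (rule that)
qed

end

text \<open>The exponent is constant on blocks of p consecutive integers, so p copies of the
  geometric series bound the sum. The additional 1 is the term d = 0, where the truncated difference
  repeats the exponent of d = 1.\<close>

lemma sum_geometric_div_le:
  fixes x :: real
  assumes "0 \<le> x" "x < 1" "1 \<le> p"
  shows "(\<Sum>d\<le>n. x ^ ((d - 1) div p)) \<le> 1 + real p / (1 - x)"
proof -
  have "(\<Sum>d<n. x ^ (d div p)) \<le> (\<Sum>d<n * p. x ^ (d div p))"
    using assms by (intro sum_mono2) (auto intro: order_less_le_trans)
  also have "\<dots> = (\<Sum>m<n. \<Sum>d\<in>{m * p..<m * p + p}. x ^ (d div p))"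
    by (rule sum.nat_group[symmetric])
  also have "\<dots> = (\<Sum>m<n. real p * x ^ m)"
  proof (rule sum.cong[OF refl])
    fix m
    have "(\<Sum>d\<in>{m * p..<m * p + p}. x ^ (d div p)) = (\<Sum>d\<in>{m * p..<m * p + p}. x ^ m)"
    proof (rule sum.cong[OF refl])
      fix d assume "d \<in> {m * p..<m * p + p}"
      then have "d div p = m" using assms(3) by (intro div_nat_eqI) (auto simp: mult.commute)
      then show "x ^ (d div p) = x ^ m" by simp
    qed
    then show "(\<Sum>d\<in>{m * p..<m * p + p}. x ^ (d div p)) = real p * x ^ m" by simp
  qed
  also have "\<dots> = real p * (\<Sum>m<n. x ^ m)" by (simp add: sum_distrib_left)
  also have "\<dots> \<le> real p * (1 / (1 - x))"
  proof (intro mult_left_mono)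
    have "(\<Sum>m<n. x ^ m) \<le> (\<Sum>m. x ^ m)"
      using assms by (intro sum_le_suminf) (auto intro: summable_geometric)
    then show "(\<Sum>m<n. x ^ m) \<le> 1 / (1 - x)" using assms by (simp add: suminf_geometric)
  qed simp
  finally have "(\<Sum>d<n. x ^ (d div p)) \<le> real p / (1 - x)" by simp
  moreover have "(\<Sum>d\<le>n. x ^ ((d - 1) div p)) \<le> 1 + (\<Sum>d<n. x ^ (d div p))"
    by (cases n) (auto simp: sum.atMost_Suc_shift lessThan_Suc_atMost simp del: sum.atMost_Suc)
  ultimately show ?thesis by linarith
qed

text \<open>For fixed k the distance to l is injective on either side of k, so each side contributes
  at most one full sum of g.\<close>

lemma sum_abs_diff_le:
  fixes g :: "nat \<Rightarrow> real" and I :: "nat set"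
  assumes I: "finite I" and g: "\<And>d. 0 \<le> g d" "\<And>n. (\<Sum>d\<le>n. g d) \<le> B"
  shows "(\<Sum>k\<in>I. \<Sum>l\<in>I. g (if k \<le> l then l - k else k - l)) \<le> real (card I) * (2 * B)"
proof -
  have "(\<Sum>l\<in>I. g (if k \<le> l then l - k else k - l)) \<le> 2 * B" if "k \<in> I" for k
  proof -
    have le: "(\<Sum>l\<in>J. g (f l)) \<le> B" if "finite J" "inj_on f J" for J and f :: "nat \<Rightarrow> nat"
    proof -
      have "finite (f ` J)" using that by simp
      then obtain n where n: "f ` J \<subseteq> {..n}" unfolding finite_nat_iff_bounded_le by blast
      have "(\<Sum>l\<in>J. g (f l)) = sum g (f ` J)" using that by (simp add: sum.reindex)
      also have "\<dots> \<le> sum g {..n}" using n g by (intro sum_mono2) auto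
      finally show ?thesis using g(2)[of n] by simp
    qed
    have "(\<Sum>l\<in>I. g (if k \<le> l then l - k else k - l))
        = (\<Sum>l\<in>{l\<in>I. k \<le> l}. g (l - k)) + (\<Sum>l\<in>{l\<in>I. \<not> k \<le> l}. g (k - l))"
      using I by (simp add: sum.inter_filter if_distrib sum.distrib[symmetric] cong: if_cong)
        (auto intro!: sum.cong)
    also have "\<dots> \<le> B + B" using I by (intro add_mono le) (auto simp: inj_on_def)
    finally show ?thesis by simp
  qed
  then have "(\<Sum>k\<in>I. \<Sum>l\<in>I. g (if k \<le> l then l - k else k - l)) \<le> (\<Sum>k\<in>I. 2 * B)" by (rule sum_mono)
  then show ?thesis by simp
qed

section \<open>Kernel sums\<close>

text \<open>It is applied with v k = k/N - u_0, x k the kernel argument, e the rounding error of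
  t_0/N and d = 1/N. Substituting v = - b * x + e into the quadratic polynomial leaves three
  discrete moments of the kernel; those of orders 0 and 1 enter only with factors of order d.
  Conditions at k are imposed only where the weight is nonzero, that is inside the window.\<close>

lemma kernel_sum_expansion:
  fixes c x v F :: "nat \<Rightarrow> real"
  assumes K: "finite K" and v: "\<And>k. k \<in> K \<Longrightarrow> c k \<noteq> 0 \<Longrightarrow> v k = - b * x k + e"
    and F: "\<And>k. k \<in> K \<Longrightarrow> c k \<noteq> 0 \<Longrightarrow> \<bar>F k - (\<phi>1 * v k + \<phi>2 * ((v k)\<^sup>2 / 2))\<bar> \<le> A * (d + b ^ 3)"
    and s0: "(\<Sum>k\<in>K. \<bar>c k\<bar>) \<le> C" and s1: "b * \<bar>\<Sum>k\<in>K. c k * x k\<bar> \<le> C * d"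
    and s2: "b\<^sup>2 * \<bar>(\<Sum>k\<in>K. c k * (x k)\<^sup>2) - \<kappa>\<bar> \<le> C * d"
    and e: "\<bar>e\<bar> \<le> d" and d: "0 \<le> d" "d \<le> 1" and b: "0 \<le> b"
  shows "\<bar>(\<Sum>k\<in>K. c k * F k) - 1 / 2 * b\<^sup>2 * \<kappa> * \<phi>2\<bar>
    \<le> (\<bar>A\<bar> * C + 2 * \<bar>\<phi>1\<bar> * C + 2 * \<bar>\<phi>2\<bar> * C) * (d + b ^ 3)"
proof -
  let ?T = "\<lambda>k. \<phi>1 * v k + \<phi>2 * ((v k)\<^sup>2 / 2)"
  define X0 where "X0 = (\<Sum>k\<in>K. c k)"
  define X1 where "X1 = (\<Sum>k\<in>K. c k * x k)"
  define X2 where "X2 = (\<Sum>k\<in>K. c k * (x k)\<^sup>2)"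
  have C: "0 \<le> C" using s0 by (rule order_trans[rotated]) (simp add: sum_nonneg)
  have X0: "\<bar>X0\<bar> \<le> C" unfolding X0_def using s0 by (rule order_trans[OF sum_abs])
  have b3: "0 \<le> b ^ 3" using b by simp
  have v1: "(\<Sum>k\<in>K. c k * v k) = e * X0 - b * X1"
  proof -
    have "c k * v k = e * c k - b * (c k * x k)" if "k \<in> K" for k
    proof (cases "c k = 0")
      case False
      then show ?thesis unfolding v[OF that False] by algebra
    qed simp
    then have "(\<Sum>k\<in>K. c k * v k) = (\<Sum>k\<in>K. e * c k - b * (c k * x k))" by (rule sum.cong[OF refl])
    then show ?thesis by (simp add: X0_def X1_def sum_subtractf sum_distrib_left)
  qed
  have v2: "(\<Sum>k\<in>K. c k * (v k)\<^sup>2) = b\<^sup>2 * X2 - 2 * e * (b * X1) + e\<^sup>2 * X0"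
  proof -
    have "c k * (v k)\<^sup>2 = b\<^sup>2 * (c k * (x k)\<^sup>2) - 2 * e * (b * (c k * x k)) + e\<^sup>2 * c k" if "k \<in> K" for k
    proof (cases "c k = 0")
      case False
      then show ?thesis unfolding v[OF that False] by algebra
    qed simp
    then have "(\<Sum>k\<in>K. c k * (v k)\<^sup>2)
        = (\<Sum>k\<in>K. b\<^sup>2 * (c k * (x k)\<^sup>2) - 2 * e * (b * (c k * x k)) + e\<^sup>2 * c k)" by (rule sum.cong[OF refl])
    then show ?thesis by (simp add: X0_def X1_def X2_def sum.distrib sum_subtractf sum_distrib_left)
  qed
  have T: "(\<Sum>k\<in>K. c k * ?T k) = \<phi>1 * (\<Sum>k\<in>K. c k * v k) + \<phi>2 / 2 * (\<Sum>k\<in>K. c k * (v k)\<^sup>2)"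
    by (simp add: sum.distrib sum_distrib_left distrib_left mult_ac)
  have r: "\<bar>(\<Sum>k\<in>K. c k * F k) - (\<Sum>k\<in>K. c k * ?T k)\<bar> \<le> \<bar>A\<bar> * C * (d + b ^ 3)"
  proof -
    have "\<bar>(\<Sum>k\<in>K. c k * F k) - (\<Sum>k\<in>K. c k * ?T k)\<bar> = \<bar>\<Sum>k\<in>K. c k * (F k - ?T k)\<bar>"
      by (simp add: sum_subtractf right_diff_distrib)
    also have "\<dots> \<le> (\<Sum>k\<in>K. \<bar>c k * (F k - ?T k)\<bar>)" by (rule sum_abs)
    also have "\<dots> \<le> (\<Sum>k\<in>K. \<bar>c k\<bar> * (\<bar>A\<bar> * (d + b ^ 3)))"
    proof (rule sum_mono)
      fix k assume k: "k \<in> K"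
      show "\<bar>c k * (F k - ?T k)\<bar> \<le> \<bar>c k\<bar> * (\<bar>A\<bar> * (d + b ^ 3))"
      proof (cases "c k = 0")
        case False
        have "A * (d + b ^ 3) \<le> \<bar>A\<bar> * (d + b ^ 3)" using d b3 by (intro mult_right_mono) auto
        with F[OF k False] have "\<bar>F k - ?T k\<bar> \<le> \<bar>A\<bar> * (d + b ^ 3)" by (rule order_trans)
        then show ?thesis unfolding abs_mult by (rule mult_left_mono) simp
      qed simp
    qed
    also have "\<dots> = (\<Sum>k\<in>K. \<bar>c k\<bar>) * (\<bar>A\<bar> * (d + b ^ 3))" by (simp add: sum_distrib_right)
    also have "\<dots> \<le> C * (\<bar>A\<bar> * (d + b ^ 3))" using s0 d b3 by (intro mult_right_mono) auto
    finally show ?thesis by (simp add: mult_ac)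
  qed
  have bX1: "\<bar>b * X1\<bar> \<le> C * d" using s1 b by (simp add: X1_def abs_mult)
  have eX0: "\<bar>e * X0\<bar> \<le> d * C" unfolding abs_mult using e X0 d by (intro mult_mono) auto
  have "\<bar>e * X0 - b * X1\<bar> \<le> 2 * C * d" using bX1 eX0 by (simp add: abs_le_iff algebra_simps)
  then have 1: "\<bar>\<phi>1 * (\<Sum>k\<in>K. c k * v k)\<bar> \<le> \<bar>\<phi>1\<bar> * (2 * C * d)"
    unfolding v1 abs_mult[of \<phi>1] by (rule mult_left_mono) simp
  have bX2: "\<bar>b\<^sup>2 * (X2 - \<kappa>)\<bar> \<le> C * d" using s2 by (simp add: X2_def abs_mult)
  have "\<bar>2 * e * (b * X1)\<bar> \<le> 2 * 1 * (C * d)"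
    unfolding abs_mult[of "2 * e"] using bX1 e d by (intro mult_mono) (auto simp: abs_mult)
  moreover have "\<bar>e\<^sup>2 * X0\<bar> \<le> d * C"
  proof -
    have "\<bar>e\<bar> * \<bar>e\<bar> \<le> d * d" using e by (intro mult_mono) auto
    then have "e\<^sup>2 \<le> d * d" by (simp add: power2_eq_square)
    also have "\<dots> \<le> d" using d by (simp add: mult_left_le)
    finally show ?thesis unfolding abs_mult using X0 d by (intro mult_mono) auto
  qed
  moreover have "\<bar>b\<^sup>2 * X2 - b\<^sup>2 * \<kappa>\<bar> \<le> C * d" using bX2 by (simp add: right_diff_distrib)
  moreover have "\<bar>w - y + z - w'\<bar> \<le> 4 * u"
    if "\<bar>y\<bar> \<le> 2 * 1 * u" "\<bar>z\<bar> \<le> u" "\<bar>w - w'\<bar> \<le> u" for u w w' y z :: real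
    using that by linarith
  ultimately have "\<bar>(\<Sum>k\<in>K. c k * (v k)\<^sup>2) - b\<^sup>2 * \<kappa>\<bar> \<le> 4 * (C * d)"
    unfolding v2 by (simp only: mult.commute[of d C])
  then have "\<bar>(\<Sum>k\<in>K. c k * (v k)\<^sup>2) - b\<^sup>2 * \<kappa>\<bar> \<le> 4 * C * d" by (simp only: mult.assoc)
  then have 2: "\<bar>\<phi>2 / 2 * ((\<Sum>k\<in>K. c k * (v k)\<^sup>2) - b\<^sup>2 * \<kappa>)\<bar> \<le> \<bar>\<phi>2 / 2\<bar> * (4 * C * d)"
    unfolding abs_mult[of "\<phi>2 / 2"] by (rule mult_left_mono) simp
  have "(\<Sum>k\<in>K. c k * F k) - 1 / 2 * b\<^sup>2 * \<kappa> * \<phi>2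
      = ((\<Sum>k\<in>K. c k * F k) - (\<Sum>k\<in>K. c k * ?T k)) + \<phi>1 * (\<Sum>k\<in>K. c k * v k)
        + \<phi>2 / 2 * ((\<Sum>k\<in>K. c k * (v k)\<^sup>2) - b\<^sup>2 * \<kappa>)"
    unfolding T by (simp add: algebra_simps)
  also have "\<bar>\<dots>\<bar> \<le> \<bar>A\<bar> * C * (d + b ^ 3) + \<bar>\<phi>1\<bar> * (2 * C * d) + \<bar>\<phi>2 / 2\<bar> * (4 * C * d)"
    using r 1 2 by linarith
  also have "\<dots> = \<bar>A\<bar> * C * (d + b ^ 3) + (2 * \<bar>\<phi>1\<bar> * C + 2 * \<bar>\<phi>2\<bar> * C) * d"
    by (simp add: algebra_simps)
  also have "\<dots> \<le> \<bar>A\<bar> * C * (d + b ^ 3) + (2 * \<bar>\<phi>1\<bar> * C + 2 * \<bar>\<phi>2\<bar> * C) * (d + b ^ 3)"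
    using C b3 by (intro add_left_mono mult_left_mono) auto
  finally show ?thesis by (simp add: distrib_right)
qed

lemma card_nat_window_le:
  fixes I :: "nat set" and m h :: real
  assumes "\<And>k. k \<in> I \<Longrightarrow> \<bar>m - real k\<bar> \<le> h / 2" "finite I" "0 \<le> h"
  shows "real (card I) \<le> h + 1"
proof (cases "I = {}")
  case False
  have "I \<subseteq> {Min I..Max I}" using assms(2) by auto
  then have "card I \<le> card {Min I..Max I}" by (intro card_mono) auto
  also have "\<dots> = Suc (Max I) - Min I" by simp
  finally have "real (card I) \<le> real (Suc (Max I) - Min I)" by simp
  moreover have "Min I \<le> Max I" "Min I \<in> I" "Max I \<in> I" using assms(2) False by auto
  moreover have "\<bar>m - real (Min I)\<bar> \<le> h / 2" "\<bar>m - real (Max I)\<bar> \<le> h / 2"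
    using assms(1) \<open>Min I \<in> I\<close> \<open>Max I \<in> I\<close> by auto
  moreover have "real (Suc (Max I) - Min I) = real (Max I) + 1 - real (Min I)"
    using \<open>Min I \<le> Max I\<close> by (simp add: of_nat_diff)
  ultimately show ?thesis unfolding abs_le_iff by linarith
qed (use assms in auto)

lemma kernel_sums:
  assumes bv: "bounded_variation_on W {-1/2..1/2}" and zero: "\<forall>x. x \<notin> {-1/2..1/2} \<longrightarrow> W x = 0"
    and int: "W integrable_on {-1/2..1/2}"
  obtains C where "0 \<le> C" "\<And>x. \<bar>W x\<bar> \<le> C"
    "\<And>h m N p r. 0 < h \<Longrightarrow> (m - real N) / h \<le> -1/2 \<Longrightarrow> 1/2 \<le> (m - real p) / h \<Longrightarrow> p \<le> N \<Longrightarrow> r \<le> 2 \<Longrightarrow>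
      \<bar>(\<Sum>k=p+1..N. 1 / h * W ((m - real k) / h) * ((m - real k) / h) ^ r) - kernel_moment W r\<bar> \<le> C / h"
proof -
  have z: "W x = 0" if "x \<notin> {-1/2..1/2}" for x using zero that by blast
  have bvr: "bounded_variation_on (\<lambda>x. W x * x ^ r) UNIV" for r
    by (rule bounded_variation_on_zero_outside[OF bv _ z]) auto
  have "\<exists>V. 0 \<le> V \<and> (\<forall>n (x :: nat \<Rightarrow> real). (\<forall>i<n. x i \<le> x (Suc i)) \<longrightarrow>
      (\<Sum>i<n. \<bar>W (x (Suc i)) * x (Suc i) ^ r - W (x i) * x i ^ r\<bar>) \<le> V)" for r
    by (rule bounded_variation_onE[OF bvr[of r]]) auto
  then have "\<forall>r. \<exists>V. 0 \<le> V \<and> (\<forall>n (x :: nat \<Rightarrow> real). (\<forall>i<n. x i \<le> x (Suc i)) \<longrightarrow>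
      (\<Sum>i<n. \<bar>W (x (Suc i)) * x (Suc i) ^ r - W (x i) * x i ^ r\<bar>) \<le> V)" by blast
  then obtain V where "\<forall>r. 0 \<le> V r \<and> (\<forall>n (x :: nat \<Rightarrow> real). (\<forall>i<n. x i \<le> x (Suc i)) \<longrightarrow>
      (\<Sum>i<n. \<bar>W (x (Suc i)) * x (Suc i) ^ r - W (x i) * x i ^ r\<bar>) \<le> V r)"
    unfolding choice_iff by blast
  then have V: "\<And>r. 0 \<le> V r"
    "\<And>r n (x :: nat \<Rightarrow> real). (\<forall>i<n. x i \<le> x (Suc i)) \<longrightarrow>
      (\<Sum>i<n. \<bar>W (x (Suc i)) * x (Suc i) ^ r - W (x i) * x i ^ r\<bar>) \<le> V r" by blast+
  obtain B where B: "0 \<le> B" "\<And>x. \<bar>W x\<bar> \<le> B"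
    using bounded_variation_on_bounded[of W] bvr[of 0] by auto
  \<comment> \<open>A single constant for the sup norm of W and for the total variations of W, W x
    and W x ^ 2 on the line.\<close>
  define C where "C = B + (\<Sum>r\<le>2. V r)"
  show thesis
  proof (rule that[of C])
    show "0 \<le> C" unfolding C_def using B(1) V(1) by (intro add_nonneg_nonneg sum_nonneg) auto
    have "0 \<le> (\<Sum>r\<le>2. V r)" using V(1) by (intro sum_nonneg) auto
    then show "\<bar>W x\<bar> \<le> C" for x using B(2)[of x] by (simp add: C_def)
  next
    fix h m :: real and N p r :: nat
    assume h: "0 < h" and cover: "(m - real N) / h \<le> -1/2" "1/2 \<le> (m - real p) / h" and "p \<le> N" "r \<le> 2"
    have "V r \<le> (\<Sum>r\<le>2. V r)" using \<open>r \<le> 2\<close> V(1) by (intro member_le_sum) auto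
    then have VC: "V r \<le> C" using B(1) by (simp add: C_def)
    have "\<bar>(\<Sum>k=p+1..N. 1 / h * (W ((m - real k) / h) * ((m - real k) / h) ^ r))
        - integral {-1/2..1/2} (\<lambda>x. W x * x ^ r)\<bar> \<le> V r / h"
    proof (rule riemann_sum_bounded_variation[OF _ _ _ h cover \<open>p \<le> N\<close>])
      show "(\<lambda>x. W x * x ^ r) integrable_on {-1/2..1/2}"
        by (rule kernel_power_integrable[OF bv _ z int]) auto
    qed (use V(2) z in auto)
    also have "\<dots> \<le> C / h" using VC h by (simp add: divide_right_mono)
    finally show "\<bar>(\<Sum>k=p+1..N. 1 / h * W ((m - real k) / h) * ((m - real k) / h) ^ r) - kernel_moment W r\<bar> \<le> C / h"
      by (simp add: kernel_moment_def mult.assoc)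
  qed
qed

section \<open>The time-varying process\<close>

text \<open>The parameter \<alpha> is fixed independently of u, since the gradient is taken at a
  fixed point and only then differentiated in u. The margin 2 * r lets each coordinate vary while
  staying above r.\<close>

locale tvarch = arch_noise M Z p q lam E
  for M :: "'a measure" and Z :: "int \<Rightarrow> 'a \<Rightarrow> real" and p :: nat and q :: "nat \<Rightarrow> real" and lam E :: real +
  fixes a :: "nat \<Rightarrow> real \<Rightarrow> real" and L B r :: real and \<alpha> :: "nat \<Rightarrow> real"
    and X :: "nat \<Rightarrow> int \<Rightarrow> 'a \<Rightarrow> real" and Xs :: "real \<Rightarrow> int \<Rightarrow> 'a \<Rightarrow> real"
  assumes a_range: "\<And>j u. j \<le> p \<Longrightarrow> u \<in> {0..1} \<Longrightarrow> 0 \<le> a j u \<and> a j u \<le> q j"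
    and a_lip: "\<And>j u v. j \<le> p \<Longrightarrow> u \<in> {0..1} \<Longrightarrow> v \<in> {0..1} \<Longrightarrow> \<bar>a j u - a j v\<bar> \<le> q j * (L * \<bar>u - v\<bar>)"
    and L: "0 \<le> L"
    and a_jet: "\<And>j. j \<le> p \<Longrightarrow> jet {0<..<1} (a j) (q j) B" and B: "0 \<le> B"
    and r: "0 < r" and \<alpha>: "\<And>j. j \<le> p \<Longrightarrow> 2 * r \<le> \<alpha> j"
    and X: "\<And>N. 1 \<le> N \<Longrightarrow> tvarch_process M p a Z N (X N)"
    and Xs: "\<And>u. u \<in> {0<..1} \<Longrightarrow> stationary_arch_process M p a Z u (Xs u)"
begin

abbreviation tv :: "nat \<Rightarrow> nat \<Rightarrow> int \<Rightarrow> real" where "tv N \<equiv> tv_coeff p a N"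
abbreviation st :: "real \<Rightarrow> nat \<Rightarrow> int \<Rightarrow> real" where "st u \<equiv> stat_coeff p a u"

lemma \<alpha>_r: "j \<le> p \<Longrightarrow> r \<le> \<alpha> j"
  using \<alpha>[of j] r by simp

lemma tv_le: "1 \<le> N \<Longrightarrow> coeff_le p q (tv N) (int N)"
  unfolding coeff_le_def tv_coeff_def using a_range q by auto

lemma tv_le': "1 \<le> N \<Longrightarrow> t \<le> int N \<Longrightarrow> coeff_le p q (tv N) t"
  by (rule coeff_le_mono[OF tv_le])

lemma st_le: "u \<in> {0..1} \<Longrightarrow> coeff_le p q (st u) t"
  unfolding coeff_le_def stat_coeff_def using a_range by auto

text \<open>The causal expansion identifies the squares with explicit functions of the noise,
  simultaneously for all times up to N; from here on the series takes the place of the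
  process.\<close>

lemma X_eq:
  assumes "1 \<le> N"
  shows "AE \<omega> in M. \<forall>t\<le>int N. (X N t \<omega>)\<^sup>2 = Y (tv N) t \<omega>"
proof -
  have "AE \<omega> in M. t \<le> int N \<longrightarrow> (X N t \<omega>)\<^sup>2 = Y (tv N) t \<omega>" for t
  proof (cases "t \<le> int N")
    case True
    then have "AE \<omega> in M. (arch_term (tv N) (\<lambda>s. Z s \<omega>) t has_sum (X N t \<omega>)\<^sup>2) {js. \<forall>j\<in>set js. 1 \<le> j}"
      using X[OF assms] by (auto simp: tvarch_process_def causal_arch_square_def)
    then show ?thesis
    proof eventually_elim
      case (elim \<omega>)
      then have "(\<lambda>n. arch_level p (tv N) (\<lambda>s. Z s \<omega>) n t) sums (X N t \<omega>)\<^sup>2"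
        by (rule arch_level_sums) (simp add: tv_coeff_def)
      then show ?case by (simp add: Y_def arch_series_def sums_iff)
    qed
  qed simp
  then have "AE \<omega> in M. \<forall>t. t \<le> int N \<longrightarrow> (X N t \<omega>)\<^sup>2 = Y (tv N) t \<omega>" by (subst AE_all_countable) blast
  then show ?thesis by simp
qed

lemma Xs_eq:
  assumes "u \<in> {0<..1}"
  shows "AE \<omega> in M. \<forall>t. (Xs u t \<omega>)\<^sup>2 = Y (st u) t \<omega>"
proof (subst AE_all_countable, rule allI)
  fix t
  have "AE \<omega> in M. (arch_term (st u) (\<lambda>s. Z s \<omega>) t has_sum (Xs u t \<omega>)\<^sup>2) {js. \<forall>j\<in>set js. 1 \<le> j}"
    using Xs[OF assms] by (auto simp: stationary_arch_process_def causal_arch_square_def)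
  then show "AE \<omega> in M. (Xs u t \<omega>)\<^sup>2 = Y (st u) t \<omega>"
  proof eventually_elim
    case (elim \<omega>)
    then have "(\<lambda>n. arch_level p (st u) (\<lambda>s. Z s \<omega>) n t) sums (Xs u t \<omega>)\<^sup>2"
      by (rule arch_level_sums) (simp add: stat_coeff_def)
    then show ?case by (simp add: Y_def arch_series_def sums_iff)
  qed
qed

lemma X_measurable: "1 \<le> N \<Longrightarrow> t \<le> int N \<Longrightarrow> X N t \<in> borel_measurable M"
  using X[of N] by (auto simp: tvarch_process_def)

lemma Xs_measurable: "u \<in> {0<..1} \<Longrightarrow> Xs u t \<in> borel_measurable M"
  using Xs[of u] by (auto simp: stationary_arch_process_def)

lemma Y_difference:
  assumes \<tau>: "0 < \<tau>"
  obtains K where "0 \<le> K"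
    "\<And>N (u :: real) t. 1 \<le> N \<Longrightarrow> u \<in> {0..1} \<Longrightarrow> t \<le> int N \<Longrightarrow> \<tau> * real N \<le> real_of_int t \<Longrightarrow>
      AE \<omega> in M. \<bar>Y (tv N) t \<omega> - Y (st u) t \<omega>\<bar> \<le> K * (\<bar>real_of_int t / real N - u\<bar> + 1 / real N) * V t \<omega>"
proof -
  obtain \<kappa> where \<kappa>: "0 \<le> \<kappa>" "\<And>n. real (Suc n) ^ 3 / lam ^ n \<le> \<kappa>" using cube_le_power[OF lam] by blast
  show thesis
  proof (rule that[of "(L + 1 / \<tau>) * real p * \<kappa>"])
    show "0 \<le> (L + 1 / \<tau>) * real p * \<kappa>" using L \<tau> \<kappa>(1) by simp
  next
    fix N t and u :: real assume N: "1 \<le> N" and u: "u \<in> {0..1}" and t: "t \<le> int N" "\<tau> * real N \<le> real_of_int t"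
    show "AE \<omega> in M. \<bar>Y (tv N) t \<omega> - Y (st u) t \<omega>\<bar>
        \<le> (L + 1 / \<tau>) * real p * \<kappa> * (\<bar>real_of_int t / real N - u\<bar> + 1 / real N) * V t \<omega>"
      using AE_summable
    proof eventually_elim
      case (elim \<omega>)
      show ?case
        unfolding Y_def V_def
      proof (rule arch_series_diff_le[OF lam q spec[OF elim] tv_le'[OF N t(1)] st_le[OF u] p _ \<tau> t(2) L _ \<kappa>(2)])
        fix j s assume j: "j \<le> p" and s: "0 \<le> s" "s \<le> t"
        have "real_of_int s / real N \<in> {0..1}" using s t(1) N by (auto simp: divide_le_eq)
        then show "\<bar>tv N j s - st u j s\<bar> \<le> q j * (L * \<bar>real_of_int s / real N - u\<bar>)"
          using a_lip[OF j _ u] j s by (simp add: tv_coeff_def stat_coeff_def)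
      qed (use N in simp)
    qed
  qed
qed

text \<open>By \<open>limit_L_has_partial_deriv\<close> this is component i of the gradient of the
  limiting likelihood at \<alpha>, as a function of u.\<close>

definition \<phi> :: "nat \<Rightarrow> real \<Rightarrow> real" where
  "\<phi> i u = expectation (S \<alpha> i (st u) 0)"

lemma \<phi>_taylor:
  assumes i: "i \<le> p"
  obtains \<phi>' \<phi>'' K where
    "\<And>u. u \<in> {0<..<1} \<Longrightarrow> (\<phi> i has_real_derivative \<phi>' u) (at u)"
    "\<And>u. u \<in> {0<..<1} \<Longrightarrow> (\<phi>' has_real_derivative \<phi>'' u) (at u)"
    "\<And>u v. u \<in> {0<..<1} \<Longrightarrow> v \<in> {0<..<1} \<Longrightarrow>
       \<bar>\<phi> i v - \<phi> i u - \<phi>' u * (v - u) - \<phi>'' u * ((v - u)\<^sup>2 / 2)\<bar> \<le> K * \<bar>v - u\<bar> ^ 3"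
proof -
  obtain \<kappa> where \<kappa>: "0 \<le> \<kappa>" "\<And>n. real (Suc n) ^ 3 / lam ^ n \<le> \<kappa>" using cube_le_power[OF lam] by blast
  obtain K where K: "0 \<le> K"
    "\<And>S y i G. \<lbrakk>\<And>j. j \<le> p \<Longrightarrow> jet S (y j) (\<kappa> * G) B; \<And>j u. j \<le> p \<Longrightarrow> u \<in> S \<Longrightarrow> 0 \<le> y j u;
       i \<le> p; 1 \<le> G\<rbrakk> \<Longrightarrow> jet S (\<lambda>u. score p \<alpha> i (\<lambda>j. y j u)) (K * G ^ 5) 1"
    using jet_score[where p = p and \<alpha> = \<alpha> and r = r and \<kappa> = \<kappa> and B = B, OF r \<alpha>_r \<kappa>(1) B] by blast
  \<comment> \<open>Each path of the score is smooth in u with amplitude of order G ^ 5, which the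
    sixth moment of G makes integrable.\<close>
  have "AE \<omega> in M. jet {0<..<1} (\<lambda>u. S \<alpha> i (st u) 0 \<omega>) (K * G 0 \<omega> ^ 5) 1"
    using AE_summable AE_V_le_G
  proof eventually_elim
    case (elim \<omega>)
    have s: "summable (\<lambda>n. arch_level p (dom_coeff lam q) (\<lambda>s. Z s \<omega>) n t)" for t using elim(1) by blast
    show ?case
      unfolding S_def
    proof (rule K(2)[OF _ _ i])
      show "1 \<le> G 0 \<omega>" using elim(2) by blast
    next
      fix j assume j: "j \<le> p"
      have V: "0 \<le> V (0 - int j) \<omega>" "V (0 - int j) \<omega> \<le> G 0 \<omega>" using elim(2) j by blast+
      have "jet {0<..<1} (\<lambda>u. Y (st u) (0 - int j) \<omega>) (\<kappa> * V (0 - int j) \<omega>) B"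
        unfolding Y_def V_def
        by (rule jet_arch_series[OF a_jet B lam q _ _ s \<kappa>(2)]) auto
      then show "jet {0<..<1} (\<lambda>u. Y (st u) (0 - int j) \<omega>) (\<kappa> * G 0 \<omega>) B"
        by (rule jet_mono) (use V \<kappa>(1) B in \<open>auto intro: mult_left_mono\<close>)
      fix u :: real assume "u \<in> {0<..<1}"
      then have c: "coeff_le p q (st u) (0 - int j)" by (intro st_le) auto
      show "0 \<le> Y (st u) (0 - int j) \<omega>"
        unfolding Y_def by (rule arch_series_nonneg[OF lam q s c])
    qed
  qed
  then show thesis
  proof (rule expectation_taylor[rotated -2])
    show "integrable M (\<lambda>\<omega>. K * G 0 \<omega> ^ 5)" using G_moment(1)[of 5 0] by simp
  next
    fix \<phi>' \<phi>''
    assume "\<And>u. u \<in> {0<..<1} \<Longrightarrow> ((\<lambda>u. expectation (\<lambda>\<omega>. S \<alpha> i (st u) 0 \<omega>)) has_real_derivative \<phi>' u) (at u)"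
      "\<And>u. u \<in> {0<..<1} \<Longrightarrow> (\<phi>' has_real_derivative \<phi>'' u) (at u)"
      "\<And>u v. u \<in> {0<..<1} \<Longrightarrow> v \<in> {0<..<1} \<Longrightarrow>
       \<bar>expectation (\<lambda>\<omega>. S \<alpha> i (st v) 0 \<omega>) - expectation (\<lambda>\<omega>. S \<alpha> i (st u) 0 \<omega>) - \<phi>' u * (v - u)
         - \<phi>'' u * ((v - u)\<^sup>2 / 2)\<bar> \<le> expectation (\<lambda>\<omega>. K * G 0 \<omega> ^ 5) * \<bar>v - u\<bar> ^ 3"
    then show thesis
      by (intro that[of \<phi>' \<phi>'' "expectation (\<lambda>\<omega>. K * G 0 \<omega> ^ 5)"]) (simp_all add: \<phi>_def[abs_def])
  qed auto
qed

lemma lag_squares_Xs: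
  assumes "u \<in> {0<..1}"
  shows "AE \<omega> in M. \<forall>k. lag_squares (\<lambda>s. Xs u s \<omega>) k = (\<lambda>j. Y (st u) (k - int j) \<omega>)"
  using Xs_eq[OF assms] by eventually_elim (auto simp: lag_squares_def)

lemma lag_squares_X:
  assumes "1 \<le> N"
  shows "AE \<omega> in M. \<forall>k\<le>int N. lag_squares (\<lambda>s. X N s \<omega>) k = (\<lambda>j. Y (tv N) (k - int j) \<omega>)"
  using X_eq[OF assms] by eventually_elim (auto simp: lag_squares_def)

text \<open>Almost surely the score at time k is one fixed measurable function of the p + 1 values
  of the stationary process at times k - p, ..., k, so its expectation is shift invariant.\<close>

lemma expectation_S_stationary:
  assumes u: "u \<in> {0<..1}" and i: "i \<le> p"
  shows "expectation (S \<alpha> i (st u) k) = \<phi> i u"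
proof -
  define J where "J = {- int p..0}"
  define f where "f x = score p \<alpha> i (\<lambda>j. if j \<le> p then (x (- int j))\<^sup>2 else 0)" for x :: "int \<Rightarrow> real"
  have m: "(\<lambda>x :: int \<Rightarrow> real. x (- int j)) \<in> borel_measurable (Pi\<^sub>M J (\<lambda>_. borel))" if "j \<le> p" for j
    using that by (intro measurable_component_singleton) (auto simp: J_def)
  have f: "f \<in> borel_measurable (Pi\<^sub>M J (\<lambda>_. borel))"
    unfolding f_def
  proof (intro score_measurable)
    show "(\<lambda>x :: int \<Rightarrow> real. if j \<le> p then (x (- int j))\<^sup>2 else 0) \<in> borel_measurable (Pi\<^sub>M J (\<lambda>_. borel))" for j
    proof (cases "j \<le> p")
      case True
      then show ?thesis using borel_measurable_power[OF m[OF True], of 2] by simp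
    qed simp
  qed
  have [measurable]: "(\<lambda>\<omega>. \<lambda>i\<in>J. Xs u (i + h) \<omega>) \<in> measurable M (Pi\<^sub>M J (\<lambda>_. borel))" for h
    using Xs_measurable[OF u] by (intro measurable_restrict)
  have E: "expectation (S \<alpha> i (st u) h) = integral\<^sup>L (distr M (Pi\<^sub>M J (\<lambda>_. borel)) (\<lambda>\<omega>. \<lambda>i\<in>J. Xs u (i + h) \<omega>)) f" for h
  proof -
    have "expectation (S \<alpha> i (st u) h) = expectation (\<lambda>\<omega>. f (\<lambda>i\<in>J. Xs u (i + h) \<omega>))"
    proof (rule integral_cong_AE)
      show "AE \<omega> in M. S \<alpha> i (st u) h \<omega> = f (\<lambda>i\<in>J. Xs u (i + h) \<omega>)"
        using Xs_eq[OF u]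
      proof eventually_elim
        case (elim \<omega>)
        show ?case
          unfolding S_def f_def using elim
          by (intro score_cong i) (auto simp: J_def add.commute)
      qed
      show "(\<lambda>\<omega>. f (\<lambda>i\<in>J. Xs u (i + h) \<omega>)) \<in> borel_measurable M"
        by (rule measurable_compose[OF _ f]) measurable
    qed measurable
    also have "\<dots> = integral\<^sup>L (distr M (Pi\<^sub>M J (\<lambda>_. borel)) (\<lambda>\<omega>. \<lambda>i\<in>J. Xs u (i + h) \<omega>)) f"
      by (rule integral_distr[symmetric]) (use f in measurable)
    finally show ?thesis .
  qed
  have "distr M (Pi\<^sub>M J (\<lambda>_. borel)) (\<lambda>\<omega>. \<lambda>i\<in>J. Xs u (i + h) \<omega>)
      = distr M (Pi\<^sub>M J (\<lambda>_. borel)) (\<lambda>\<omega>. \<lambda>i\<in>J. Xs u i \<omega>)" for h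
    using Xs[OF u] unfolding stationary_arch_process_def strictly_stationary_def J_def by blast
  from this[of k] this[of 0] show ?thesis unfolding \<phi>_def E[of k] E[of 0] by simp
qed

lemma arch_w_measurable:
  assumes "\<And>t. x t \<in> borel_measurable M"
  shows "(\<lambda>\<omega>. arch_l p (\<lambda>s. x s \<omega>) k \<alpha>') \<in> borel_measurable M"
proof -
  note [measurable] = assms
  show ?thesis unfolding arch_l_def arch_w_def by measurable
qed

lemma Xs_lag_squares_le:
  assumes u: "u \<in> {0<..1}"
  shows "AE \<omega> in M. 1 \<le> G k \<omega> \<and> (\<forall>j\<le>p. lag_squares (\<lambda>s. Xs u s \<omega>) k j \<le> G k \<omega>)"
proof -
  have c: "coeff_le p q (st u) k" using u by (intro st_le) auto
  show ?thesis
    using AE_process_le_G[OF c, of 0] lag_squares_Xs[OF u] by eventually_elim auto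
qed

lemma arch_l_integrable:
  assumes u: "u \<in> {0<..1}" and \<rho>: "0 < \<rho>" "\<And>j. j \<le> p \<Longrightarrow> \<rho> \<le> \<alpha>' j"
  shows "integrable M (\<lambda>\<omega>. arch_l p (\<lambda>s. Xs u s \<omega>) k \<alpha>')"
proof (rule integrable_G_bound(1)[where n = 1])
  show "(\<lambda>\<omega>. arch_l p (\<lambda>s. Xs u s \<omega>) k \<alpha>') \<in> borel_measurable M"
    by (rule arch_w_measurable[OF Xs_measurable[OF u]])
  show "AE \<omega> in M. \<bar>arch_l p (\<lambda>s. Xs u s \<omega>) k \<alpha>'\<bar> \<le> (\<bar>ln \<rho>\<bar> + (\<Sum>j\<le>p. \<alpha>' j) + 1 / \<rho>) * G k \<omega> ^ 1"
    using Xs_lag_squares_le[OF u, of k]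
  proof eventually_elim
    case (elim \<omega>)
    have "\<bar>arch_l p (\<lambda>s. Xs u s \<omega>) k \<alpha>'\<bar> \<le> (\<bar>ln \<rho>\<bar> + (\<Sum>j\<le>p. \<alpha>' j) + 1 / \<rho>) * G k \<omega>"
      by (rule arch_l_abs_le[OF \<rho>]) (use elim in auto)
    then show ?case by simp
  qed
qed simp

lemma S_integrable:
  assumes i: "i \<le> p" and c: "coeff_le p q c k"
  shows "integrable M (S \<alpha> i c k)"
proof -
  obtain K where "score_constant \<alpha> K" using score_difference_bounds[where \<alpha> = \<alpha> and r = r, OF r \<alpha>_r] by blast
  from score_constantD(2)[OF this i c] show ?thesis
    by (intro integrable_G_bound(1)[where k = k and n = 2]) auto
qed

text \<open>The pathwise quadratic remainder has a constant linear in the current square, which is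
  integrable; after integration it is the remainder that
  \<open>has_real_derivative_quadratic\<close> expects.\<close>

lemma limit_L_has_partial_deriv:
  assumes u: "u \<in> {0<..1}" and i: "i \<le> p"
  shows "((\<lambda>s. limit_L M p Xs u (\<alpha>(i := s))) has_real_derivative \<phi> i u) (at (\<alpha> i))"
proof (rule has_real_derivative_quadratic[where S = "{r<..}"])
  show "open {r<..}" "\<alpha> i \<in> {r<..}" using \<alpha>[OF i] r by auto
  fix s assume "s \<in> {r<..}"
  then have s: "r < s" by simp
  let ?l = "\<lambda>s \<omega>. arch_l p (\<lambda>t. Xs u t \<omega>) 0 (\<alpha>(i := s))"
  let ?B = "\<lambda>\<omega>. 1 / r\<^sup>2 * (1 + G 0 \<omega> / r)"
  have c: "coeff_le p q (st u) 0" using u by (intro st_le) auto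
  have il: "integrable M (?l s)" if "r < s" for s
    by (rule arch_l_integrable[OF u r]) (use that \<alpha>_r in auto)
  have ls: "integrable M (?l s)" by (rule il[OF s])
  have l\<alpha>: "integrable M (?l (\<alpha> i))" by (rule il) (use \<alpha>[OF i] r in simp)
  have iS: "integrable M (S \<alpha> i (st u) 0)" by (rule S_integrable[OF i c])
  have iB: "integrable M ?B" using G_moment(1)[of 1 0] by simp
  have iBs: "integrable M (\<lambda>\<omega>. ?B \<omega> * (s - \<alpha> i)\<^sup>2)" using iB by (rule integrable_mult_left)
  have "\<bar>expectation (\<lambda>\<omega>. ?l s \<omega> - ?l (\<alpha> i) \<omega> - S \<alpha> i (st u) 0 \<omega> * (s - \<alpha> i))\<bar>
      \<le> expectation (\<lambda>\<omega>. \<bar>?l s \<omega> - ?l (\<alpha> i) \<omega> - S \<alpha> i (st u) 0 \<omega> * (s - \<alpha> i)\<bar>)"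
    by (rule integral_abs_bound)
  also have "\<dots> \<le> expectation (\<lambda>\<omega>. ?B \<omega> * (s - \<alpha> i)\<^sup>2)"
  proof (rule integral_mono_AE)
    show "AE \<omega> in M. \<bar>?l s \<omega> - ?l (\<alpha> i) \<omega> - S \<alpha> i (st u) 0 \<omega> * (s - \<alpha> i)\<bar> \<le> ?B \<omega> * (s - \<alpha> i)\<^sup>2"
      using Xs_lag_squares_le[OF u, of 0] lag_squares_Xs[OF u]
    proof eventually_elim
      case (elim \<omega>)
      have S: "S \<alpha> i (st u) 0 \<omega> = score p \<alpha> i (lag_squares (\<lambda>t. Xs u t \<omega>) 0)"
        unfolding S_def using elim(2) by simp
      have "\<bar>?l s \<omega> - ?l (\<alpha> i) \<omega> - S \<alpha> i (st u) 0 \<omega> * (s - \<alpha> i)\<bar>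
          \<le> 1 / r\<^sup>2 * (1 + lag_squares (\<lambda>t. Xs u t \<omega>) 0 0 / r) * (s - \<alpha> i)\<^sup>2"
        using arch_l_partial_quadratic[where x = "\<lambda>t. Xs u t \<omega>" and k = 0 and \<alpha> = \<alpha> and r = r, OF r \<alpha> i s] unfolding S by simp
      also have "\<dots> \<le> ?B \<omega> * (s - \<alpha> i)\<^sup>2"
        using elim(1) r by (intro mult_right_mono mult_left_mono add_left_mono divide_right_mono) auto
      finally show ?case .
    qed
  qed (use ls l\<alpha> iS in simp, rule iBs)
  also have "\<dots> = expectation ?B * (s - \<alpha> i)\<^sup>2" using iB by simp
  finally show "\<bar>limit_L M p Xs u (\<alpha>(i := s)) - limit_L M p Xs u (\<alpha>(i := \<alpha> i)) - \<phi> i u * (s - \<alpha> i)\<bar>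
      \<le> expectation ?B * (s - \<alpha> i)\<^sup>2"
    unfolding limit_L_def \<phi>_def using ls l\<alpha> iS by simp
qed

end

text \<open>Finite-sample form of the asymptotic hypotheses. In rescaled time b / 2 is the
  half-width of the window, 1 / N the rounding of the centre and p / N the reach of the lags;
  together they use at most half of the distance from u_0 to either end.\<close>

definition admissible :: "real \<Rightarrow> nat \<Rightarrow> nat \<Rightarrow> real \<Rightarrow> nat \<Rightarrow> bool" where
  "admissible u\<^sub>0 p N b m \<longleftrightarrow> 1 \<le> N \<and> 0 < b \<and> b \<le> 1 \<and> 1 \<le> b * real N \<and>
     \<bar>u\<^sub>0 - real m / real N\<bar> < 1 / real N \<and>
     b / 2 + (1 + real p) / real N \<le> u\<^sub>0 / 2 \<and> b / 2 + (1 + real p) / real N \<le> (1 - u\<^sub>0) / 2"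

lemma eventually_admissible:
  assumes u0: "u\<^sub>0 \<in> {0<..<1}"
    and t0: "\<forall>N\<ge>1. \<bar>u\<^sub>0 - real (t\<^sub>0 N) / real N\<bar> < 1 / real N"
    and b: "b \<longlonglongrightarrow> 0" and bN: "filterlim (\<lambda>N. b N * real N) at_top sequentially"
  shows "\<forall>\<^sub>F N in sequentially. admissible u\<^sub>0 p N (b N) (t\<^sub>0 N)"
proof -
  have "(\<lambda>N. b N / 2 + (1 + real p) / real N) \<longlonglongrightarrow> 0 / 2 + 0"
    by (intro tendsto_intros b lim_const_over_n) simp
  then have lim: "(\<lambda>N. b N / 2 + (1 + real p) / real N) \<longlonglongrightarrow> 0" by simp
  have "\<forall>\<^sub>F N in sequentially. b N / 2 + (1 + real p) / real N < u\<^sub>0 / 2"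
    using u0 by (intro order_tendstoD(2)[OF lim]) auto
  moreover have "\<forall>\<^sub>F N in sequentially. b N / 2 + (1 + real p) / real N < (1 - u\<^sub>0) / 2"
    using u0 by (intro order_tendstoD(2)[OF lim]) auto
  moreover have "\<forall>\<^sub>F N in sequentially. 1 \<le> b N * real N"
    using bN by (simp add: filterlim_at_top)
  moreover have "\<forall>\<^sub>F N in sequentially. b N < 1" by (rule order_tendstoD(2)[OF b]) simp
  moreover have "\<forall>\<^sub>F N in sequentially. 1 \<le> N" by (rule eventually_ge_at_top)
  ultimately show ?thesis
  proof eventually_elim
    case (elim N)
    \<comment> \<open>The bandwidth is positive because its product with N is at least 1.\<close>
    have "0 < b N"
    proof (rule ccontr)
      assume "\<not> 0 < b N"
      then have "b N * real N \<le> 0" by (simp add: mult_nonpos_nonneg)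
      with elim show False by simp
    qed
    with elim t0 show ?case by (auto simp: admissible_def)
  qed
qed

context
  fixes u\<^sub>0 b :: real and p N m :: nat
  assumes adm: "admissible u\<^sub>0 p N b m"
begin

text \<open>The rounding error 1 / N is at most b because b N \<ge> 1, so b / 2 + 1 / N stays below
  2 * b. The lower bound for k - p keeps every lagged time at least u_0 / 2 times N.\<close>

lemma admissible_window:
  assumes "\<bar>real m - real k\<bar> \<le> b * real N / 2"
  shows "\<bar>real k / real N - u\<^sub>0\<bar> \<le> 2 * b" "u\<^sub>0 / 2 * real N \<le> real k - real p"
    "real k / real N \<in> {0<..<1}" "p + 1 \<le> k" "k \<le> N"
proof -
  have N: "0 < real N" and b: "0 < b" using adm by (auto simp: admissible_def)
  have "\<bar>real m / real N - real k / real N\<bar> = \<bar>real m - real k\<bar> / real N"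
    using N by (simp add: diff_divide_distrib[symmetric])
  also have "\<dots> \<le> (b * real N / 2) / real N" using assms N by (intro divide_right_mono) auto
  also have "\<dots> = b / 2" using N by simp
  finally have k: "\<bar>real m / real N - real k / real N\<bar> \<le> b / 2" .
  have m: "\<bar>u\<^sub>0 - real m / real N\<bar> < 1 / real N" using adm by (simp add: admissible_def)
  have bN: "1 / real N \<le> b" using adm N by (simp add: admissible_def divide_le_eq)
  have pN: "0 \<le> real p / real N" by simp
  have c: "b / 2 + 1 / real N + real p / real N \<le> u\<^sub>0 / 2" "b / 2 + 1 / real N + real p / real N \<le> 1 / 2 - u\<^sub>0 / 2"
    using adm by (auto simp: admissible_def add_divide_distrib diff_divide_distrib)
  have N1: "0 < 1 / real N" using N by simp
  show "\<bar>real k / real N - u\<^sub>0\<bar> \<le> 2 * b" using k m bN b by linarith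
  have "u\<^sub>0 / 2 \<le> real k / real N - real p / real N" using k m c by linarith
  then have le: "u\<^sub>0 / 2 \<le> (real k - real p) / real N" by (simp add: diff_divide_distrib)
  then show "u\<^sub>0 / 2 * real N \<le> real k - real p" using N by (simp add: pos_le_divide_eq)
  show kN: "real k / real N \<in> {0<..<1}" 
  proof -
    have "0 < real k / real N" using k m c N1 b pN by linarith
    moreover have "real k / real N < 1" using k m c N1 b pN by linarith
    ultimately show ?thesis by simp
  qed
  have "0 < u\<^sub>0 / 2" using c b N1 pN by linarith
  with le have "0 < (real k - real p) / real N" by linarith
  then have "real p < real k" using N by (simp add: zero_less_divide_iff)
  then show "p + 1 \<le> k" by simp
  have "real k < real N" using kN N by (simp add: divide_less_eq)
  then show "k \<le> N" by simp
qed

lemma admissible_cover: "(real m - real N) / (b * real N) \<le> -1/2" "1/2 \<le> (real m - real p) / (b * real N)" "p \<le> N"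
proof -
  have N: "0 < real N" and b: "0 < b" using adm by (auto simp: admissible_def)
  have m: "\<bar>u\<^sub>0 - real m / real N\<bar> < 1 / real N" using adm by (simp add: admissible_def)
  have pN: "0 \<le> real p / real N" by simp
  have N1: "0 < 1 / real N" using N by simp
  have c: "b / 2 + 1 / real N + real p / real N \<le> u\<^sub>0 / 2" "b / 2 + 1 / real N + real p / real N \<le> 1 / 2 - u\<^sub>0 / 2"
    using adm by (auto simp: admissible_def add_divide_distrib diff_divide_distrib)
  have u: "0 < u\<^sub>0" using c b N1 pN by linarith
  have u': "u\<^sub>0 < 1" using c b N1 pN by linarith
  have "real m / real N - 1 \<le> - (b / 2)" using m c u u' pN by linarith
  then have "(real m - real N) / real N \<le> - (b / 2)" using N by (simp add: diff_divide_distrib)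
  then show "(real m - real N) / (b * real N) \<le> -1/2" using N b by (simp add: field_simps)
  have "b / 2 \<le> real m / real N - real p / real N" using m c u by linarith
  then have "b / 2 \<le> (real m - real p) / real N" by (simp add: diff_divide_distrib)
  then show "1/2 \<le> (real m - real p) / (b * real N)" using N b by (simp add: field_simps)
  have "real p / real N \<le> 1" using c u b N1 by linarith
  then show "p \<le> N" using N by (simp add: divide_le_eq)
qed

end

section \<open>Kernel weights on an admissible window\<close>

definition kernel_function :: "(real \<Rightarrow> real) \<Rightarrow> bool" where
  "kernel_function W \<longleftrightarrow> bounded_variation_on W {-1/2..1/2} \<and> (\<forall>x. x \<notin> {-1/2..1/2} \<longrightarrow> W x = 0) \<and>
     integral {-1/2..1/2} W = 1 \<and> integral {-1/2..1/2} (\<lambda>x. W x * x) = 0"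

definition kernel_arg :: "real \<Rightarrow> nat \<Rightarrow> nat \<Rightarrow> nat \<Rightarrow> real" where
  "kernel_arg b N m k = (real m - real k) / (b * real N)"

definition kernel_weight :: "(real \<Rightarrow> real) \<Rightarrow> real \<Rightarrow> nat \<Rightarrow> nat \<Rightarrow> nat \<Rightarrow> real" where
  "kernel_weight W b N m k = 1 / (b * real N) * W (kernel_arg b N m k)"

text \<open>Riemann sums of the kernel moments have error of order 1 / (b N). The prefactors b and b
  ^ 2 turn it into 1 / N, and in the first-order estimate the limit is 0. The constant is uniform
  over all admissible parameters.\<close>

definition kernel_constant :: "(real \<Rightarrow> real) \<Rightarrow> real \<Rightarrow> bool" where
  "kernel_constant W C \<longleftrightarrow> 0 \<le> C \<and> (\<forall>u\<^sub>0 p N b m. admissible u\<^sub>0 p N b m \<longrightarrow>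
      (\<Sum>k=p+1..N. \<bar>kernel_weight W b N m k\<bar>) \<le> C \<and>
      b * \<bar>\<Sum>k=p+1..N. kernel_weight W b N m k * kernel_arg b N m k\<bar> \<le> C * (1 / real N) \<and>
      b\<^sup>2 * \<bar>(\<Sum>k=p+1..N. kernel_weight W b N m k * (kernel_arg b N m k)\<^sup>2) - kernel_moment W 2\<bar>
        \<le> C * (1 / real N) \<and>
      (\<forall>k. \<bar>kernel_weight W b N m k\<bar> \<le> C / (b * real N)) \<and>
      (\<forall>k. W (kernel_arg b N m k) \<noteq> 0 \<longrightarrow> \<bar>real m - real k\<bar> \<le> b * real N / 2) \<and>
      real (card {k \<in> {p+1..N}. W (kernel_arg b N m k) \<noteq> 0}) \<le> 2 * (b * real N))"

lemma kernel_constantD: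
  assumes "kernel_constant W C" "admissible u\<^sub>0 p N b m"
  shows "(\<Sum>k=p+1..N. \<bar>kernel_weight W b N m k\<bar>) \<le> C"
    "b * \<bar>\<Sum>k=p+1..N. kernel_weight W b N m k * kernel_arg b N m k\<bar> \<le> C * (1 / real N)"
    "b\<^sup>2 * \<bar>(\<Sum>k=p+1..N. kernel_weight W b N m k * (kernel_arg b N m k)\<^sup>2) - kernel_moment W 2\<bar>
      \<le> C * (1 / real N)"
    "\<bar>kernel_weight W b N m k\<bar> \<le> C / (b * real N)"
    "W (kernel_arg b N m k) \<noteq> 0 \<Longrightarrow> \<bar>real m - real k\<bar> \<le> b * real N / 2"
    "real (card {k \<in> {p+1..N}. W (kernel_arg b N m k) \<noteq> 0}) \<le> 2 * (b * real N)"
  using assms unfolding kernel_constant_def by blast+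

lemma kernel_window_sums:
  assumes "kernel_function W"
  obtains C where "0 \<le> C" "kernel_constant W C"
proof -
  have bv: "bounded_variation_on W {-1/2..1/2}" and zero: "\<forall>x. x \<notin> {-1/2..1/2} \<longrightarrow> W x = 0"
    and W1: "integral {-1/2..1/2} W = 1" and Wx: "integral {-1/2..1/2} (\<lambda>x. W x * x) = 0"
    using assms by (auto simp: kernel_function_def)
  \<comment> \<open>The integral of a nonintegrable function is 0 by default, so the value 1 forces
    integrability.\<close>
  have int: "W integrable_on {-1/2..1/2}" using W1 not_integrable_integral by force
  obtain C where C: "0 \<le> C" "\<And>x. \<bar>W x\<bar> \<le> C"
    "\<And>h m N p r. 0 < h \<Longrightarrow> (m - real N) / h \<le> -1/2 \<Longrightarrow> 1/2 \<le> (m - real p) / h \<Longrightarrow> p \<le> N \<Longrightarrow> r \<le> 2 \<Longrightarrow>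
      \<bar>(\<Sum>k=p+1..N. 1 / h * W ((m - real k) / h) * ((m - real k) / h) ^ r) - kernel_moment W r\<bar> \<le> C / h"
    using kernel_sums[OF bv zero int] by blast
  have "kernel_constant W (2 * C)"
    unfolding kernel_constant_def
  proof (intro conjI allI impI)
    show "0 \<le> 2 * C" using C(1) by simp
    fix u\<^sub>0 b :: real and p N m :: nat
    assume adm: "admissible u\<^sub>0 p N b m"
    define h where "h = b * real N"
    let ?x = "kernel_arg b N m" and ?c = "kernel_weight W b N m"
    let ?I = "{k \<in> {p+1..N}. W (?x k) \<noteq> 0}"
    have b: "0 < b" "b \<le> 1" and N: "0 < real N" and h: "0 < h" "1 \<le> h"
      using adm by (auto simp: admissible_def h_def)
    have x: "?x k = (real m - real k) / h" for k by (simp add: kernel_arg_def h_def)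
    have c: "?c k = 1 / h * W (?x k)" for k by (simp add: kernel_weight_def h_def)
    have cb: "\<bar>?c k\<bar> \<le> C / h" for k
    proof -
      have "\<bar>1 / h * W (?x k)\<bar> \<le> 1 / h * C"
        unfolding abs_mult abs_of_pos[OF divide_pos_pos[OF zero_less_one h(1)]]
        using C(2) h(1) by (intro mult_left_mono) auto
      then show ?thesis by (simp add: c)
    qed
    show "\<bar>?c k\<bar> \<le> 2 * C / (b * real N)" for k
      using cb[of k] C(1) h(1) divide_right_mono[of C "2 * C" h] unfolding h_def by linarith
    show win: "\<bar>real m - real k\<bar> \<le> b * real N / 2" if "W (?x k) \<noteq> 0" for k
    proof -
      have "?x k \<in> {-1/2..1/2}" using zero that by blast
      moreover have "\<bar>y\<bar> \<le> 1/2" if "y \<in> {-1/2..1/2}" for y :: real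
        using that unfolding atLeastAtMost_iff by linarith
      ultimately have "\<bar>?x k\<bar> \<le> 1/2" by blast
      then have "\<bar>real m - real k\<bar> / h \<le> 1/2" unfolding x abs_divide abs_of_pos[OF h(1)] .
      then show ?thesis using h(1) by (simp add: pos_divide_le_eq h_def)
    qed
    have "real (card ?I) \<le> h + 1"
      by (rule card_nat_window_le[where m = "real m"]) (use win h(1) in \<open>auto simp: h_def\<close>)
    then have card: "real (card ?I) \<le> 2 * h" using h(2) by simp
    then show "real (card ?I) \<le> 2 * (b * real N)" by (simp add: h_def)
    have sum: "\<bar>(\<Sum>k=p+1..N. ?c k * ?x k ^ r) - kernel_moment W r\<bar> \<le> C / h" if "r \<le> 2" for r
      using C(3)[of h "real m" N p r] admissible_cover[OF adm] h(1) that unfolding c x h_def by blast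
    have "(\<Sum>k=p+1..N. \<bar>?c k\<bar>) = (\<Sum>k\<in>?I. \<bar>?c k\<bar>)"
      by (intro sum.mono_neutral_right) (auto simp: c)
    also have "\<dots> \<le> (\<Sum>k\<in>?I. C / h)" by (intro sum_mono cb)
    also have "\<dots> = real (card ?I) * (C / h)" by simp
    also have "\<dots> \<le> (2 * h) * (C / h)" using card C(1) h(1) by (intro mult_right_mono) auto
    also have "\<dots> = 2 * C" using h(1) by simp
    finally show "(\<Sum>k=p+1..N. \<bar>?c k\<bar>) \<le> 2 * C" .
    have "kernel_moment W 1 = 0" using Wx by (simp add: kernel_moment_def)
    then have "b * \<bar>\<Sum>k=p+1..N. ?c k * ?x k\<bar> \<le> b * (C / h)"
      using sum[of 1] b by (intro mult_left_mono) auto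
    also have "\<dots> \<le> 2 * C * (1 / real N)" using b N C(1) by (simp add: h_def divide_right_mono)
    finally show "b * \<bar>\<Sum>k=p+1..N. ?c k * ?x k\<bar> \<le> 2 * C * (1 / real N)" .
    have "b\<^sup>2 * \<bar>(\<Sum>k=p+1..N. ?c k * (?x k)\<^sup>2) - kernel_moment W 2\<bar> \<le> b\<^sup>2 * (C / h)"
      using sum[of 2] by (intro mult_left_mono) auto
    also have "\<dots> = b * (C / real N)" using b by (simp add: h_def power2_eq_square)
    also have "\<dots> \<le> 2 * (C / real N)" using b C(1) by (intro mult_right_mono) auto
    also have "\<dots> = 2 * C * (1 / real N)" by simp
    finally show "b\<^sup>2 * \<bar>(\<Sum>k=p+1..N. ?c k * (?x k)\<^sup>2) - kernel_moment W 2\<bar> \<le> 2 * C * (1 / real N)" .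
  qed
  then show thesis using that[of "2 * C"] C(1) by simp
qed

section \<open>Mean and variance of the gradient\<close>

text \<open>An entry of the covariance matrix is bounded by the mean of two variances, so it
  suffices to bound the diagonal.\<close>

lemma abs_covar_le:
  assumes "prob_space P" "integrable P f" "integrable P g"
    "integrable P (\<lambda>\<omega>. (f \<omega>)\<^sup>2)" "integrable P (\<lambda>\<omega>. (g \<omega>)\<^sup>2)"
  shows "\<bar>covar P f g\<bar> \<le> 1 / 2 * (((\<integral>\<omega>. (f \<omega>)\<^sup>2 \<partial>P) - (\<integral>\<omega>. f \<omega> \<partial>P)\<^sup>2)
    + ((\<integral>\<omega>. (g \<omega>)\<^sup>2 \<partial>P) - (\<integral>\<omega>. g \<omega> \<partial>P)\<^sup>2))"
proof -
  interpret prob_space P by fact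
  define f' where "f' \<omega> = f \<omega> - expectation f" for \<omega>
  define g' where "g' \<omega> = g \<omega> - expectation g" for \<omega>
  have i: "integrable P (\<lambda>\<omega>. (f' \<omega>)\<^sup>2)" "integrable P (\<lambda>\<omega>. (g' \<omega>)\<^sup>2)"
    unfolding f'_def g'_def power2_diff using assms(2-5) by auto
  have [measurable]: "f' \<in> borel_measurable P" "g' \<in> borel_measurable P"
    using assms(2,3) unfolding f'_def g'_def by auto
  have le: "\<bar>f' \<omega> * g' \<omega>\<bar> \<le> 1 / 2 * ((f' \<omega>)\<^sup>2 + (g' \<omega>)\<^sup>2)" for \<omega>
  proof -
    have "0 \<le> (\<bar>f' \<omega>\<bar> - \<bar>g' \<omega>\<bar>)\<^sup>2" by simp
    also have "\<dots> = (f' \<omega>)\<^sup>2 + (g' \<omega>)\<^sup>2 - 2 * \<bar>f' \<omega> * g' \<omega>\<bar>" by (simp add: power2_diff abs_mult)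
    finally show ?thesis by simp
  qed
  have iB: "integrable P (\<lambda>\<omega>. 1 / 2 * ((f' \<omega>)\<^sup>2 + (g' \<omega>)\<^sup>2))" using i by auto
  have ifg: "integrable P (\<lambda>\<omega>. f' \<omega> * g' \<omega>)"
    by (rule Bochner_Integration.integrable_bound[OF iB]) (use le in \<open>auto intro!: AE_I2 order_trans[OF le]\<close>)
  have "\<bar>covar P f g\<bar> = \<bar>expectation (\<lambda>\<omega>. f' \<omega> * g' \<omega>)\<bar>" by (simp add: covar_def f'_def g'_def)
  also have "\<dots> \<le> expectation (\<lambda>\<omega>. \<bar>f' \<omega> * g' \<omega>\<bar>)" by (rule integral_abs_bound)
  also have "\<dots> \<le> expectation (\<lambda>\<omega>. 1 / 2 * ((f' \<omega>)\<^sup>2 + (g' \<omega>)\<^sup>2))"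
    by (intro integral_mono iB integrable_abs ifg le)
  also have "\<dots> = 1 / 2 * (variance f + variance g)" using i by (simp add: f'_def g'_def)
  also have "variance f = expectation (\<lambda>\<omega>. (f \<omega>)\<^sup>2) - (expectation f)\<^sup>2"
    by (rule variance_eq[OF assms(2,4)])
  also have "variance g = expectation (\<lambda>\<omega>. (g \<omega>)\<^sup>2) - (expectation g)\<^sup>2"
    by (rule variance_eq[OF assms(3,5)])
  finally show ?thesis .
qed

context tvarch
begin

text \<open>A lag of at most p shifts rescaled time by at most p / N; together with the error 1 / N
  of the comparison itself this gives p + 1.\<close>

definition window_constant :: "real \<Rightarrow> real \<Rightarrow> bool" where
  "window_constant \<tau> K \<longleftrightarrow> 0 \<le> K \<and>
     (\<forall>N u k d. 1 \<le> N \<longrightarrow> u \<in> {0..1} \<longrightarrow> k \<le> N \<longrightarrow> \<tau> * real N \<le> real k - real p \<longrightarrow>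
      \<bar>real k / real N - u\<bar> \<le> d \<longrightarrow>
      (AE \<omega> in M. \<forall>j\<le>p. \<bar>Y (tv N) (int k - int j) \<omega> - Y (st u) (int k - int j) \<omega>\<bar>
        \<le> K * (d + (real p + 1) / real N) * V (int k - int j) \<omega>))"

lemma window_constantD:
  assumes "window_constant \<tau> K"
  shows "0 \<le> K"
    "1 \<le> N \<Longrightarrow> u \<in> {0..1} \<Longrightarrow> k \<le> N \<Longrightarrow> \<tau> * real N \<le> real k - real p \<Longrightarrow> \<bar>real k / real N - u\<bar> \<le> d \<Longrightarrow>
      AE \<omega> in M. \<forall>j\<le>p. \<bar>Y (tv N) (int k - int j) \<omega> - Y (st u) (int k - int j) \<omega>\<bar>
        \<le> K * (d + (real p + 1) / real N) * V (int k - int j) \<omega>"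
  using assms unfolding window_constant_def by blast+

lemma Y_difference_window:
  assumes \<tau>: "0 < \<tau>"
  obtains K where "window_constant \<tau> K"
proof -
  obtain K where K: "0 \<le> K"
    "\<And>N (u :: real) t. 1 \<le> N \<Longrightarrow> u \<in> {0..1} \<Longrightarrow> t \<le> int N \<Longrightarrow> \<tau> * real N \<le> real_of_int t \<Longrightarrow>
      AE \<omega> in M. \<bar>Y (tv N) t \<omega> - Y (st u) t \<omega>\<bar> \<le> K * (\<bar>real_of_int t / real N - u\<bar> + 1 / real N) * V t \<omega>"
    using Y_difference[OF \<tau>] by blast
  have "window_constant \<tau> K"
    unfolding window_constant_def
  proof (intro conjI allI impI)
    show "0 \<le> K" by (rule K(1))
    fix N k and u d :: real
    assume N: "1 \<le> N" and u: "u \<in> {0..1}" and k: "k \<le> N" "\<tau> * real N \<le> real k - real p"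
      and d: "\<bar>real k / real N - u\<bar> \<le> d"
    have j: "AE \<omega> in M. j \<le> p \<longrightarrow> \<bar>Y (tv N) (int k - int j) \<omega> - Y (st u) (int k - int j) \<omega>\<bar>
        \<le> K * (d + (real p + 1) / real N) * V (int k - int j) \<omega>" for j
    proof (cases "j \<le> p")
      case True
      have "real j \<le> real p" using True by simp
      with k(2) have "\<tau> * real N \<le> real_of_int (int k - int j)" by simp
      moreover have "int k - int j \<le> int N" using k(1) by simp
      ultimately have "AE \<omega> in M. \<bar>Y (tv N) (int k - int j) \<omega> - Y (st u) (int k - int j) \<omega>\<bar>
          \<le> K * (\<bar>real_of_int (int k - int j) / real N - u\<bar> + 1 / real N) * V (int k - int j) \<omega>"
        by (intro K(2) N u)
      then show ?thesis
        using AE_V_le_G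
      proof eventually_elim
        case (elim \<omega>)
        have V: "0 \<le> V (int k - int j) \<omega>" using elim(2) True by blast
        have jN: "0 \<le> real j / real N" "real j / real N \<le> real p / real N"
          using True by (auto intro: divide_right_mono)
        have "real_of_int (int k - int j) / real N = real k / real N - real j / real N"
          by (simp add: diff_divide_distrib)
        then have "\<bar>real_of_int (int k - int j) / real N - u\<bar> \<le> d + real p / real N"
          using d jN by linarith
        then have "\<bar>real_of_int (int k - int j) / real N - u\<bar> + 1 / real N \<le> d + (real p + 1) / real N"
          by (simp add: add_divide_distrib)
        then have "K * (\<bar>real_of_int (int k - int j) / real N - u\<bar> + 1 / real N) * V (int k - int j) \<omega>
            \<le> K * (d + (real p + 1) / real N) * V (int k - int j) \<omega>"
          using K(1) V by (intro mult_right_mono mult_left_mono)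
        with elim(1) show ?case by linarith
      qed
    qed simp
    then have "AE \<omega> in M. \<forall>j. j \<le> p \<longrightarrow> \<bar>Y (tv N) (int k - int j) \<omega> - Y (st u) (int k - int j) \<omega>\<bar>
        \<le> K * (d + (real p + 1) / real N) * V (int k - int j) \<omega>" by (subst AE_all_countable) blast
    then show "AE \<omega> in M. \<forall>j\<le>p. \<bar>Y (tv N) (int k - int j) \<omega> - Y (st u) (int k - int j) \<omega>\<bar>
        \<le> K * (d + (real p + 1) / real N) * V (int k - int j) \<omega>" by simp
  qed
  then show thesis by (rule that)
qed

text \<open>The comparison is with the stationary process at u = k / N itself: the distance in
  rescaled time is then 0 and only the error 1 / N remains. The passage from k / N to u_0 is left to
  the Taylor expansion.\<close>

lemma local_mean:
  assumes i: "i \<le> p" and \<tau>: "0 < \<tau>"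
  obtains K where "0 \<le> K"
    "\<And>N k. 1 \<le> N \<Longrightarrow> k \<le> N \<Longrightarrow> real k / real N \<in> {0<..<1} \<Longrightarrow> \<tau> * real N \<le> real k - real p \<Longrightarrow>
      \<bar>expectation (S \<alpha> i (tv N) (int k)) - \<phi> i (real k / real N)\<bar> \<le> K / real N"
proof -
  obtain K where "score_constant \<alpha> K" using score_difference_bounds[where \<alpha> = \<alpha> and r = r, OF r \<alpha>_r] by blast
  note K = score_constantD[OF this]
  obtain K' where "window_constant \<tau> K'" using Y_difference_window[OF \<tau>] by blast
  note K' = window_constantD[OF this]
  show thesis
  proof (rule that[of "K * (K' * (real p + 1)) * EG"])
    show "0 \<le> K * (K' * (real p + 1)) * EG" using K(1) K'(1) EG_nonneg by simp
  next
    fix N k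
    assume N: "1 \<le> N" and k: "k \<le> N" "real k / real N \<in> {0<..<1}" "\<tau> * real N \<le> real k - real p"
    define \<eta> where "\<eta> = K' * (0 + (real p + 1) / real N)"
    have \<eta>: "0 \<le> \<eta>" using K'(1) by (simp add: \<eta>_def)
    let ?u = "real k / real N"
    have ct: "coeff_le p q (tv N) (int k)" using N k by (intro tv_le') auto
    have cs: "coeff_le p q (st ?u) (int k)" using k(2) by (intro st_le) auto
    have iT: "integrable M (S \<alpha> i (tv N) (int k))" by (rule S_integrable[OF i ct])
    have iS: "integrable M (S \<alpha> i (st ?u) (int k))" by (rule S_integrable[OF i cs])
    have "AE \<omega> in M. \<bar>D \<alpha> i (tv N) (st ?u) (int k) \<omega>\<bar> \<le> K * \<eta> * G (int k) \<omega> ^ 2"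
      unfolding \<eta>_def
      by (rule K(5)[OF i ct cs \<eta>[unfolded \<eta>_def] K'(2)[OF N _ k(1,3)]]) (use k(2) in auto)
    then have "\<bar>expectation (D \<alpha> i (tv N) (st ?u) (int k))\<bar> \<le> K * \<eta> * expectation (\<lambda>\<omega>. G (int k) \<omega> ^ 2)"
      by (intro integrable_G_bound(2)) auto
    also have "\<dots> \<le> K * \<eta> * EG" using K(1) \<eta> G_moment(2)[of 2] by (intro mult_left_mono) auto
    also have "expectation (D \<alpha> i (tv N) (st ?u) (int k))
        = expectation (S \<alpha> i (tv N) (int k)) - expectation (S \<alpha> i (st ?u) (int k))"
      unfolding D_def using iT iS by simp
    also have "expectation (S \<alpha> i (st ?u) (int k)) = \<phi> i ?u"
      using k(2) by (intro expectation_S_stationary i) auto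
    finally show "\<bar>expectation (S \<alpha> i (tv N) (int k)) - \<phi> i ?u\<bar> \<le> K * (K' * (real p + 1)) * EG / real N"
      by (simp add: \<eta>_def mult_ac)
  qed
qed

text \<open>The gradient with the series in place of the squared processes;
  \<open>grad_bias_B_AE\<close> shows that the two agree almost surely.\<close>

definition gradient_sum :: "(real \<Rightarrow> real) \<Rightarrow> real \<Rightarrow> nat \<Rightarrow> real \<Rightarrow> nat \<Rightarrow> nat \<Rightarrow> 'a \<Rightarrow> real" where
  "gradient_sum W u N b m i \<omega> = (\<Sum>k=p+1..N. kernel_weight W b N m k * D \<alpha> i (tv N) (st u) (int k) \<omega>)"

lemma D_integrable:
  assumes "i \<le> p" "1 \<le> N" "k \<le> N" "u \<in> {0..1}"
  shows "integrable M (D \<alpha> i (tv N) (st u) (int k))"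
proof -
  have "coeff_le p q (tv N) (int k)" using assms by (intro tv_le') auto
  then have "integrable M (S \<alpha> i (tv N) (int k))" by (rule S_integrable[OF assms(1)])
  moreover have "integrable M (S \<alpha> i (st u) (int k))" by (rule S_integrable[OF assms(1) st_le[OF assms(4)]])
  ultimately show ?thesis unfolding D_def[abs_def] by (rule Bochner_Integration.integrable_diff)
qed

lemma D_product_integrable:
  assumes i: "i \<le> p" and N: "1 \<le> N" "k \<le> N" "l \<le> N" and u: "u \<in> {0..1}"
  shows "integrable M (\<lambda>\<omega>. D \<alpha> i (tv N) (st u) (int k) \<omega> * D \<alpha> i (tv N) (st u) (int l) \<omega>)"
proof -
  obtain K where "score_constant \<alpha> K" using score_difference_bounds[where \<alpha> = \<alpha> and r = r, OF r \<alpha>_r] by blast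
  note K = score_constantD[OF this]
  have D: "AE \<omega> in M. \<bar>D \<alpha> i (tv N) (st u) (int k) \<omega>\<bar> \<le> 2 * K * G (int k) \<omega> ^ 2" if "k \<le> N" for k
  proof -
    have "AE \<omega> in M. \<bar>S \<alpha> i (tv N) (int k) \<omega>\<bar> \<le> K * G (int k) \<omega> ^ 2"
      using N that by (intro K(2) i tv_le') auto
    moreover have "AE \<omega> in M. \<bar>S \<alpha> i (st u) (int k) \<omega>\<bar> \<le> K * G (int k) \<omega> ^ 2"
      using u by (intro K(2) i st_le)
    ultimately show ?thesis
      by eventually_elim (unfold D_def, linarith)
  qed
  show ?thesis
    by (rule product_G_bound(1)[OF _ _ D[OF N(2)] D[OF N(3)]]) (use K(1) in auto)
qed

lemma gradient_sum_integrable: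
  assumes i: "i \<le> p" and N: "1 \<le> N" and u: "u \<in> {0..1}"
  shows "integrable M (gradient_sum W u N b m i)" "integrable M (\<lambda>\<omega>. (gradient_sum W u N b m i \<omega>)\<^sup>2)"
proof -
  show "integrable M (gradient_sum W u N b m i)"
    unfolding gradient_sum_def[abs_def]
    by (intro Bochner_Integration.integrable_sum integrable_mult_right D_integrable i N u) auto
  have eq: "(\<lambda>\<omega>. (gradient_sum W u N b m i \<omega>)\<^sup>2)
      = (\<lambda>\<omega>. \<Sum>k=p+1..N. \<Sum>l=p+1..N. (kernel_weight W b N m k * kernel_weight W b N m l) *
        (D \<alpha> i (tv N) (st u) (int k) \<omega> * D \<alpha> i (tv N) (st u) (int l) \<omega>))"
    unfolding gradient_sum_def power2_eq_square sum_product by (intro ext sum.cong refl) (simp only: mult_ac)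
  show "integrable M (\<lambda>\<omega>. (gradient_sum W u N b m i \<omega>)\<^sup>2)"
    unfolding eq
    by (intro Bochner_Integration.integrable_sum integrable_mult_right D_product_integrable i N u) auto
qed

lemma gradient_sum_mean:
  assumes i: "i \<le> p" and u0: "u\<^sub>0 \<in> {0<..<1}"
    and W: "kernel_function W"
  obtains D2 C where "has_second_derivative (\<phi> i) D2 u\<^sub>0" "0 \<le> C"
    "\<And>N b m. admissible u\<^sub>0 p N b m \<Longrightarrow>
      \<bar>expectation (gradient_sum W u\<^sub>0 N b m i) - 1 / 2 * b\<^sup>2 * kernel_moment W 2 * D2\<bar> \<le> C * (b ^ 3 + 1 / real N)"
proof -
  obtain \<phi>' \<phi>'' K1 where \<phi>:
    "\<And>u. u \<in> {0<..<1} \<Longrightarrow> (\<phi> i has_real_derivative \<phi>' u) (at u)"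
    "\<And>u. u \<in> {0<..<1} \<Longrightarrow> (\<phi>' has_real_derivative \<phi>'' u) (at u)"
    "\<And>u v. u \<in> {0<..<1} \<Longrightarrow> v \<in> {0<..<1} \<Longrightarrow>
       \<bar>\<phi> i v - \<phi> i u - \<phi>' u * (v - u) - \<phi>'' u * ((v - u)\<^sup>2 / 2)\<bar> \<le> K1 * \<bar>v - u\<bar> ^ 3"
    using \<phi>_taylor[OF i] by blast
  have "0 < u\<^sub>0 / 2" using u0 by simp
  then obtain K2 where K2: "0 \<le> K2"
    "\<And>N k. 1 \<le> N \<Longrightarrow> k \<le> N \<Longrightarrow> real k / real N \<in> {0<..<1} \<Longrightarrow> u\<^sub>0 / 2 * real N \<le> real k - real p \<Longrightarrow>
      \<bar>expectation (S \<alpha> i (tv N) (int k)) - \<phi> i (real k / real N)\<bar> \<le> K2 / real N"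
    using local_mean[OF i] by blast
  obtain C where C: "0 \<le> C" "kernel_constant W C" using kernel_window_sums[OF W] .
  \<comment> \<open>K2 is the price of localising at k / N; the factor 8 comes from the cube of the
    distance bound 2 * b.\<close>
  define A where "A = K2 + 8 * \<bar>K1\<bar>"
  show thesis
  proof (rule that)
    have "\<forall>\<^sub>F y in nhds u\<^sub>0. y \<in> {0<..<1}"
      using u0 by (intro eventually_nhds_in_open) auto
    then have "\<forall>\<^sub>F y in nhds u\<^sub>0. (\<phi> i has_real_derivative \<phi>' y) (at y)"
      by eventually_elim (rule \<phi>(1))
    then show "has_second_derivative (\<phi> i) (\<phi>'' u\<^sub>0) u\<^sub>0"
      unfolding has_second_derivative_def using \<phi>(2)[OF u0] by blast
  next
    show "0 \<le> \<bar>A\<bar> * C + 2 * \<bar>\<phi>' u\<^sub>0\<bar> * C + 2 * \<bar>\<phi>'' u\<^sub>0\<bar> * C" using C(1) by simp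
  next
    fix N b m assume adm: "admissible u\<^sub>0 p N b m"
    let ?x = "kernel_arg b N m" and ?c = "kernel_weight W b N m"
    let ?F = "\<lambda>k. expectation (D \<alpha> i (tv N) (st u\<^sub>0) (int k))"
    have N: "1 \<le> N" and b: "0 < b" "b \<le> 1" and t: "\<bar>u\<^sub>0 - real m / real N\<bar> < 1 / real N"
      using adm by (auto simp: admissible_def)
    have u01: "u\<^sub>0 \<in> {0..1}" "u\<^sub>0 \<in> {0<..1}" using u0 by auto
    have "expectation (gradient_sum W u\<^sub>0 N b m i) = (\<Sum>k=p+1..N. ?c k * ?F k)"
      unfolding gradient_sum_def[abs_def] using N u01 i
      by (subst Bochner_Integration.integral_sum)
         (auto intro!: integrable_mult_right D_integrable simp del: times_divide_eq_left times_divide_eq_right)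
    also have "\<bar>\<dots> - 1 / 2 * b\<^sup>2 * kernel_moment W 2 * \<phi>'' u\<^sub>0\<bar>
        \<le> (\<bar>A\<bar> * C + 2 * \<bar>\<phi>' u\<^sub>0\<bar> * C + 2 * \<bar>\<phi>'' u\<^sub>0\<bar> * C) * (1 / real N + b ^ 3)"
    proof (rule kernel_sum_expansion)
      fix k assume k: "k \<in> {p+1..N}" and "?c k \<noteq> 0"
      then have "W (?x k) \<noteq> 0" by (auto simp: kernel_weight_def)
      then have win: "\<bar>real m - real k\<bar> \<le> b * real N / 2" by (rule kernel_constantD(5)[OF C(2) adm])
      note w = admissible_window[OF adm win]
      show "real k / real N - u\<^sub>0 = - b * ?x k + (real m / real N - u\<^sub>0)"
        using N b by (simp add: kernel_arg_def field_simps)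
      have F: "?F k = expectation (S \<alpha> i (tv N) (int k)) - \<phi> i u\<^sub>0"
      proof -
        have "?F k = expectation (S \<alpha> i (tv N) (int k)) - expectation (S \<alpha> i (st u\<^sub>0) (int k))"
          unfolding D_def using N w(5) u01 i
          by (intro Bochner_Integration.integral_diff S_integrable tv_le' st_le) auto
        then show ?thesis using expectation_S_stationary[OF u01(2) i] by simp
      qed
      have "\<bar>expectation (S \<alpha> i (tv N) (int k)) - \<phi> i (real k / real N)\<bar> \<le> K2 / real N"
        by (rule K2(2)[OF N w(5,3,2)])
      moreover have "\<bar>\<phi> i (real k / real N) - \<phi> i u\<^sub>0 - \<phi>' u\<^sub>0 * (real k / real N - u\<^sub>0)
          - \<phi>'' u\<^sub>0 * ((real k / real N - u\<^sub>0)\<^sup>2 / 2)\<bar> \<le> K1 * \<bar>real k / real N - u\<^sub>0\<bar> ^ 3"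
        by (rule \<phi>(3)[OF u0 w(3)])
      moreover have "K1 * \<bar>real k / real N - u\<^sub>0\<bar> ^ 3 \<le> \<bar>K1\<bar> * (2 * b) ^ 3"
        using w(1) by (intro mult_mono power_mono) auto
      ultimately have "\<bar>?F k - (\<phi>' u\<^sub>0 * (real k / real N - u\<^sub>0) + \<phi>'' u\<^sub>0 * ((real k / real N - u\<^sub>0)\<^sup>2 / 2))\<bar>
          \<le> K2 / real N + \<bar>K1\<bar> * (2 * b) ^ 3"
        unfolding F by linarith
      also have "\<dots> = K2 * (1 / real N) + 8 * \<bar>K1\<bar> * b ^ 3" by (simp add: power_mult_distrib)
      also have "\<dots> \<le> A * (1 / real N) + A * b ^ 3"
        using b K2(1) N by (intro add_mono mult_right_mono) (auto simp: A_def)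
      finally show "\<bar>?F k - (\<phi>' u\<^sub>0 * (real k / real N - u\<^sub>0) + \<phi>'' u\<^sub>0 * ((real k / real N - u\<^sub>0)\<^sup>2 / 2))\<bar>
          \<le> A * (1 / real N + b ^ 3)" by (simp only: distrib_left)
    next
      show "\<bar>real m / real N - u\<^sub>0\<bar> \<le> 1 / real N" using t by linarith
      show "1 / real N \<le> 1" using N by simp
      show "(\<Sum>k=p+1..N. \<bar>?c k\<bar>) \<le> C" "b * \<bar>\<Sum>k=p+1..N. ?c k * ?x k\<bar> \<le> C * (1 / real N)"
        "b\<^sup>2 * \<bar>(\<Sum>k=p+1..N. ?c k * (?x k)\<^sup>2) - kernel_moment W 2\<bar> \<le> C * (1 / real N)"
        by (rule kernel_constantD[OF C(2) adm])+
      show "0 \<le> b" using b by simp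
      show "finite {p+1..N}" "0 \<le> 1 / real N" by simp_all
    qed
    finally show "\<bar>expectation (gradient_sum W u\<^sub>0 N b m i) - 1 / 2 * b\<^sup>2 * kernel_moment W 2 * \<phi>'' u\<^sub>0\<bar>
        \<le> (\<bar>A\<bar> * C + 2 * \<bar>\<phi>' u\<^sub>0\<bar> * C + 2 * \<bar>\<phi>'' u\<^sub>0\<bar> * C) * (b ^ 3 + 1 / real N)"
      by (simp only: add.commute)
  qed
qed

end

lemma has_second_derivative_cong:
  assumes S: "open S" "x \<in> S" and eq: "\<And>y. y \<in> S \<Longrightarrow> f y = g y" and f: "has_second_derivative f D x"
  shows "has_second_derivative g D x"
proof -
  obtain f' where f': "\<forall>\<^sub>F y in nhds x. (f has_real_derivative f' y) (at y)" "(f' has_real_derivative D) (at x)"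
    using f unfolding has_second_derivative_def by blast
  have "\<forall>\<^sub>F y in nhds x. y \<in> S" using S by (rule eventually_nhds_in_open)
  with f'(1) have "\<forall>\<^sub>F y in nhds x. (g has_real_derivative f' y) (at y)"
  proof eventually_elim
    case (elim y)
    have "\<forall>\<^sub>F z in nhds y. z \<in> S" using S(1) elim(2) by (rule eventually_nhds_in_open)
    then have "\<forall>\<^sub>F z in nhds y. f z = g z" by eventually_elim (rule eq)
    from DERIV_cong_ev[OF refl this refl] elim(1) show ?case by blast
  qed
  with f'(2) show ?thesis unfolding has_second_derivative_def by blast
qed

context tvarch
begin

text \<open>Order count: two weights of order 1 / (b N), about b N indices for one sum, a
  geometrically convergent second sum and a difference of size b give 1 / N in total.\<close>

lemma gradient_sum_variance:
  assumes i: "i \<le> p" and u0: "u\<^sub>0 \<in> {0<..<1}"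
    and W: "kernel_function W"
  obtains C b\<^sub>0 where "0 \<le> C" "0 < b\<^sub>0"
    "\<And>N b m. admissible u\<^sub>0 p N b m \<Longrightarrow> b \<le> b\<^sub>0 \<Longrightarrow>
      expectation (\<lambda>\<omega>. (gradient_sum W u\<^sub>0 N b m i \<omega>)\<^sup>2) - (expectation (gradient_sum W u\<^sub>0 N b m i))\<^sup>2
        \<le> C * (1 / real N)"
proof -
  obtain C where C: "0 \<le> C" "kernel_constant W C" using kernel_window_sums[OF W] .
  have "0 < u\<^sub>0 / 2" using u0 by simp
  then obtain K' where "window_constant (u\<^sub>0 / 2) K'" using Y_difference_window by blast
  note K' = window_constantD[OF this]
  obtain K where "cov_constant \<alpha> K" using score_difference_covariance[where \<alpha> = \<alpha> and r = r, OF r \<alpha>_r] by blast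
  then have K: "0 \<le> K"
    "\<And>\<eta> i c c' k l. i \<le> p \<Longrightarrow> coeff_le p q c l \<Longrightarrow> coeff_le p q c' l \<Longrightarrow> k \<le> l \<Longrightarrow> 0 \<le> \<eta> \<Longrightarrow> \<eta> \<le> 1 \<Longrightarrow>
      AE \<omega> in M. \<forall>j\<le>p. \<bar>Y c (k - int j) \<omega> - Y c' (k - int j) \<omega>\<bar> \<le> \<eta> * V (k - int j) \<omega> \<Longrightarrow>
      \<bar>cov (D \<alpha> i c c' k) (D \<alpha> i c c' l)\<bar> \<le> K * \<eta> * (1 / lam) ^ ((nat (l - k) - 1) div p)"
    unfolding cov_constant_def by blast+
  \<comment> \<open>With 1 / N \<le> b, the approximation rate 2 * b + (p + 1) / N is at most (p +
    3) * b.\<close>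
  define K'' where "K'' = K' * (real p + 3)"
  have K'': "0 \<le> K''" using K'(1) by (simp add: K''_def)
  define B where "B = 1 + real p / (1 - 1 / lam)"
  have B: "0 \<le> B" using lam by (simp add: B_def)
  define g where "g d = (1 / lam) ^ ((d - 1) div p)" for d
  have g0: "0 \<le> g d" for d using lam by (simp add: g_def)
  have gB: "(\<Sum>d\<le>n. g d) \<le> B" for n
    unfolding g_def B_def by (rule sum_geometric_div_le) (use lam p in auto)
  show thesis
  \<comment> \<open>The bound on b makes the rate \<eta> = K'' * b at most 1, as
    \<open>cov_constant\<close> requires.\<close>
  proof (rule that[of "4 * C * C * K * K'' * B" "1 / (K'' + 1)"])
    show "0 \<le> 4 * C * C * K * K'' * B" using C(1) K(1) K'' B by simp
    show "0 < 1 / (K'' + 1)" using K'' by simp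
  next
    fix N b m assume adm: "admissible u\<^sub>0 p N b m" and b0: "b \<le> 1 / (K'' + 1)"
    have N: "1 \<le> N" and b: "0 < b" using adm by (auto simp: admissible_def)
    have u01: "u\<^sub>0 \<in> {0..1}" using u0 by auto
    define h where "h = b * real N"
    have h: "0 < h" using b N by (simp add: h_def)
    define c where "c = kernel_weight W b N m"
    define A where "A k = D \<alpha> i (tv N) (st u\<^sub>0) (int k)" for k
    define I where "I = {k \<in> {p+1..N}. W (kernel_arg b N m k) \<noteq> 0}"
    define \<eta> where "\<eta> = K'' * b"
    have \<eta>0: "0 \<le> \<eta>" using K'' b by (simp add: \<eta>_def)
    have \<eta>1: "\<eta> \<le> 1"
    proof -
      have "\<eta> \<le> K'' * (1 / (K'' + 1))" unfolding \<eta>_def using b0 K'' by (rule mult_left_mono)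
      also have "\<dots> \<le> 1" using K'' by simp
      finally show ?thesis .
    qed
    have iA: "integrable M (A k)" if "k \<le> N" for k
      unfolding A_def using that by (rule D_integrable[OF i N _ u01])
    have iAA: "integrable M (\<lambda>\<omega>. A k \<omega> * A l \<omega>)" if "k \<le> N" "l \<le> N" for k l
      unfolding A_def by (rule D_product_integrable[OF i N that u01])
    have gs: "gradient_sum W u\<^sub>0 N b m i = (\<lambda>\<omega>. \<Sum>k=p+1..N. c k * A k \<omega>)"
      by (simp add: gradient_sum_def[abs_def] c_def A_def)
    have E1: "expectation (gradient_sum W u\<^sub>0 N b m i) = (\<Sum>k=p+1..N. c k * expectation (A k))"
      unfolding gs using iA by (subst Bochner_Integration.integral_sum) auto
    have "expectation (\<lambda>\<omega>. (gradient_sum W u\<^sub>0 N b m i \<omega>)\<^sup>2)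
        = expectation (\<lambda>\<omega>. \<Sum>k=p+1..N. \<Sum>l=p+1..N. (c k * c l) * (A k \<omega> * A l \<omega>))"
      unfolding gs power2_eq_square sum_product by (intro arg_cong[where f = expectation] ext sum.cong refl) (simp only: mult_ac)
    also have "\<dots> = (\<Sum>k=p+1..N. \<Sum>l=p+1..N. (c k * c l) * expectation (\<lambda>\<omega>. A k \<omega> * A l \<omega>))"
    proof -
      have "expectation (\<lambda>\<omega>. \<Sum>l=p+1..N. (c k * c l) * (A k \<omega> * A l \<omega>))
          = (\<Sum>l=p+1..N. (c k * c l) * expectation (\<lambda>\<omega>. A k \<omega> * A l \<omega>))" if "k \<le> N" for k
        using iAA[OF that] by (subst Bochner_Integration.integral_sum) auto
      moreover have "integrable M (\<lambda>\<omega>. \<Sum>l=p+1..N. (c k * c l) * (A k \<omega> * A l \<omega>))" if "k \<le> N" for k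
        using iAA[OF that] by (intro Bochner_Integration.integrable_sum integrable_mult_right) auto
      ultimately show ?thesis by (subst Bochner_Integration.integral_sum) auto
    qed
    finally have E2: "expectation (\<lambda>\<omega>. (gradient_sum W u\<^sub>0 N b m i \<omega>)\<^sup>2)
        = (\<Sum>k=p+1..N. \<Sum>l=p+1..N. (c k * c l) * expectation (\<lambda>\<omega>. A k \<omega> * A l \<omega>))" .
    have "expectation (\<lambda>\<omega>. (gradient_sum W u\<^sub>0 N b m i \<omega>)\<^sup>2) - (expectation (gradient_sum W u\<^sub>0 N b m i))\<^sup>2
        = (\<Sum>k=p+1..N. \<Sum>l=p+1..N. (c k * c l) * cov (A k) (A l))"
      unfolding E1 E2 unfolding power2_eq_square sum_product cov_def
      by (simp add: sum_subtractf right_diff_distrib mult_ac)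
    also have "\<dots> = (\<Sum>k\<in>I. \<Sum>l=p+1..N. (c k * c l) * cov (A k) (A l))"
      by (rule sum.mono_neutral_right) (auto simp: I_def c_def kernel_weight_def)
    also have "\<dots> = (\<Sum>k\<in>I. \<Sum>l\<in>I. (c k * c l) * cov (A k) (A l))"
      by (intro sum.cong refl sum.mono_neutral_right) (auto simp: I_def c_def kernel_weight_def)
    also have "\<dots> \<le> (\<Sum>k\<in>I. \<Sum>l\<in>I. (C / h * (C / h) * (K * \<eta>)) * g (if k \<le> l then l - k else k - l))"
    proof (intro sum_mono)
      fix k l assume kI: "k \<in> I" and lI: "l \<in> I"
      have cov_le: "\<bar>cov (A k) (A l)\<bar> \<le> K * \<eta> * g (l - k)" if kl: "k \<le> l" "k \<in> I" "l \<in> I" for k l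
      proof -
        have "\<bar>real m - real k\<bar> \<le> b * real N / 2"
          using kl(2) by (intro kernel_constantD(5)[OF C(2) adm]) (simp add: I_def)
        note w = admissible_window[OF adm this]
        have lN: "l \<le> N" using kl(3) by (simp add: I_def)
        have bN: "1 / real N \<le> b" using adm N by (simp add: admissible_def divide_le_eq)
        have "2 * b + (real p + 1) / real N = 2 * b + (real p + 1) * (1 / real N)" by simp
        also have "\<dots> \<le> 2 * b + (real p + 1) * b" using bN by (intro add_left_mono mult_left_mono) auto
        also have "\<dots> = (real p + 3) * b" by (simp add: algebra_simps)
        finally have "K' * (2 * b + (real p + 1) / real N) \<le> K' * ((real p + 3) * b)"
          using K'(1) by (rule mult_left_mono)
        then have le\<eta>: "K' * (2 * b + (real p + 1) / real N) \<le> \<eta>" by (simp add: \<eta>_def K''_def mult.assoc)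
        have "AE \<omega> in M. \<forall>j\<le>p. \<bar>Y (tv N) (int k - int j) \<omega> - Y (st u\<^sub>0) (int k - int j) \<omega>\<bar>
            \<le> \<eta> * V (int k - int j) \<omega>"
          using K'(2)[OF N u01 w(5,2,1)] AE_V_le_G
        proof eventually_elim
          case (elim \<omega>)
          show ?case
          proof (intro allI impI)
            fix j assume j: "j \<le> p"
            have "0 \<le> V (int k - int j) \<omega>" using elim(2) j by blast
            with le\<eta> have "K' * (2 * b + (real p + 1) / real N) * V (int k - int j) \<omega> \<le> \<eta> * V (int k - int j) \<omega>"
              by (rule mult_right_mono)
            moreover have "\<bar>Y (tv N) (int k - int j) \<omega> - Y (st u\<^sub>0) (int k - int j) \<omega>\<bar>
              \<le> K' * (2 * b + (real p + 1) / real N) * V (int k - int j) \<omega>" using elim(1) j by blast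
            ultimately show "\<bar>Y (tv N) (int k - int j) \<omega> - Y (st u\<^sub>0) (int k - int j) \<omega>\<bar>
              \<le> \<eta> * V (int k - int j) \<omega>" by (rule order_trans[rotated])
          qed
        qed
        then have "\<bar>cov (A k) (A l)\<bar> \<le> K * \<eta> * (1 / lam) ^ ((nat (int l - int k) - 1) div p)"
          unfolding A_def using kl(1) lN
          by (intro K(2) i tv_le' N st_le u01 \<eta>0 \<eta>1) auto
        then show ?thesis using kl(1) by (simp add: g_def nat_diff_distrib)
      qed
      have sym: "cov (A k) (A l) = cov (A l) (A k)" unfolding cov_def by (simp add: mult.commute)
      have "\<bar>cov (A k) (A l)\<bar> \<le> K * \<eta> * g (if k \<le> l then l - k else k - l)"
        using cov_le[of k l] cov_le[of l k] kI lI by (simp add: sym)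
      moreover have "\<bar>c k\<bar> \<le> C / h" for k unfolding c_def h_def by (rule kernel_constantD(4)[OF C(2) adm])
      ultimately have "\<bar>c k * c l * cov (A k) (A l)\<bar> \<le> C / h * (C / h) * (K * \<eta> * g (if k \<le> l then l - k else k - l))"
        unfolding abs_mult using C(1) h by (intro mult_mono) auto
      then show "c k * c l * cov (A k) (A l) \<le> C / h * (C / h) * (K * \<eta>) * g (if k \<le> l then l - k else k - l)"
        by (simp only: mult.assoc)
    qed
    also have "\<dots> = (C / h * (C / h) * (K * \<eta>)) * (\<Sum>k\<in>I. \<Sum>l\<in>I. g (if k \<le> l then l - k else k - l))"
      by (simp only: sum_distrib_left)
    also have "\<dots> \<le> (C / h * (C / h) * (K * \<eta>)) * (2 * h * (2 * B))"
    proof (rule mult_left_mono)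
      have "(\<Sum>k\<in>I. \<Sum>l\<in>I. g (if k \<le> l then l - k else k - l)) \<le> real (card I) * (2 * B)"
        by (rule sum_abs_diff_le[OF _ g0 gB]) (simp add: I_def)
      also have "\<dots> \<le> 2 * h * (2 * B)"
        using kernel_constantD(6)[OF C(2) adm] B by (intro mult_right_mono) (auto simp: I_def h_def)
      finally show "(\<Sum>k\<in>I. \<Sum>l\<in>I. g (if k \<le> l then l - k else k - l)) \<le> 2 * h * (2 * B)" .
      show "0 \<le> C / h * (C / h) * (K * \<eta>)" using K(1) \<eta>0 by simp
    qed
    also have "\<dots> = 4 * C * C * K * K'' * B * (b / h)"
      unfolding \<eta>_def using h by (simp add: field_simps)
    also have "b / h = 1 / real N" using b by (simp add: h_def)
    finally show "expectation (\<lambda>\<omega>. (gradient_sum W u\<^sub>0 N b m i \<omega>)\<^sup>2)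
        - (expectation (gradient_sum W u\<^sub>0 N b m i))\<^sup>2 \<le> 4 * C * C * K * K'' * B * (1 / real N)" .
  qed
qed

section \<open>Return from the series to the given processes\<close>

lemma grad_bias_B_eq':
  "i \<le> p \<Longrightarrow> grad_bias_B p W b N m x y \<alpha> i \<omega> =
    (\<Sum>k=p+1..N. 1 / (b * real N) * W ((real m - real k) / (b * real N)) *
        (score p \<alpha> i (lag_squares (\<lambda>s. x s \<omega>) (int k)) - score p \<alpha> i (lag_squares (\<lambda>s. y s \<omega>) (int k))))"
  by (rule grad_bias_B_eq[OF r]) (erule \<alpha>_r)

lemma grad_bias_B_AE:
  assumes i: "i \<le> p" and N: "1 \<le> N" and u: "u \<in> {0<..1}"
  shows "AE \<omega> in M. grad_bias_B p W b N m (X N) (Xs u) \<alpha> i \<omega> = gradient_sum W u N b m i \<omega>"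
  using lag_squares_X[OF N] lag_squares_Xs[OF u]
proof eventually_elim
  case (elim \<omega>)
  show ?case
    unfolding grad_bias_B_eq'[OF i] gradient_sum_def kernel_weight_def kernel_arg_def D_def S_def
    by (intro sum.cong refl) (use elim in simp)
qed

lemma grad_bias_B_measurable:
  assumes i: "i \<le> p" and N: "1 \<le> N" and u: "u \<in> {0<..1}"
  shows "grad_bias_B p W b N m (X N) (Xs u) \<alpha> i \<in> borel_measurable M"
proof -
  have x: "(\<lambda>\<omega>. score p \<alpha> i (lag_squares (\<lambda>s. X N s \<omega>) (int k))) \<in> borel_measurable M" if "k \<le> N" for k
    unfolding lag_squares_def using that
    by (intro score_measurable borel_measurable_power X_measurable N) auto
  have y: "(\<lambda>\<omega>. score p \<alpha> i (lag_squares (\<lambda>s. Xs u s \<omega>) k)) \<in> borel_measurable M" for k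
    unfolding lag_squares_def
    by (intro score_measurable borel_measurable_power Xs_measurable u)
  show ?thesis
    unfolding grad_bias_B_eq'[OF i, abs_def]
    by (intro borel_measurable_sum borel_measurable_times borel_measurable_diff borel_measurable_const x y) simp
qed

lemma grad_bias_B_moments:
  assumes i: "i \<le> p" and N: "1 \<le> N" and u: "u \<in> {0<..1}"
  shows "integrable M (grad_bias_B p W b N m (X N) (Xs u) \<alpha> i)"
    "integrable M (\<lambda>\<omega>. (grad_bias_B p W b N m (X N) (Xs u) \<alpha> i \<omega>)\<^sup>2)"
    "expectation (grad_bias_B p W b N m (X N) (Xs u) \<alpha> i) = expectation (gradient_sum W u N b m i)"
    "expectation (\<lambda>\<omega>. (grad_bias_B p W b N m (X N) (Xs u) \<alpha> i \<omega>)\<^sup>2)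
      = expectation (\<lambda>\<omega>. (gradient_sum W u N b m i \<omega>)\<^sup>2)"
proof -
  note meas [measurable] = grad_bias_B_measurable[OF i N u, of W b m]
  have "u \<in> {0..1}" using u by auto
  note int = gradient_sum_integrable[OF i N this, of W b m]
  note ae = grad_bias_B_AE[OF i N u, of W b m]
  have meas': "gradient_sum W u N b m i \<in> borel_measurable M" using int(1) by simp
  have ae2: "AE \<omega> in M. (grad_bias_B p W b N m (X N) (Xs u) \<alpha> i \<omega>)\<^sup>2 = (gradient_sum W u N b m i \<omega>)\<^sup>2"
    using ae by eventually_elim simp
  show "integrable M (grad_bias_B p W b N m (X N) (Xs u) \<alpha> i)"
    by (rule integrable_cong_AE[THEN iffD2, OF meas meas' ae int(1)])
  show "integrable M (\<lambda>\<omega>. (grad_bias_B p W b N m (X N) (Xs u) \<alpha> i \<omega>)\<^sup>2)"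
    by (rule integrable_cong_AE[THEN iffD2, OF _ _ ae2 int(2)]) (use meas' in measurable)
  show "expectation (grad_bias_B p W b N m (X N) (Xs u) \<alpha> i) = expectation (gradient_sum W u N b m i)"
    by (rule integral_cong_AE[OF meas meas' ae])
  show "expectation (\<lambda>\<omega>. (grad_bias_B p W b N m (X N) (Xs u) \<alpha> i \<omega>)\<^sup>2)
      = expectation (\<lambda>\<omega>. (gradient_sum W u N b m i \<omega>)\<^sup>2)"
    by (rule integral_cong_AE[OF _ _ ae2]) (use meas' in measurable)
qed

end

section \<open>Conclusion\<close>

lemma bigo_iff_eventually_le:
  fixes f g :: "nat \<Rightarrow> real"
  assumes "\<forall>\<^sub>F n in sequentially. \<bar>f n\<bar> \<le> C * \<bar>g n\<bar>"
  shows "f \<in> O(g)"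
  using assms by (intro bigoI[of _ C]) simp

text \<open>This fixes the inflation 1 + \<nu> and the weight of the constant term. After
  multiplication by the sixth root of m, the lags contribute at most (1 + \<nu>) * (1 - \<nu>) = 1 -
  \<nu> ^ 2, and the weight is chosen to use up no more than the remaining \<nu> ^ 2. The summand 1
  in its denominator keeps it well defined for m = 0.\<close>

lemma dom_contraction:
  fixes m s \<nu> :: real
  assumes "0 \<le> m" "0 \<le> s" "m powr (1/6) * s \<le> 1 - \<nu>" "0 < \<nu>" "\<nu> < 1"
  shows "m * (\<nu>\<^sup>2 / (m powr (1/6) + 1) + (1 + \<nu>) * s) ^ 6 \<le> 1"
proof -
  let ?r = "m powr (1/6)"
  have r: "0 \<le> ?r" by simp
  have r6: "?r ^ 6 = m"
  proof (cases "m = 0")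
    case False
    then have "?r ^ 6 = ?r powr real 6" by (subst powr_realpow) auto
    also have "\<dots> = m" using False assms(1) by (simp add: powr_powr)
    finally show ?thesis .
  qed simp
  have "?r * (\<nu>\<^sup>2 / (?r + 1)) \<le> \<nu>\<^sup>2"
  proof -
    have "?r * (\<nu>\<^sup>2 / (?r + 1)) = \<nu>\<^sup>2 * (?r / (?r + 1))" by simp
    also have "\<dots> \<le> \<nu>\<^sup>2 * 1"
    proof (rule mult_left_mono)
      show "?r / (?r + 1) \<le> 1" using r by (subst divide_le_eq_1_pos) (auto intro: add_nonneg_pos)
    qed simp
    finally show ?thesis by simp
  qed
  moreover have "(1 + \<nu>) * (?r * s) \<le> (1 + \<nu>) * (1 - \<nu>)" using assms by (intro mult_left_mono) auto
  ultimately have "?r * (\<nu>\<^sup>2 / (?r + 1) + (1 + \<nu>) * s) \<le> \<nu>\<^sup>2 + (1 + \<nu>) * (1 - \<nu>)"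
    by (simp add: distrib_left mult.left_commute)
  also have "\<dots> = 1" by (simp add: power2_eq_square algebra_simps)
  finally have "(?r * (\<nu>\<^sup>2 / (?r + 1) + (1 + \<nu>) * s)) ^ 6 \<le> 1 ^ 6"
    using assms r by (intro power_mono) auto
  then show ?thesis by (simp add: power_mult_distrib r6)
qed

text \<open>Integrals and \<open>deriv\<close> are total functions. The conclusion therefore also
  asserts that the likelihood, the gradient and its square are integrable and that the partial
  derivatives exist, so that the expansions do not concern default values.\<close>

theorem proposition3:
  fixes P :: "'w measure"
    and Z :: "int \<Rightarrow> 'w \<Rightarrow> real"
    and p :: nat
    and a :: "nat \<Rightarrow> real \<Rightarrow> real"
    and ell :: "nat \<Rightarrow> real"
    and \<delta> \<rho> Q M \<nu> C \<rho>\<^sub>1 \<rho>\<^sub>2 u\<^sub>0 :: real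
    and X :: "nat \<Rightarrow> int \<Rightarrow> 'w \<Rightarrow> real"
    and Xs :: "real \<Rightarrow> int \<Rightarrow> 'w \<Rightarrow> real"
    and W :: "real \<Rightarrow> real"
    and t\<^sub>0 :: "nat \<Rightarrow> nat"
    and b :: "nat \<Rightarrow> real"
  assumes P: "prob_space P"
    and p: "1 \<le> p"
    and Z_indep: "prob_space.indep_vars P (\<lambda>_. borel) Z UNIV"
    and Z_ident: "\<forall>t. distr P borel (Z t) = distr P borel (Z 0)"
    and Z_mean: "\<forall>t. integrable P (Z t) \<and> (\<integral>\<omega>. Z t \<omega> \<partial>P) = 0"
    and Z_var: "\<forall>t. integrable P (\<lambda>\<omega>. (Z t \<omega>)\<^sup>2) \<and> (\<integral>\<omega>. (Z t \<omega>)\<^sup>2 \<partial>P) = 1"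
    and \<delta>: "0 < \<delta>"
    and Z_mom: "\<forall>t. integrable P (\<lambda>\<omega>. \<bar>Z t \<omega>\<bar> powr (4 * (1 + \<delta>)))"
    and Z_density: "\<forall>t. positive_density_near_zero (distr P borel (Z t))"
    and a_nonneg: "\<forall>j\<le>p. \<forall>u\<in>{0..1}. 0 \<le> a j u"
    and const_pos: "0 < \<rho>" "0 < Q" "0 < M" "0 < \<nu>" "\<nu> < 1"
    and ell_pos: "\<forall>j. 0 < ell j"
    and ell_sum: "summable (\<lambda>j. real (Suc j) / ell (Suc j))"
    and a0_inf: "(INF u\<in>{0..1}. a 0 u) > \<rho>"
    and a_bound: "\<forall>j\<le>p. \<forall>u\<in>{0..1}. a j u \<le> Q / ell j"
    and a_lip: "\<forall>j\<le>p. \<forall>u\<in>{0..1}. \<forall>v\<in>{0..1}. \<bar>a j u - a j v\<bar> \<le> M * \<bar>u - v\<bar> / ell j"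
    and Q_sum: "Q * (\<Sum>j. 1 / ell (Suc j)) \<le> 1 - \<nu>"
    and Z12_int: "integrable P (\<lambda>\<omega>. Z 0 \<omega> ^ 12)"
    and Z12: "(\<integral>\<omega>. Z 0 \<omega> ^ 12 \<partial>P) powr (1/6) * (\<Sum>j=1..p. Q / ell j) \<le> 1 - \<nu>"
    and a_derivs: "\<forall>j\<le>p. bounded_derivs_on (a j) {0..1} 3 C"
    and \<rho>12: "0 < \<rho>\<^sub>1" "\<rho>\<^sub>1 \<le> \<rho>\<^sub>2"
    and a_int: "\<forall>u\<in>{0<..1}. (\<lambda>j. a j u) \<in> interior (Omega p \<rho>\<^sub>1 \<rho>\<^sub>2)"
    and X: "\<forall>N\<ge>1. tvarch_process P p a Z N (X N)"
    and Xs: "\<forall>u\<in>{0<..1}. stationary_arch_process P p a Z u (Xs u)"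
    and W_zero: "\<forall>x. x \<notin> {-1/2..1/2} \<longrightarrow> W x = 0"
    and W_bv: "bounded_variation_on W {-1/2..1/2}"
    and W_int: "integral {-1/2..1/2} W = 1"
    and W_mom: "integral {-1/2..1/2} (\<lambda>x. W x * x) = 0"
    and u0: "u\<^sub>0 \<in> {0<..<1}"
    and t0: "\<forall>N\<ge>1. \<bar>u\<^sub>0 - real (t\<^sub>0 N) / real N\<bar> < 1 / real N"
    and b_lim: "b \<longlonglongrightarrow> 0"
    and bN_lim: "filterlim (\<lambda>N. b N * real N) at_top sequentially"
  shows "let au0 = (\<lambda>j. a j u\<^sub>0);
             gradB = (\<lambda>N. grad_bias_B p W (b N) N (t\<^sub>0 N) (X N) (Xs u\<^sub>0) au0)
    in (\<forall>u\<in>{0<..1}. \<forall>\<alpha>\<in>Omega p \<rho>\<^sub>1 \<rho>\<^sub>2. integrable P (\<lambda>\<omega>. arch_l p (\<lambda>s. Xs u s \<omega>) 0 \<alpha>))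
     \<and> (\<forall>u\<in>{0<..1}. \<forall>i\<le>p. has_partial_deriv i (limit_L P p Xs u) au0)
     \<and> (\<forall>N\<ge>1. \<forall>i\<le>p.
          (\<forall>\<omega>\<in>space P. has_partial_deriv i
             (bias_B p W (b N) N (t\<^sub>0 N) (\<lambda>s. X N s \<omega>) (\<lambda>s. Xs u\<^sub>0 s \<omega>)) au0) \<and>
          integrable P (gradB N i) \<and> integrable P (\<lambda>\<omega>. (gradB N i \<omega>)\<^sup>2))
     \<and> (\<forall>i\<le>p. \<exists>D.
          has_second_derivative (\<lambda>u. partial_deriv i (limit_L P p Xs u) au0) D u\<^sub>0 \<and>
          (\<lambda>N. (\<integral>\<omega>. gradB N i \<omega> \<partial>P) - 1/2 * (b N)\<^sup>2 * kernel_moment W 2 * D)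
            \<in> O(\<lambda>N. b N ^ 3 + 1 / real N))
     \<and> (\<forall>i\<le>p. \<forall>j\<le>p.
          (\<lambda>N. covar P (gradB N i) (gradB N j)) \<in> O(\<lambda>N. b N ^ 6 + 1 / real N))"
proof -
  interpret prob_space P by (rule P)
  define q where "q j = Q / ell j" for j
  define lam where "lam = 1 + \<nu>"
  define m12 where "m12 = expectation (\<lambda>\<omega>. Z 0 \<omega> ^ 12)"
  define \<beta> where "\<beta> = \<nu>\<^sup>2 / (m12 powr (1/6) + 1)"
  \<comment> \<open>Since q j = Q / ell j, the Lipschitz constant M / ell j equals q j * (M /
    Q).\<close>
  define L where "L = M / Q"
  \<comment> \<open>Large enough that C \<le> q j * B for every j up to p, and at least 1, as
    \<open>bounded_derivs_imp_jet\<close> requires.\<close>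
  define B where "B = 1 + (\<Sum>j\<le>p. \<bar>C\<bar> / q j)"
  \<comment> \<open>Half of the lower bound of the parameter set leaves room for varying a
    coordinate on both sides.\<close>
  define r where "r = \<rho>\<^sub>1 / 2"
  define \<alpha> where "\<alpha> = (\<lambda>j. a j u\<^sub>0)"
  have q: "0 < q j" for j using const_pos ell_pos by (simp add: q_def)
  have \<beta>: "0 < \<beta>" unfolding \<beta>_def using const_pos by (intro divide_pos_pos add_nonneg_pos) auto
  have m12: "0 \<le> m12" unfolding m12_def by simp
  have rv [measurable]: "Z t \<in> borel_measurable P" for t
    using Z_indep by (auto simp: indep_vars_def)
  have Zt: "integrable P (\<lambda>\<omega>. Z t \<omega> ^ 12) \<and> expectation (\<lambda>\<omega>. Z t \<omega> ^ 12) = m12" for t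
  proof -
    \<comment> \<open>The twelfth moment is given at time 0 only; equality of the laws carries it to
      every time.\<close>
    have i: "integrable (distr P borel (Z s)) (\<lambda>x. x ^ 12) \<longleftrightarrow> integrable P (\<lambda>\<omega>. Z s \<omega> ^ 12)" for s
      by (rule integrable_distr_eq) measurable
    have e: "integral\<^sup>L (distr P borel (Z s)) (\<lambda>x. x ^ 12) = expectation (\<lambda>\<omega>. Z s \<omega> ^ 12)" for s
      by (rule integral_distr) measurable
    have d: "distr P borel (Z t) = distr P borel (Z 0)" using Z_ident by blast
    show ?thesis using i[of t] i[of 0] e[of t] e[of 0] Z12_int unfolding d m12_def by simp
  qed
  have "m12 * (\<beta> + (1 + \<nu>) * (\<Sum>j=1..p. q j)) ^ 6 \<le> 1"
    unfolding \<beta>_def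
    using Z12 unfolding m12_def[symmetric] q_def[symmetric]
    by (rule dom_contraction[OF m12 _ _ const_pos(4,5), rotated]) (intro sum_nonneg less_imp_le q)
  then have contr: "m12 * (\<beta> + (\<Sum>j=1..p. lam * q j)) ^ 6 \<le> 1"
    by (simp add: lam_def sum_distrib_left)
  have r: "0 < r" using \<rho>12 by (simp add: r_def)
  have "\<alpha> \<in> Omega p \<rho>\<^sub>1 \<rho>\<^sub>2"
    unfolding \<alpha>_def using a_int u0 interior_subset by (metis greaterThanAtMost_iff greaterThanLessThan_iff less_imp_le subsetD)
  then have \<alpha>: "2 * r \<le> \<alpha> j" if "j \<le> p" for j
    using that by (cases "j = 0") (auto simp: Omega_def r_def)
  interpret tvarch P Z p q lam "(q 0 / \<beta>) ^ 6" a L B r \<alpha> X Xs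
  proof
    show "indep_vars (\<lambda>_. borel) Z UNIV" by (rule Z_indep)
    show "1 \<le> p" by (rule p)
    show "1 < lam" using const_pos by (simp add: lam_def)
    show "0 \<le> q j" for j using q[of j] by simp
    show "integrable P (\<lambda>\<omega>. (\<Sum>n<m. arch_level p (dom_coeff lam q) (\<lambda>s. Z s \<omega>) n t) ^ 6) \<and>
      expectation (\<lambda>\<omega>. (\<Sum>n<m. arch_level p (dom_coeff lam q) (\<lambda>s. Z s \<omega>) n t) ^ 6) \<le> (q 0 / \<beta>) ^ 6" for m t
      by (rule dom_partial_moment[OF Z_indep _ _ _ _ \<beta> contr]) (use Zt q const_pos in \<open>auto simp: lam_def less_imp_le\<close>)
    show "0 \<le> a j u \<and> a j u \<le> q j" if "j \<le> p" "u \<in> {0..1}" for j u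
      using that a_nonneg a_bound by (simp add: q_def)
    show "\<bar>a j u - a j v\<bar> \<le> q j * (L * \<bar>u - v\<bar>)" if "j \<le> p" "u \<in> {0..1}" "v \<in> {0..1}" for j u v
    proof -
      have "\<bar>a j u - a j v\<bar> \<le> M * \<bar>u - v\<bar> / ell j" using a_lip that by blast
      then show ?thesis using const_pos by (simp add: q_def L_def)
    qed
    show "0 \<le> L" using const_pos by (simp add: L_def)
    have S0: "0 \<le> (\<Sum>j\<le>p. \<bar>C\<bar> / q j)" by (intro sum_nonneg divide_nonneg_pos q) simp
    show "0 \<le> B" using S0 by (simp add: B_def)
    show "jet {0<..<1} (a j) (q j) B" if j: "j \<le> p" for j
    proof (rule bounded_derivs_imp_jet)
      show "bounded_derivs_on (a j) {0..1} 3 C" using a_derivs j by blast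
      show "\<bar>a j u\<bar> \<le> q j" if "u \<in> {0..1}" for u
        using that j a_nonneg a_bound by (simp add: q_def)
      show "1 \<le> B" using S0 by (simp add: B_def)
      show "0 \<le> q j" using q[of j] by simp
      have "\<bar>C\<bar> / q j \<le> (\<Sum>j\<le>p. \<bar>C\<bar> / q j)"
        using j q by (intro member_le_sum) (auto intro: divide_nonneg_pos)
      then have "\<bar>C\<bar> / q j \<le> B" by (simp add: B_def)
      then have "\<bar>C\<bar> \<le> q j * B" using q[of j] by (simp add: pos_divide_le_eq mult.commute)
      then show "C \<le> q j * B" by linarith
    qed
    show "0 < r" by (rule r)
    show "2 * r \<le> \<alpha> j" if "j \<le> p" for j by (rule \<alpha>[OF that])
    show "tvarch_process P p a Z N (X N)" if "1 \<le> N" for N using X that by blast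
    show "stationary_arch_process P p a Z u (Xs u)" if "u \<in> {0<..1}" for u using Xs that by blast
  qed
  have W: "kernel_function W" unfolding kernel_function_def using W_bv W_zero W_int W_mom by blast
  have u01: "u\<^sub>0 \<in> {0<..1}" using u0 by simp
  define gradB where "gradB = (\<lambda>N. grad_bias_B p W (b N) N (t\<^sub>0 N) (X N) (Xs u\<^sub>0) \<alpha>)"
  note adm = eventually_admissible[OF u0 t0 b_lim bN_lim, of p]
  have moments: "integrable P (gradB N i)" "integrable P (\<lambda>\<omega>. (gradB N i \<omega>)\<^sup>2)"
    "expectation (gradB N i) = expectation (gradient_sum W u\<^sub>0 N (b N) (t\<^sub>0 N) i)"
    "expectation (\<lambda>\<omega>. (gradB N i \<omega>)\<^sup>2) = expectation (\<lambda>\<omega>. (gradient_sum W u\<^sub>0 N (b N) (t\<^sub>0 N) i \<omega>)\<^sup>2)"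
    if "i \<le> p" "1 \<le> N" for i N
    unfolding gradB_def by (rule grad_bias_B_moments[OF that u01])+
  have partial: "partial_deriv i (limit_L P p Xs u) \<alpha> = \<phi> i u" if "u \<in> {0<..1}" "i \<le> p" for u i
    unfolding partial_deriv_def by (rule DERIV_imp_deriv[OF limit_L_has_partial_deriv[OF that]])
  have 1: "integrable P (\<lambda>\<omega>. arch_l p (\<lambda>s. Xs u s \<omega>) 0 \<alpha>')"
    if "u \<in> {0<..1}" "\<alpha>' \<in> Omega p \<rho>\<^sub>1 \<rho>\<^sub>2" for u \<alpha>'
  proof (rule arch_l_integrable[OF that(1) \<rho>12(1)])
    show "\<rho>\<^sub>1 \<le> \<alpha>' j" if "j \<le> p" for j
      using that \<open>\<alpha>' \<in> Omega p \<rho>\<^sub>1 \<rho>\<^sub>2\<close> by (cases "j = 0") (auto simp: Omega_def)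
  qed
  have 2: "has_partial_deriv i (limit_L P p Xs u) \<alpha>" if "u \<in> {0<..1}" "i \<le> p" for u i
    unfolding has_partial_deriv_def real_differentiable_def
    by (rule exI, rule limit_L_has_partial_deriv[OF that])
  have 3: "has_partial_deriv i (bias_B p W (b N) N (t\<^sub>0 N) x y) \<alpha>" if "i \<le> p" for i N x y
    unfolding has_partial_deriv_def real_differentiable_def
    by (rule exI, rule bias_B_has_partial_deriv[OF r _ that]) (erule \<alpha>_r)
  have 4: "\<exists>D. has_second_derivative (\<lambda>u. partial_deriv i (limit_L P p Xs u) \<alpha>) D u\<^sub>0 \<and>
      (\<lambda>N. expectation (gradB N i) - 1/2 * (b N)\<^sup>2 * kernel_moment W 2 * D) \<in> O(\<lambda>N. b N ^ 3 + 1 / real N)"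
    if i: "i \<le> p" for i
  proof -
    obtain D2 C' where D2: "has_second_derivative (\<phi> i) D2 u\<^sub>0" "0 \<le> C'"
      "\<And>N b m. admissible u\<^sub>0 p N b m \<Longrightarrow>
        \<bar>expectation (gradient_sum W u\<^sub>0 N b m i) - 1 / 2 * b\<^sup>2 * kernel_moment W 2 * D2\<bar> \<le> C' * (b ^ 3 + 1 / real N)"
      by (rule gradient_sum_mean[OF i u0 W]) (rule that)
    have "has_second_derivative (\<lambda>u. partial_deriv i (limit_L P p Xs u) \<alpha>) D2 u\<^sub>0"
      by (rule has_second_derivative_cong[OF _ u0 _ D2(1)]) (use partial i in auto)
    moreover have "(\<lambda>N. expectation (gradB N i) - 1/2 * (b N)\<^sup>2 * kernel_moment W 2 * D2) \<in> O(\<lambda>N. b N ^ 3 + 1 / real N)"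
    proof (rule bigo_iff_eventually_le[where C = C'])
      show "\<forall>\<^sub>F N in sequentially. \<bar>expectation (gradB N i) - 1/2 * (b N)\<^sup>2 * kernel_moment W 2 * D2\<bar>
          \<le> C' * \<bar>b N ^ 3 + 1 / real N\<bar>"
        using adm
      proof eventually_elim
        case (elim N)
        have "1 \<le> N" "0 < b N" using elim by (auto simp: admissible_def)
        then have "\<bar>b N ^ 3 + 1 / real N\<bar> = b N ^ 3 + 1 / real N" by (intro abs_of_nonneg) simp
        then show ?case using D2(3)[OF elim] moments(3)[OF i \<open>1 \<le> N\<close>] by (simp only:)
      qed
    qed
    ultimately show ?thesis by blast
  qed
  have 5: "(\<lambda>N. covar P (gradB N i) (gradB N j)) \<in> O(\<lambda>N. b N ^ 6 + 1 / real N)" if i: "i \<le> p" and j: "j \<le> p" for i j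
  proof -
    obtain C1 b1 where C1: "0 \<le> C1" "0 < b1"
      "\<And>N b m. admissible u\<^sub>0 p N b m \<Longrightarrow> b \<le> b1 \<Longrightarrow>
        expectation (\<lambda>\<omega>. (gradient_sum W u\<^sub>0 N b m i \<omega>)\<^sup>2) - (expectation (gradient_sum W u\<^sub>0 N b m i))\<^sup>2
          \<le> C1 * (1 / real N)"
      by (rule gradient_sum_variance[OF i u0 W]) (rule that)
    obtain C2 b2 where C2: "0 \<le> C2" "0 < b2"
      "\<And>N b m. admissible u\<^sub>0 p N b m \<Longrightarrow> b \<le> b2 \<Longrightarrow>
        expectation (\<lambda>\<omega>. (gradient_sum W u\<^sub>0 N b m j \<omega>)\<^sup>2) - (expectation (gradient_sum W u\<^sub>0 N b m j))\<^sup>2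
          \<le> C2 * (1 / real N)"
      by (rule gradient_sum_variance[OF j u0 W]) (rule that)
    have small: "\<forall>\<^sub>F N in sequentially. b N < b1" "\<forall>\<^sub>F N in sequentially. b N < b2"
      using C1(2) C2(2) by (auto intro: order_tendstoD(2)[OF b_lim])
    show ?thesis
    proof (rule bigo_iff_eventually_le[where C = "C1 + C2"])
      show "\<forall>\<^sub>F N in sequentially. \<bar>covar P (gradB N i) (gradB N j)\<bar> \<le> (C1 + C2) * \<bar>b N ^ 6 + 1 / real N\<bar>"
        using adm small
      proof eventually_elim
        case (elim N)
        have N: "1 \<le> N" and b: "0 < b N" using elim(1) by (auto simp: admissible_def)
        have "\<bar>covar P (gradB N i) (gradB N j)\<bar>
          \<le> 1 / 2 * ((expectation (\<lambda>\<omega>. (gradB N i \<omega>)\<^sup>2) - (expectation (gradB N i))\<^sup>2)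
            + (expectation (\<lambda>\<omega>. (gradB N j \<omega>)\<^sup>2) - (expectation (gradB N j))\<^sup>2))"
          by (rule abs_covar_le[OF P moments(1)[OF i N] moments(1)[OF j N] moments(2)[OF i N] moments(2)[OF j N]])
        also have "\<dots> \<le> 1 / 2 * (C1 * (1 / real N) + C2 * (1 / real N))"
          unfolding moments(3)[OF i N] moments(4)[OF i N] moments(3)[OF j N] moments(4)[OF j N]
          using elim by (intro mult_left_mono add_mono C1(3) C2(3)) auto
        also have "\<dots> \<le> (C1 + C2) * (1 / real N)"
          unfolding distrib_right[symmetric] using C1(1) C2(1) by (intro half_le mult_nonneg_nonneg) auto
        also have "\<dots> \<le> (C1 + C2) * \<bar>b N ^ 6 + 1 / real N\<bar>"
          using C1(1) C2(1) b by (intro mult_left_mono) auto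
        finally show ?case .
      qed
    qed
  qed
  have gradB: "grad_bias_B p W (b N) N (t\<^sub>0 N) (X N) (Xs u\<^sub>0) \<alpha> = gradB N" for N
    by (simp add: gradB_def)
  show ?thesis
    unfolding Let_def \<alpha>_def[symmetric] gradB
    by (intro conjI ballI allI impI 1 2 3 4 5 moments(1,2))
qed

end
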